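(* Let $R$ be a commutative unital ring. The category $\mathscr{C}_R$ is the additive completion of the biset category $\Omega_R$; that is, $\mathscr{C}_R$ is equivalent, as an $R$-linear category, to the additive completion $\mathrm{Add}(\Omega_R)$ of $\Omega_R$.
   Context: All groups and sets with group action are finite; actions are left actions unless stated otherwise. For a finite group $\Gamma$ and a finite $\Gamma$-set $Z$, $B(Z)$ denotes the Grothendieck group, for the relations given by disjoint union, of the category of finite $\Gamma$-sets over $Z$ (pairs $(S,\varphi)$ with $\varphi:S\to Z$ a morphism of $\Gamma$-sets; isomorphisms are $\Gamma$-isomorphisms commuting with the maps to $Z$). The category $\mathscr{C}_R$: Objects are pairs $(G,X)$ with $G$ a finite group and $X$ a finite $G$-set, written $\frac{X}{G}$ or $X/G$. Morphisms: given $X/G$ and $Y/H$, regard $X$ and $Y$ as $(H\times G)$-sets through the projections ($H$ acts trivially on $X$, $G$ acts trivially on $Y$), and set $\mathrm{Hom}_{\mathscr{C}_R}(X/G,Y/H)=RB^{H,G}(Y,X):=R\otimes_{\mathbb Z}B(Y\times X)$, with $Y\times X$ viewed as an $(H\times G)$-set. It is generated by the classes $\langle U,\beta,\alpha\rangle$ of spans $Y\xleftarrow{\beta}U\xrightarrow{\alpha}X$ of $(H\times G)$-sets. An $(H\times G)$-set is identified with an $(H,G)$-biset through $(h,g)u=hug^{-1}$; so $\beta(hug)=h\beta(u)$ and $\alpha(hug)=g^{-1}\alpha(u)$. Composition: for $\langle U,\beta,\alpha\rangle\in RB^{H,G}(Y,X)$ and $\langle V,\delta,\gamma\rangle\in RB^{K,H}(Z,Y)$,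 $\langle V,\delta,\gamma\rangle\circ\langle U,\beta,\alpha\rangle=\langle V\hat\times_HU,\hat\delta,\hat\alpha\rangle$, where $V\times_HU$ is the set of orbits $[v,u]$ of $V\times U$ under the right $H$-action $(v,u)\cdot h=(vh,h^{-1}u)$, $V\hat\times_HU=\{[v,u]\in V\times_HU\mid\gamma(v)=\beta(u)\}$ with the natural $(K\times G)$-action, $\hat\delta[v,u]=\delta(v)$, $\hat\alpha[v,u]=\alpha(u)$; this is extended $R$-bilinearly. Identity of $X/G$: $\langle G\times X,\underline1,\overline1\rangle$, with $(a,b)(g,x)=(agb^{-1},ax)$, $\underline1(g,x)=x$, $\overline1(g,x)=g^{-1}x$. The biset category $\Omega_R$: objects are all finite groups; morphisms from $G$ to $H$ are $RB(H,G)=R\otimes_{\mathbb Z}B(H\times G)$, where $B(H\times G)$ is the Burnside group (Grothendieck group for disjoint union) of finite $(H,G)$-bisets; composition is the bilinear extension of $(V,U)\mapsto V\times_HU$; the identity of $G$ is the class of the $(G,G)$-biset $G$. The additive completion $\mathrm{Add}(\Omega_R)$: objects are $n$-tuples ($n\ge 0$) of objects of $\Omega_R$; arrows are matrices of arrows of $\Omega_R$, composed by matrix multiplication. *)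

theory Defs
  imports
    "HOL-Algebra.Group_Action"
    "HOL-Algebra.Module"
    "HOL-Algebra.Free_Abelian_Groups"
    "HOL-Library.Infinite_Typeclass"
begin

section \<open>Linear categories and their equivalences\<close>

text \<open>
  \<open>Hom C X Y\<close> is the module of morphisms from \<open>X\<close> to \<open>Y\<close>, and \<open>Comp C X Y Z g f\<close> is \<open>g \<circ> f\<close> for
  \<open>f\<close> from \<open>X\<close> to \<open>Y\<close> and \<open>g\<close> from \<open>Y\<close> to \<open>Z\<close>. Hom-modules need not be disjoint, so operations on
  morphisms take source and target as arguments. The library's module record extends the ring
  record; its multiplicative fields carry no meaning here and are left undefined throughout.
\<close>

record ('o, 'm, 'r) lincat =
  Obj :: "'o set"
  Hom :: "'o \<Rightarrow> 'o \<Rightarrow> ('r, 'm) module"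
  Comp :: "'o \<Rightarrow> 'o \<Rightarrow> 'o \<Rightarrow> 'm \<Rightarrow> 'm \<Rightarrow> 'm"
  Ident :: "'o \<Rightarrow> 'm"

definition module_map ::
  "('r, 's) ring_scheme \<Rightarrow> ('r, 'm) module \<Rightarrow> ('r, 'n) module \<Rightarrow> ('m \<Rightarrow> 'n) \<Rightarrow> bool"
  where "module_map R M N f \<longleftrightarrow>
    f \<in> carrier M \<rightarrow> carrier N \<and>
    (\<forall>x \<in> carrier M. \<forall>y \<in> carrier M. f (x \<oplus>\<^bsub>M\<^esub> y) = f x \<oplus>\<^bsub>N\<^esub> f y) \<and>
    (\<forall>r \<in> carrier R. \<forall>x \<in> carrier M. f (r \<odot>\<^bsub>M\<^esub> x) = r \<odot>\<^bsub>N\<^esub> f x)"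

definition linear_category :: "('r, 's) ring_scheme \<Rightarrow> ('o, 'm, 'r) lincat \<Rightarrow> bool"
  where "linear_category R C \<longleftrightarrow>
    (\<forall>X \<in> Obj C. \<forall>Y \<in> Obj C. Module.module R (Hom C X Y)) \<and>
    (\<forall>X \<in> Obj C. Ident C X \<in> carrier (Hom C X X)) \<and>
    (\<forall>X \<in> Obj C. \<forall>Y \<in> Obj C. \<forall>Z \<in> Obj C. \<forall>g \<in> carrier (Hom C Y Z).
       module_map R (Hom C X Y) (Hom C X Z) (\<lambda>f. Comp C X Y Z g f)) \<and>
    (\<forall>X \<in> Obj C. \<forall>Y \<in> Obj C. \<forall>Z \<in> Obj C. \<forall>f \<in> carrier (Hom C X Y).
       module_map R (Hom C Y Z) (Hom C X Z) (\<lambda>g. Comp C X Y Z g f)) \<and>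
    (\<forall>X \<in> Obj C. \<forall>Y \<in> Obj C. \<forall>f \<in> carrier (Hom C X Y).
       Comp C X Y Y (Ident C Y) f = f \<and> Comp C X X Y f (Ident C X) = f) \<and>
    (\<forall>W \<in> Obj C. \<forall>X \<in> Obj C. \<forall>Y \<in> Obj C. \<forall>Z \<in> Obj C.
       \<forall>f \<in> carrier (Hom C W X). \<forall>g \<in> carrier (Hom C X Y). \<forall>h \<in> carrier (Hom C Y Z).
         Comp C W Y Z h (Comp C W X Y g f) = Comp C W X Z (Comp C X Y Z h g) f)"

definition linear_functor ::
  "('r, 's) ring_scheme \<Rightarrow> ('o, 'm, 'r) lincat \<Rightarrow> ('p, 'n, 'r) lincat \<Rightarrow>
   ('o \<Rightarrow> 'p) \<Rightarrow> ('o \<Rightarrow> 'o \<Rightarrow> 'm \<Rightarrow> 'n) \<Rightarrow> bool"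
  where "linear_functor R C D Fo Fm \<longleftrightarrow>
    Fo \<in> Obj C \<rightarrow> Obj D \<and>
    (\<forall>X \<in> Obj C. \<forall>Y \<in> Obj C. module_map R (Hom C X Y) (Hom D (Fo X) (Fo Y)) (Fm X Y)) \<and>
    (\<forall>X \<in> Obj C. Fm X X (Ident C X) = Ident D (Fo X)) \<and>
    (\<forall>X \<in> Obj C. \<forall>Y \<in> Obj C. \<forall>Z \<in> Obj C.
       \<forall>f \<in> carrier (Hom C X Y). \<forall>g \<in> carrier (Hom C Y Z).
         Fm X Z (Comp C X Y Z g f) = Comp D (Fo X) (Fo Y) (Fo Z) (Fm Y Z g) (Fm X Y f))"

definition iso_arrow :: "('o, 'm, 'r) lincat \<Rightarrow> 'o \<Rightarrow> 'o \<Rightarrow> 'm \<Rightarrow> bool"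
  where "iso_arrow C X Y f \<longleftrightarrow>
    f \<in> carrier (Hom C X Y) \<and>
    (\<exists>g \<in> carrier (Hom C Y X). Comp C X Y X g f = Ident C X \<and> Comp C Y X Y f g = Ident C Y)"

definition natural_iso ::
  "('o, 'm, 'r) lincat \<Rightarrow> ('p, 'n, 'r) lincat \<Rightarrow>
   ('o \<Rightarrow> 'p) \<Rightarrow> ('o \<Rightarrow> 'o \<Rightarrow> 'm \<Rightarrow> 'n) \<Rightarrow>
   ('o \<Rightarrow> 'p) \<Rightarrow> ('o \<Rightarrow> 'o \<Rightarrow> 'm \<Rightarrow> 'n) \<Rightarrow> ('o \<Rightarrow> 'n) \<Rightarrow> bool"
  where "natural_iso C D Fo Fm Go Gm \<eta> \<longleftrightarrow>
    (\<forall>X \<in> Obj C. iso_arrow D (Fo X) (Go X) (\<eta> X)) \<and>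
    (\<forall>X \<in> Obj C. \<forall>Y \<in> Obj C. \<forall>f \<in> carrier (Hom C X Y).
       Comp D (Fo X) (Fo Y) (Go Y) (\<eta> Y) (Fm X Y f) =
       Comp D (Fo X) (Go X) (Go Y) (Gm X Y f) (\<eta> X))"

definition linear_equivalent ::
  "('r, 's) ring_scheme \<Rightarrow> ('o, 'm, 'r) lincat \<Rightarrow> ('p, 'n, 'r) lincat \<Rightarrow> bool"
  where "linear_equivalent R C D \<longleftrightarrow>
    linear_category R C \<and> linear_category R D \<and>
    (\<exists>Fo Fm Go Gm \<eta> \<epsilon>.
       linear_functor R C D Fo Fm \<and> linear_functor R D C Go Gm \<and>
       natural_iso C C (\<lambda>X. X) (\<lambda>X Y f. f) (\<lambda>X. Go (Fo X)) (\<lambda>X Y f. Gm (Fo X) (Fo Y) (Fm X Y f)) \<eta> \<and>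
       natural_iso D D (\<lambda>X. Fo (Go X)) (\<lambda>X Y f. Fm (Go X) (Go Y) (Gm X Y f)) (\<lambda>X. X) (\<lambda>X Y f. f) \<epsilon>)"

section \<open>Additive completion\<close>

text \<open>
  Objects are lists of objects. An arrow from \<open>xs\<close> to \<open>ys\<close> is a matrix with rows indexed by \<open>ys\<close> and
  columns by \<open>xs\<close>, represented by a function that is undefined outside the index rectangle.
\<close>

definition mat_index :: "'o list \<Rightarrow> 'o list \<Rightarrow> (nat \<times> nat) set"
  where "mat_index xs ys = {..<length ys} \<times> {..<length xs}"

definition mat_hom :: "('o, 'm, 'r) lincat \<Rightarrow> 'o list \<Rightarrow> 'o list \<Rightarrow> ('r, nat \<times> nat \<Rightarrow> 'm) module"
  where "mat_hom D xs ys =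
    \<lparr>carrier = (\<Pi>\<^sub>E (i, j) \<in> mat_index xs ys. carrier (Hom D (xs ! j) (ys ! i))),
     monoid.mult = undefined, monoid.one = undefined,
     ring.zero = (\<lambda>(i, j) \<in> mat_index xs ys. \<zero>\<^bsub>Hom D (xs ! j) (ys ! i)\<^esub>),
     ring.add = (\<lambda>A B. \<lambda>(i, j) \<in> mat_index xs ys. A (i, j) \<oplus>\<^bsub>Hom D (xs ! j) (ys ! i)\<^esub> B (i, j)),
     module.smult = (\<lambda>r A. \<lambda>(i, j) \<in> mat_index xs ys. r \<odot>\<^bsub>Hom D (xs ! j) (ys ! i)\<^esub> A (i, j))\<rparr>"

definition additive_completion ::
  "('o, 'm, 'r) lincat \<Rightarrow> ('o list, nat \<times> nat \<Rightarrow> 'm, 'r) lincat"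
  where "additive_completion D =
    \<lparr>Obj = lists (Obj D),
     Hom = mat_hom D,
     Comp = (\<lambda>xs ys zs B A. \<lambda>(i, k) \<in> mat_index xs zs.
        \<Oplus>\<^bsub>Hom D (xs ! k) (zs ! i)\<^esub> j \<in> {..<length ys}.
          Comp D (xs ! k) (ys ! j) (zs ! i) (B (i, j)) (A (j, k))),
     Ident = (\<lambda>xs. \<lambda>(i, j) \<in> mat_index xs xs.
        if i = j then Ident D (xs ! i) else \<zero>\<^bsub>Hom D (xs ! j) (xs ! i)\<^esub>)\<rparr>"


section \<open>Abelian groups by generators and relations, and \<open>R \<otimes>\<^sub>\<int> M\<close>\<close>

type_synonym 'a frag = "'a \<Rightarrow>\<^sub>0 int"

definition presented_kernel :: "'a set \<Rightarrow> 'a frag set \<Rightarrow> 'a frag set"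
  where "presented_kernel S T = generate (free_Abelian_group S) T"

definition presented_group :: "'a set \<Rightarrow> 'a frag set \<Rightarrow> 'a frag set monoid"
  where "presented_group S T = free_Abelian_group S Mod presented_kernel S T"

definition presented_class :: "'a set \<Rightarrow> 'a frag set \<Rightarrow> 'a frag \<Rightarrow> 'a frag set"
  where "presented_class S T x = presented_kernel S T #>\<^bsub>free_Abelian_group S\<^esub> x"

definition coset_rep :: "'a set \<Rightarrow> 'a"
  where "coset_rep A = (SOME x. x \<in> A)"

definition frag_bilinear :: "('a \<Rightarrow> 'b \<Rightarrow> 'c frag) \<Rightarrow> 'a frag \<Rightarrow> 'b frag \<Rightarrow> 'c frag"
  where "frag_bilinear b x y = frag_extend (\<lambda>a. frag_extend (b a) y) x"

text \<open>
  \<open>M\<close> is an abelian group in the library's multiplicative notation. The two families of relations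
  make \<open>(r, m) \<mapsto> r \<otimes> m\<close> biadditive; balancedness over the integers is a consequence.
\<close>

definition tensor_rels ::
  "('r, 's) ring_scheme \<Rightarrow> 'm monoid \<Rightarrow> ('r \<times> 'm) frag set"
  where "tensor_rels R M =
    {frag_of (r \<oplus>\<^bsub>R\<^esub> s, m) - frag_of (r, m) - frag_of (s, m) | r s m.
       r \<in> carrier R \<and> s \<in> carrier R \<and> m \<in> carrier M} \<union>
    {frag_of (r, m \<otimes>\<^bsub>M\<^esub> n) - frag_of (r, m) - frag_of (r, n) | r m n.
       r \<in> carrier R \<and> m \<in> carrier M \<and> n \<in> carrier M}"

definition tensor_class ::
  "('r, 's) ring_scheme \<Rightarrow> 'm monoid \<Rightarrow> ('r \<times> 'm) frag \<Rightarrow> ('r \<times> 'm) frag set"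
  where "tensor_class R M x = presented_class (carrier R \<times> carrier M) (tensor_rels R M) x"

definition tensor_module ::
  "('r, 's) ring_scheme \<Rightarrow> 'm monoid \<Rightarrow> ('r, ('r \<times> 'm) frag set) module"
  where "tensor_module R M =
    (let Q = presented_group (carrier R \<times> carrier M) (tensor_rels R M) in
      \<lparr>carrier = carrier Q, monoid.mult = undefined, monoid.one = undefined,
       ring.zero = \<one>\<^bsub>Q\<^esub>, ring.add = (\<lambda>A B. A \<otimes>\<^bsub>Q\<^esub> B),
       module.smult = (\<lambda>r A. tensor_class R M
         (frag_extend (\<lambda>(s, m). frag_of (r \<otimes>\<^bsub>R\<^esub> s, m)) (coset_rep A)))\<rparr>)"

text \<open>
  The extension of scalars \<open>(r \<otimes> m, s \<otimes> n) \<mapsto> r s \<otimes> c m n\<close> of a biadditive map \<open>c\<close> with values in \<open>P\<close>.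
\<close>

definition tensor_bilinear ::
  "('r, 's) ring_scheme \<Rightarrow> 'p monoid \<Rightarrow> ('m \<Rightarrow> 'n \<Rightarrow> 'p) \<Rightarrow>
   ('r \<times> 'm) frag set \<Rightarrow> ('r \<times> 'n) frag set \<Rightarrow> ('r \<times> 'p) frag set"
  where "tensor_bilinear R P c A B =
    tensor_class R P
      (frag_bilinear (\<lambda>(r, m) (s, n). frag_of (r \<otimes>\<^bsub>R\<^esub> s, c m n)) (coset_rep A) (coset_rep B))"

text \<open>
  The Grothendieck group of a class \<open>S\<close> of objects: \<open>I\<close> is isomorphism, and \<open>D c a b\<close> says that \<open>c\<close> is
  isomorphic to the disjoint union of \<open>a\<close> and \<open>b\<close>.
\<close>

definition groth_rels ::
  "'a set \<Rightarrow> ('a \<Rightarrow> 'a \<Rightarrow> bool) \<Rightarrow> ('a \<Rightarrow> 'a \<Rightarrow> 'a \<Rightarrow> bool) \<Rightarrow> 'a frag set"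
  where "groth_rels S I D =
    {frag_of a - frag_of b | a b. a \<in> S \<and> b \<in> S \<and> I a b} \<union>
    {frag_of c - frag_of a - frag_of b | a b c. a \<in> S \<and> b \<in> S \<and> c \<in> S \<and> D c a b}"


section \<open>Finite sets with a group action\<close>

record ('k, 'u) gset =
  pts :: "'u set"
  act :: "'k \<Rightarrow> 'u \<Rightarrow> 'u"

record ('k, 'u, 'z) over_gset = "('k, 'u) gset" +
  anchor :: "'u \<Rightarrow> 'z"

text \<open>
  The library's \<open>group_action\<close> asks that each \<open>act S g\<close> be extensional, i.e. undefined outside \<open>pts S\<close>;
  hence the restricted abstractions in the constructions below.
\<close>

definition finite_gset :: "'k monoid \<Rightarrow> ('k, 'u, 'e) gset_scheme \<Rightarrow> bool"
  where "finite_gset \<Gamma> S \<longleftrightarrow> finite (pts S) \<and> group_action \<Gamma> (pts S) (act S)"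

definition gset_map ::
  "'k monoid \<Rightarrow> ('k, 'u, 'e) gset_scheme \<Rightarrow> ('k, 'v, 'f) gset_scheme \<Rightarrow> ('u \<Rightarrow> 'v) \<Rightarrow> bool"
  where "gset_map \<Gamma> S T f \<longleftrightarrow>
    f \<in> pts S \<rightarrow> pts T \<and>
    (\<forall>g \<in> carrier \<Gamma>. \<forall>s \<in> pts S. f (act S g s) = act T g (f s))"

definition gset_iso ::
  "'k monoid \<Rightarrow> ('k, 'u, 'e) gset_scheme \<Rightarrow> ('k, 'v, 'f) gset_scheme \<Rightarrow> bool"
  where "gset_iso \<Gamma> S T \<longleftrightarrow> (\<exists>f. gset_map \<Gamma> S T f \<and> bij_betw f (pts S) (pts T))"

definition gset_sum ::
  "('k, 'u, 'e) gset_scheme \<Rightarrow> ('k, 'v, 'f) gset_scheme \<Rightarrow> ('k, 'u + 'v) gset"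
  where "gset_sum S T =
    \<lparr>pts = pts S <+> pts T,
     act = (\<lambda>g. restrict (map_sum (act S g) (act T g)) (pts S <+> pts T))\<rparr>"

definition gset_over :: "'k monoid \<Rightarrow> ('k, 'z) gset \<Rightarrow> ('k, 'u, 'z) over_gset \<Rightarrow> bool"
  where "gset_over \<Gamma> Z S \<longleftrightarrow> finite_gset \<Gamma> S \<and> gset_map \<Gamma> S Z (anchor S)"

definition over_iso :: "'k monoid \<Rightarrow> ('k, 'u, 'z) over_gset \<Rightarrow> ('k, 'v, 'z) over_gset \<Rightarrow> bool"
  where "over_iso \<Gamma> S T \<longleftrightarrow>
    (\<exists>f. gset_map \<Gamma> S T f \<and> bij_betw f (pts S) (pts T) \<and>
         (\<forall>s \<in> pts S. anchor T (f s) = anchor S s))"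

definition over_sum ::
  "('k, 'u, 'z) over_gset \<Rightarrow> ('k, 'v, 'z) over_gset \<Rightarrow> ('k, 'u + 'v, 'z) over_gset"
  where "over_sum S T =
    \<lparr>pts = pts S <+> pts T,
     act = (\<lambda>g. restrict (map_sum (act S g) (act T g)) (pts S <+> pts T)),
     anchor = case_sum (anchor S) (anchor T)\<rparr>"

text \<open>
  The generators of the Grothendieck groups have underlying sets of natural numbers, which represents
  every isomorphism class. The class of a finite set with action over any other type is that of an
  isomorphic copy inside the natural numbers.
\<close>

definition gsets :: "'k monoid \<Rightarrow> ('k, nat) gset set"
  where "gsets \<Gamma> = {S. finite_gset \<Gamma> S}"

definition burnside_rels :: "'k monoid \<Rightarrow> ('k, nat) gset frag set"
  where "burnside_rels \<Gamma> =
    groth_rels (gsets \<Gamma>) (gset_iso \<Gamma>) (\<lambda>C A B. gset_iso \<Gamma> C (gset_sum A B))"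

definition burnside :: "'k monoid \<Rightarrow> ('k, nat) gset frag set monoid"
  where "burnside \<Gamma> = presented_group (gsets \<Gamma>) (burnside_rels \<Gamma>)"

definition burnside_class :: "'k monoid \<Rightarrow> ('k, nat) gset frag \<Rightarrow> ('k, nat) gset frag set"
  where "burnside_class \<Gamma> x = presented_class (gsets \<Gamma>) (burnside_rels \<Gamma>) x"

definition gset_copy :: "'k monoid \<Rightarrow> ('k, 'u) gset \<Rightarrow> ('k, nat) gset"
  where "gset_copy \<Gamma> S = (SOME T. T \<in> gsets \<Gamma> \<and> gset_iso \<Gamma> S T)"

definition gsets_over :: "'k monoid \<Rightarrow> ('k, 'z) gset \<Rightarrow> ('k, nat, 'z) over_gset set"
  where "gsets_over \<Gamma> Z = {S. gset_over \<Gamma> Z S}"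

definition over_burnside_rels :: "'k monoid \<Rightarrow> ('k, 'z) gset \<Rightarrow> ('k, nat, 'z) over_gset frag set"
  where "over_burnside_rels \<Gamma> Z =
    groth_rels (gsets_over \<Gamma> Z) (over_iso \<Gamma>) (\<lambda>C A B. over_iso \<Gamma> C (over_sum A B))"

definition over_burnside ::
  "'k monoid \<Rightarrow> ('k, 'z) gset \<Rightarrow> ('k, nat, 'z) over_gset frag set monoid"
  where "over_burnside \<Gamma> Z = presented_group (gsets_over \<Gamma> Z) (over_burnside_rels \<Gamma> Z)"

definition over_burnside_class ::
  "'k monoid \<Rightarrow> ('k, 'z) gset \<Rightarrow> ('k, nat, 'z) over_gset frag \<Rightarrow> ('k, nat, 'z) over_gset frag set"
  where "over_burnside_class \<Gamma> Z x =
    presented_class (gsets_over \<Gamma> Z) (over_burnside_rels \<Gamma> Z) x"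

definition over_copy ::
  "'k monoid \<Rightarrow> ('k, 'z) gset \<Rightarrow> ('k, 'u, 'z) over_gset \<Rightarrow> ('k, nat, 'z) over_gset"
  where "over_copy \<Gamma> Z S = (SOME T. T \<in> gsets_over \<Gamma> Z \<and> over_iso \<Gamma> S T)"


section \<open>Composition of bisets and of spans\<close>

text \<open>
  An \<open>(H, G)\<close>-biset is an \<open>(H \<times> G)\<close>-set through \<open>(h, g) u = h u g\<inverse>\<close>.
\<close>

definition lmul :: "'g monoid \<Rightarrow> ('h \<times> 'g, 'u, 'e) gset_scheme \<Rightarrow> 'h \<Rightarrow> 'u \<Rightarrow> 'u"
  where "lmul G U h u = act U (h, \<one>\<^bsub>G\<^esub>) u"

definition rmul ::
  "'h monoid \<Rightarrow> 'g monoid \<Rightarrow> ('h \<times> 'g, 'u, 'e) gset_scheme \<Rightarrow> 'u \<Rightarrow> 'g \<Rightarrow> 'u"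
  where "rmul H G U u g = act U (\<one>\<^bsub>H\<^esub>, inv\<^bsub>G\<^esub> g) u"

text \<open>
  \<open>bal_class K H G V U v u\<close> is the orbit of \<open>(v, u)\<close> under the right action of \<open>H\<close> given by
  \<open>(v, u) h = (v h, h\<inverse> u)\<close>, for a \<open>(K, H)\<close>-biset \<open>V\<close> and an \<open>(H, G)\<close>-biset \<open>U\<close>.
\<close>

definition bal_class ::
  "'k monoid \<Rightarrow> 'h monoid \<Rightarrow> 'g monoid \<Rightarrow>
   ('k \<times> 'h, 'v, 'e) gset_scheme \<Rightarrow> ('h \<times> 'g, 'u, 'f) gset_scheme \<Rightarrow>
   'v \<Rightarrow> 'u \<Rightarrow> ('v \<times> 'u) set"
  where "bal_class K H G V U v u =
    {(rmul K H V v h, lmul G U (inv\<^bsub>H\<^esub> h) u) | h. h \<in> carrier H}"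

definition bal_act ::
  "'k monoid \<Rightarrow> 'h monoid \<Rightarrow> 'g monoid \<Rightarrow>
   ('k \<times> 'h, 'v, 'e) gset_scheme \<Rightarrow> ('h \<times> 'g, 'u, 'f) gset_scheme \<Rightarrow>
   'k \<times> 'g \<Rightarrow> ('v \<times> 'u) set \<Rightarrow> ('v \<times> 'u) set"
  where "bal_act K H G V U =
    (\<lambda>(k, g) c. (\<lambda>(v, u). (lmul H V k v, rmul H G U u (inv\<^bsub>G\<^esub> g))) ` c)"

definition biset_comp ::
  "'k monoid \<Rightarrow> 'h monoid \<Rightarrow> 'g monoid \<Rightarrow>
   ('k \<times> 'h, 'v) gset \<Rightarrow> ('h \<times> 'g, 'u) gset \<Rightarrow> ('k \<times> 'g, ('v \<times> 'u) set) gset"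
  where "biset_comp K H G V U =
    (let P = {bal_class K H G V U v u | v u. v \<in> pts V \<and> u \<in> pts U} in
      \<lparr>pts = P, act = (\<lambda>a. restrict (bal_act K H G V U a) P)\<rparr>)"

text \<open>
  A span from \<open>X\<close> to \<open>Y\<close> has its two legs combined into one anchor \<open>(\<beta>, \<alpha>)\<close> with values in \<open>Y \<times> X\<close>.
\<close>

definition span_comp ::
  "'k monoid \<Rightarrow> 'h monoid \<Rightarrow> 'g monoid \<Rightarrow>
   ('k \<times> 'h, 'v, 'z \<times> 'y) over_gset \<Rightarrow> ('h \<times> 'g, 'u, 'y \<times> 'x) over_gset \<Rightarrow>
   ('k \<times> 'g, ('v \<times> 'u) set, 'z \<times> 'x) over_gset"
  where "span_comp K H G V U =
    (let P = {bal_class K H G V U v u | v u.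
                v \<in> pts V \<and> u \<in> pts U \<and> snd (anchor V v) = fst (anchor U u)} in
      \<lparr>pts = P, act = (\<lambda>a. restrict (bal_act K H G V U a) P),
       anchor = (\<lambda>c. let (v, u) = coset_rep c in (fst (anchor V v), snd (anchor U u)))\<rparr>)"

definition biset_ident :: "'g monoid \<Rightarrow> ('g \<times> 'g, 'g) gset"
  where "biset_ident G =
    \<lparr>pts = carrier G,
     act = (\<lambda>(a, b). \<lambda>g \<in> carrier G. a \<otimes>\<^bsub>G\<^esub> g \<otimes>\<^bsub>G\<^esub> inv\<^bsub>G\<^esub> b)\<rparr>"

definition span_ident ::
  "'g monoid \<Rightarrow> ('g, 'x) gset \<Rightarrow> ('g \<times> 'g, 'g \<times> 'x, 'x \<times> 'x) over_gset"
  where "span_ident G X =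
    \<lparr>pts = carrier G \<times> pts X,
     act = (\<lambda>(a, b). \<lambda>(g, x) \<in> carrier G \<times> pts X. (a \<otimes>\<^bsub>G\<^esub> g \<otimes>\<^bsub>G\<^esub> inv\<^bsub>G\<^esub> b, act X a x)),
     anchor = (\<lambda>(g, x). (x, act X (inv\<^bsub>G\<^esub> g) x))\<rparr>"

definition gset_prod ::
  "('h, 'y) gset \<Rightarrow> ('g, 'x) gset \<Rightarrow> ('h \<times> 'g, 'y \<times> 'x) gset"
  where "gset_prod Y X =
    \<lparr>pts = pts Y \<times> pts X,
     act = (\<lambda>(h, g). \<lambda>(y, x) \<in> pts Y \<times> pts X. (act Y h y, act X g x))\<rparr>"


section \<open>The biset category and the category of spans\<close>

text \<open>
  The type \<open>'g\<close> is the universe from which the underlying sets of groups are taken, and \<open>'x\<close> the one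
  for the sets they act on. Every finite group and finite set occurs up to isomorphism as soon as
  these types are infinite.
\<close>

definition biset_bilinear ::
  "'k monoid \<Rightarrow> 'h monoid \<Rightarrow> 'g monoid \<Rightarrow>
   ('k \<times> 'h, nat) gset frag set \<Rightarrow> ('h \<times> 'g, nat) gset frag set \<Rightarrow>
   ('k \<times> 'g, nat) gset frag set"
  where "biset_bilinear K H G A B =
    burnside_class (K \<times>\<times> G)
      (frag_bilinear (\<lambda>V U. frag_of (gset_copy (K \<times>\<times> G) (biset_comp K H G V U)))
        (coset_rep A) (coset_rep B))"

definition biset_category ::
  "('r, 's) ring_scheme \<Rightarrow>
   ('g monoid, ('r \<times> ('g \<times> 'g, nat) gset frag set) frag set, 'r) lincat"
  where "biset_category R =
    \<lparr>Obj = {G. group G \<and> finite (carrier G)},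
     Hom = (\<lambda>G H. tensor_module R (burnside (H \<times>\<times> G))),
     Comp = (\<lambda>G H K. tensor_bilinear R (burnside (K \<times>\<times> G)) (biset_bilinear K H G)),
     Ident = (\<lambda>G. tensor_class R (burnside (G \<times>\<times> G))
        (frag_of (\<one>\<^bsub>R\<^esub>, burnside_class (G \<times>\<times> G)
           (frag_of (gset_copy (G \<times>\<times> G) (biset_ident G))))))\<rparr>"

definition span_bilinear ::
  "'k monoid \<Rightarrow> 'h monoid \<Rightarrow> 'g monoid \<Rightarrow> ('k, 'z) gset \<Rightarrow> ('g, 'x) gset \<Rightarrow>
   ('k \<times> 'h, nat, 'z \<times> 'y) over_gset frag set \<Rightarrow> ('h \<times> 'g, nat, 'y \<times> 'x) over_gset frag set \<Rightarrow>
   ('k \<times> 'g, nat, 'z \<times> 'x) over_gset frag set"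
  where "span_bilinear K H G Z X A B =
    over_burnside_class (K \<times>\<times> G) (gset_prod Z X)
      (frag_bilinear
        (\<lambda>V U. frag_of (over_copy (K \<times>\<times> G) (gset_prod Z X) (span_comp K H G V U)))
        (coset_rep A) (coset_rep B))"

definition span_category ::
  "('r, 's) ring_scheme \<Rightarrow>
   ('g monoid \<times> ('g, 'x) gset,
    ('r \<times> ('g \<times> 'g, nat, 'x \<times> 'x) over_gset frag set) frag set, 'r) lincat"
  where "span_category R =
    \<lparr>Obj = {(G, X). group G \<and> finite (carrier G) \<and> finite_gset G X},
     Hom = (\<lambda>(G, X) (H, Y). tensor_module R (over_burnside (H \<times>\<times> G) (gset_prod Y X))),
     Comp = (\<lambda>(G, X) (H, Y) (K, Z).
        tensor_bilinear R (over_burnside (K \<times>\<times> G) (gset_prod Z X)) (span_bilinear K H G Z X)),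
     Ident = (\<lambda>(G, X). tensor_class R (over_burnside (G \<times>\<times> G) (gset_prod X X))
        (frag_of (\<one>\<^bsub>R\<^esub>, over_burnside_class (G \<times>\<times> G) (gset_prod X X)
           (frag_of (over_copy (G \<times>\<times> G) (gset_prod X X) (span_ident G X))))))\<rparr>"

end

theory Submission
  imports Defs "HOL-Algebra.Weak_Morphisms"
begin


text \<open>
  The biset category is the full subcategory of \<open>\<C>\<^sub>R\<close> on the objects \<open>pt/G\<close>: a set over a point
  is just a set, so forgetting the anchors identifies the two modules of morphisms. In \<open>\<C>\<^sub>R\<close> every
  \<open>X/G\<close> is the biproduct of the \<open>pt/G\<^sub>x\<close>, with \<open>x\<close> running over representatives of the orbits. The
  injection and the projection at \<open>x\<close> are both carried by the set \<open>G\<close>, with legs \<open>g \<mapsto> g x\<close> and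
  \<open>g \<mapsto> g\<inverse> x\<close>; multiplication in \<open>G\<close> identifies their composites with the biset \<open>G\<^sub>x\<close> and with the
  part of the identity span lying over the orbit of \<open>x\<close>. Conversely, finite groups \<open>G\<^sub>1, \<dots>, G\<^sub>n\<close>
  embed in their product \<open>G\<close>, and the disjoint union of the \<open>G/G\<^sub>i\<close> is a \<open>G\<close>-set with point
  stabilizers \<open>G\<^sub>1, \<dots>, G\<^sub>n\<close>. Taking matrix coordinates with respect to such decompositions is the
  equivalence. All identities between morphisms are checked on the classes of spans, where they
  reduce to isomorphisms of sets over \<open>Z \<times> X\<close>.
\<close>

section \<open>Presented abelian groups and extension of scalars\<close>

text \<open>Morphism modules are quotients of free abelian groups, and scalars and composition act
  on a Hilbert-chosen representative of a coset. Independence of that choice is settled once for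
  linear and once for bilinear operations; afterwards arrows are seen through the classes
  \<open>1 \<otimes> [S]\<close>, which generate over \<open>R\<close>. Passing to isomorphic copies
  also frees these classes from sets of natural numbers, so that explicit isomorphisms may use
  pairs, orbits and group elements as points. The category axioms of the additive completion are not
  verified by hand: coordinates are bijective, linear and multiplicative, so the laws of matrices
  are inherited from spans. This requires every list of groups to be the label of some
  decomposition, which is at the same time essential surjectivity.\<close>

lemma keys_add_subset:
  "Poly_Mapping.keys x \<subseteq> S \<Longrightarrow> Poly_Mapping.keys y \<subseteq> S \<Longrightarrow> Poly_Mapping.keys (x + y) \<subseteq> S"
  by (meson Un_least keys_add order_trans)

lemma keys_diff_subset:
  "Poly_Mapping.keys x \<subseteq> S \<Longrightarrow> Poly_Mapping.keys y \<subseteq> S \<Longrightarrow> Poly_Mapping.keys (x - y :: 'a frag) \<subseteq> S"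
  by (meson Un_least keys_diff order_trans)

lemma keys_frag_extend_subset:
  assumes "Poly_Mapping.keys x \<subseteq> S" "\<And>s. s \<in> S \<Longrightarrow> Poly_Mapping.keys (f s) \<subseteq> S'"
  shows "Poly_Mapping.keys (frag_extend f x) \<subseteq> S'"
  using assms keys_frag_extend[of f x] by blast

text \<open>The library's induction closes under differences. Running it for \<open>P c\<close>
  together with \<open>P (- c)\<close> trades them for sums and negated generators, the form in
  which a pure tensor can absorb the sign.\<close>

lemma frag_induct_sum [consumes 1, case_names zero of neg add]:
  assumes "Poly_Mapping.keys c \<subseteq> S" "P 0" "\<And>x. x \<in> S \<Longrightarrow> P (frag_of x)"
    "\<And>x. x \<in> S \<Longrightarrow> P (- frag_of x)"
    "\<And>a b. P a \<Longrightarrow> P b \<Longrightarrow> Poly_Mapping.keys a \<subseteq> S \<Longrightarrow> Poly_Mapping.keys b \<subseteq> S \<Longrightarrow> P (a + b)"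
  shows "P c"
proof -
  have "Poly_Mapping.keys c \<subseteq> S \<and> P c \<and> P (- c)"
    using assms(1)
  proof (induction c rule: frag_induction)
    case (diff a b)
    have "P (a - b)" "P (b - a)"
      using diff assms(5)[of a "- b"] assms(5)[of b "- a"] by auto
    then show ?case using diff keys_diff_subset by auto
  qed (use assms in auto)
  then show ?thesis by blast
qed

lemma frag_bilinear_simps:
  fixes b :: "'a \<Rightarrow> 'b \<Rightarrow> 'c frag"
  shows
  "frag_bilinear b 0 y = 0"
  "frag_bilinear b x 0 = 0"
  "frag_bilinear b (x + x') y = frag_bilinear b x y + frag_bilinear b x' y"
  "frag_bilinear b x (y + y') = frag_bilinear b x y + frag_bilinear b x y'"
  "frag_bilinear b (x - x') y = frag_bilinear b x y - frag_bilinear b x' y"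
  "frag_bilinear b x (y - y') = frag_bilinear b x y - frag_bilinear b x y'"
  "frag_bilinear b (- x) y = - frag_bilinear b x y"
  "frag_bilinear b x (- y) = - frag_bilinear b x y"
  "frag_bilinear b (frag_of s) y = frag_extend (b s) y"
proof -
  \<comment> \<open>Linearity in the first argument is that of \<open>frag_extend\<close>; for the
    second, the outer \<open>frag_extend\<close> must be additive in the function that it
    extends.\<close>
  have add: "frag_extend (\<lambda>a. f a + g a) x = frag_extend f x + frag_extend g x"
    for f g :: "'a \<Rightarrow> 'c frag" and x :: "'a frag"
    by (simp add: frag_extend_def frag_cmul_distrib2 sum.distrib)
  have neg: "frag_extend (\<lambda>a. - f a) x = - frag_extend f x" for f :: "'a \<Rightarrow> 'c frag" and x :: "'a frag"
    using add[of f "\<lambda>a. - f a" x] by (simp add: minus_unique[symmetric] frag_extend_eq_0)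
  show "frag_bilinear b x (y + y') = frag_bilinear b x y + frag_bilinear b x y'"
    by (simp add: frag_bilinear_def frag_extend_add add)
  show "frag_bilinear b x (- y) = - frag_bilinear b x y"
    by (simp add: frag_bilinear_def frag_extend_minus neg)
  show "frag_bilinear b x (y - y') = frag_bilinear b x y - frag_bilinear b x y'"
    using add[of "\<lambda>a. frag_extend (b a) y" "\<lambda>a. - frag_extend (b a) y'" x]
    by (simp add: frag_bilinear_def frag_extend_diff neg)
  show "frag_bilinear b x 0 = 0" by (simp add: frag_bilinear_def frag_extend_eq_0)
qed (simp_all add: frag_bilinear_def frag_extend_add frag_extend_diff frag_extend_minus)

lemma keys_frag_bilinear_subset:
  assumes "Poly_Mapping.keys x \<subseteq> S" "Poly_Mapping.keys y \<subseteq> S'"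
    "\<And>s s'. s \<in> S \<Longrightarrow> s' \<in> S' \<Longrightarrow> Poly_Mapping.keys (b s s') \<subseteq> S''"
  shows "Poly_Mapping.keys (frag_bilinear b x y) \<subseteq> S''"
  unfolding frag_bilinear_def by (intro keys_frag_extend_subset[OF assms(1)] keys_frag_extend_subset[OF assms(2)] assms(3))

section \<open>Quotients of free abelian groups by relations\<close>

locale presentation =
  fixes S :: "'a set" and T :: "'a frag set"
  assumes keys_rels: "t \<in> T \<Longrightarrow> Poly_Mapping.keys t \<subseteq> S"
begin

abbreviation "K \<equiv> presented_kernel S T"
abbreviation "cls \<equiv> presented_class S T"
abbreviation "Q \<equiv> presented_group S T"

lemma kernel_subgroup: "subgroup K (free_Abelian_group S)"
  unfolding presented_kernel_def
  by (rule group.generate_is_subgroup) (use keys_rels in auto)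

lemma kernel_normal: "K \<lhd> free_Abelian_group S"
  using comm_group.subgroup_imp_normal[OF abelian_free_Abelian_group kernel_subgroup] .

lemma keys_kernel: "x \<in> K \<Longrightarrow> Poly_Mapping.keys x \<subseteq> S"
  using subgroup.subset[OF kernel_subgroup] by (metis carrier_free_Abelian_group_iff subsetD)

lemma kernel_zero: "0 \<in> K"
  using subgroup.one_closed[OF kernel_subgroup] by simp

lemma kernel_add: "x \<in> K \<Longrightarrow> y \<in> K \<Longrightarrow> x + y \<in> K"
  using subgroup.m_closed[OF kernel_subgroup] by fastforce

lemma kernel_minus: "x \<in> K \<Longrightarrow> - x \<in> K"
  using subgroup.m_inv_closed[OF kernel_subgroup] keys_kernel by fastforce

lemma kernel_diff: "x \<in> K \<Longrightarrow> y \<in> K \<Longrightarrow> x - y \<in> K"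
  using kernel_add[of x "- y"] kernel_minus by simp

lemma kernel_rel: "t \<in> T \<Longrightarrow> t \<in> K"
  unfolding presented_kernel_def by (rule generate.incl)

text \<open>Closure under differences covers both inverses and products of \<open>generate\<close>:
  \<open>- h\<close> is \<open>0 - h\<close>, and \<open>a + b\<close> is
  \<open>a - (0 - b)\<close>.\<close>

lemma kernel_induct [consumes 1, case_names zero rel diff]:
  assumes "x \<in> K" "P 0" "\<And>t. t \<in> T \<Longrightarrow> P t" "\<And>a b. P a \<Longrightarrow> P b \<Longrightarrow> P (a - b)"
  shows "P x"
  using assms(1) unfolding presented_kernel_def
proof (induction x rule: generate.induct)
  case (inv h)
  then show ?case using assms(4)[OF assms(2) assms(3)] keys_rels by simp
next
  case (eng a b)
  then show ?case using assms(4)[OF eng.IH(1) assms(4)[OF assms(2) eng.IH(2)]] by simp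
qed (use assms in auto)

lemma cls_eq_iff:
  "cls x = cls y \<longleftrightarrow> x - y \<in> K" if "Poly_Mapping.keys x \<subseteq> S" "Poly_Mapping.keys y \<subseteq> S"
proof -
  have mem: "z \<in> cls w \<longleftrightarrow> z - w \<in> K" for z w
    by (force simp: presented_class_def r_coset_def)
  show ?thesis
  proof
    assume "cls x = cls y"
    then show "x - y \<in> K" using mem[of x x] mem[of x y] kernel_zero by simp
  next
    assume *: "x - y \<in> K"
    have "z - x \<in> K \<longleftrightarrow> z - y \<in> K" for z
      using kernel_add[of "z - x" "x - y"] kernel_diff[of "z - y" "x - y"] * by auto
    then show "cls x = cls y" using mem by blast
  qed
qed

text \<open>This is all that is known about the choice \<open>coset_rep\<close>: it stays among the
  formal sums over \<open>S\<close> and differs from a given representative by an element of the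
  kernel.\<close>

lemma rep_cls:
  assumes "Poly_Mapping.keys x \<subseteq> S"
  shows "coset_rep (cls x) - x \<in> K" "Poly_Mapping.keys (coset_rep (cls x)) \<subseteq> S"
proof -
  have "x \<in> cls x" using kernel_zero by (force simp: presented_class_def r_coset_def)
  then have "coset_rep (cls x) \<in> cls x" unfolding coset_rep_def by (rule someI)
  then show *: "coset_rep (cls x) - x \<in> K" by (force simp: presented_class_def r_coset_def)
  show "Poly_Mapping.keys (coset_rep (cls x)) \<subseteq> S"
    using keys_add_subset[OF keys_kernel[OF *] assms] by simp
qed

lemma carrier_Q: "carrier Q = cls ` {x. Poly_Mapping.keys x \<subseteq> S}"
  by (auto simp: presented_group_def FactGroup_def RCOSETS_def presented_class_def)

lemma carrier_QE:
  assumes "A \<in> carrier Q" obtains x where "Poly_Mapping.keys x \<subseteq> S" "A = cls x"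
  using assms carrier_Q by auto

lemma cls_closed: "Poly_Mapping.keys x \<subseteq> S \<Longrightarrow> cls x \<in> carrier Q"
  using carrier_Q by auto

lemma cls_mult:
  "Poly_Mapping.keys x \<subseteq> S \<Longrightarrow> Poly_Mapping.keys y \<subseteq> S \<Longrightarrow> cls x \<otimes>\<^bsub>Q\<^esub> cls y = cls (x + y)"
  unfolding presented_group_def FactGroup_def presented_class_def
  using normal.rcos_sum[OF kernel_normal, of x y] by simp

lemma one_Q: "\<one>\<^bsub>Q\<^esub> = cls 0"
  using group.coset_mult_one[OF group_free_Abelian_group subgroup.subset[OF kernel_subgroup]]
  unfolding presented_group_def FactGroup_def presented_class_def by simp

lemma comm_group_Q: "comm_group Q"
  unfolding presented_group_def
  by (rule comm_group.abelian_FactGroup[OF abelian_free_Abelian_group kernel_subgroup])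

end


text \<open>The chosen representative differs from \<open>x\<close> by a kernel element, and
  \<open>frag_extend f\<close> maps kernel to kernel because it does so on the relations that
  generate it.\<close>

lemma induced_linear:
  assumes "presentation S T" "presentation S' T'"
    and f: "\<And>s. s \<in> S \<Longrightarrow> Poly_Mapping.keys (f s) \<subseteq> S'"
    and rel: "\<And>t. t \<in> T \<Longrightarrow> frag_extend f t \<in> presented_kernel S' T'"
    and x: "Poly_Mapping.keys x \<subseteq> S"
  shows "presented_class S' T' (frag_extend f (coset_rep (presented_class S T x))) =
    presented_class S' T' (frag_extend f x)"
proof -
  interpret A: presentation S T by fact
  interpret B: presentation S' T' by fact
  have *: "frag_extend f k \<in> B.K" if "k \<in> A.K" for k
    using that by (induction k rule: A.kernel_induct) (auto simp: B.kernel_zero rel frag_extend_diff B.kernel_diff)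
  show ?thesis
    using A.rep_cls[OF x] x *[of "coset_rep (A.cls x) - x"]
    by (subst B.cls_eq_iff) (simp_all add: frag_extend_diff keys_frag_extend_subset[OF _ f])
qed

text \<open>This makes composition, defined on chosen representatives, a function of the classes. It
  is used twice: for the tensor product with the scalars and for the Grothendieck groups
  themselves.\<close>

lemma induced_bilinear:
  assumes "presentation S1 T1" "presentation S2 T2" "presentation S3 T3"
    and b: "\<And>s t. s \<in> S1 \<Longrightarrow> t \<in> S2 \<Longrightarrow> Poly_Mapping.keys (b s t) \<subseteq> S3"
    and rel1: "\<And>t s. t \<in> T1 \<Longrightarrow> s \<in> S2 \<Longrightarrow> frag_bilinear b t (frag_of s) \<in> presented_kernel S3 T3"
    and rel2: "\<And>s t. s \<in> S1 \<Longrightarrow> t \<in> T2 \<Longrightarrow> frag_bilinear b (frag_of s) t \<in> presented_kernel S3 T3"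
    and x: "Poly_Mapping.keys x \<subseteq> S1" and y: "Poly_Mapping.keys y \<subseteq> S2"
  shows "presented_class S3 T3 (frag_bilinear b (coset_rep (presented_class S1 T1 x))
      (coset_rep (presented_class S2 T2 y))) =
    presented_class S3 T3 (frag_bilinear b x y)"
proof -
  interpret A: presentation S1 T1 by fact
  interpret B: presentation S2 T2 by fact
  interpret C: presentation S3 T3 by fact
  note simps = frag_bilinear_simps C.kernel_zero C.kernel_diff C.kernel_add C.kernel_minus
  \<comment> \<open>Two nested inductions, over the kernel in one variable and over formal sums in
    the other, reduce the claim to a relation paired with a generator.\<close>
  have 1: "frag_bilinear b k z \<in> C.K" if k: "k \<in> A.K" and z: "Poly_Mapping.keys z \<subseteq> S2" for k z
    using k
  proof (induction k rule: A.kernel_induct)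
    case (rel t)
    show ?case using z by (induction z rule: frag_induction) (use rel1[OF rel] in \<open>auto simp: frag_bilinear_simps(1-8) C.kernel_zero C.kernel_diff\<close>)
  qed (auto simp: simps)
  have 2: "frag_bilinear b z k \<in> C.K" if k: "k \<in> B.K" and z: "Poly_Mapping.keys z \<subseteq> S1" for k z
    using k
  proof (induction k rule: B.kernel_induct)
    case (rel t)
    show ?case using z by (induction z rule: frag_induction) (use rel2[OF _ rel] in \<open>auto simp: simps\<close>)
  qed (auto simp: simps)
  define x' y' where "x' = coset_rep (A.cls x)" and "y' = coset_rep (B.cls y)"
  note x' = A.rep_cls[OF x, folded x'_def] and y' = B.rep_cls[OF y, folded y'_def]
  \<comment> \<open>The two representatives are exchanged one at a time, so that each summand has a
    kernel element in one variable.\<close>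
  have "frag_bilinear b x' y' - frag_bilinear b x y
    = frag_bilinear b (x' - x) y' + frag_bilinear b x (y' - y)"
    by (simp add: frag_bilinear_simps)
  also have "\<dots> \<in> C.K" using 1 2 x x' y' by (auto intro!: C.kernel_add)
  finally show ?thesis using x y x' y'
    by (subst C.cls_eq_iff) (simp_all add: x'_def y'_def keys_frag_bilinear_subset[OF _ _ b])
qed

section \<open>The \<open>R\<close>-module obtained from an abelian group by extension of
  scalars\<close>

locale scalar_extension =
  fixes R :: "('r, 's) ring_scheme" (structure) and M :: "'m monoid"
  assumes R: "cring R" and M: "comm_group M"
begin

abbreviation "RM \<equiv> tensor_module R M"
abbreviation "tcls \<equiv> tensor_class R M"
abbreviation "tens r m \<equiv> tcls (frag_of (r, m))"

sublocale R: cring R by (rule R)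
sublocale M: comm_group M by (rule M)

sublocale tensor: presentation "carrier R \<times> carrier M" "tensor_rels R M"
proof
  have "Poly_Mapping.keys (frag_of a - frag_of b - frag_of c) \<subseteq> carrier R \<times> carrier M"
    if "a \<in> carrier R \<times> carrier M" "b \<in> carrier R \<times> carrier M" "c \<in> carrier R \<times> carrier M" for a b c
    by (intro keys_diff_subset) (use that in auto)
  note keys = this
  fix t assume "t \<in> tensor_rels R M"
  then show "Poly_Mapping.keys t \<subseteq> carrier R \<times> carrier M"
    unfolding tensor_rels_def by (elim UnE CollectE exE conjE) (simp_all add: keys)
qed

lemma carrier_RM: "carrier RM = tcls ` {x. Poly_Mapping.keys x \<subseteq> carrier R \<times> carrier M}"
  by (simp add: tensor_module_def Let_def tensor.carrier_Q tensor_class_def)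

lemma add_RM:
  "Poly_Mapping.keys x \<subseteq> carrier R \<times> carrier M \<Longrightarrow> Poly_Mapping.keys y \<subseteq> carrier R \<times> carrier M \<Longrightarrow>
    tcls x \<oplus>\<^bsub>RM\<^esub> tcls y = tcls (x + y)"
  by (simp add: tensor_module_def Let_def tensor.cls_mult tensor_class_def)

lemma zero_RM: "\<zero>\<^bsub>RM\<^esub> = tcls 0"
  by (simp add: tensor_module_def Let_def tensor.one_Q tensor_class_def)

lemma keys_scale:
  "r \<in> carrier R \<Longrightarrow> Poly_Mapping.keys x \<subseteq> carrier R \<times> carrier M \<Longrightarrow>
    Poly_Mapping.keys (frag_extend (\<lambda>(s, m). frag_of (r \<otimes> s, m)) x) \<subseteq> carrier R \<times> carrier M"
  by (rule keys_frag_extend_subset) auto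

text \<open>Multiplying the first tensor factor by \<open>r\<close> turns every defining relation
  into a relation of the same family, by distributivity in the first family and directly in the
  second.\<close>

lemma smult_RM:
  assumes "r \<in> carrier R" "Poly_Mapping.keys x \<subseteq> carrier R \<times> carrier M"
  shows "r \<odot>\<^bsub>RM\<^esub> tcls x = tcls (frag_extend (\<lambda>(s, m). frag_of (r \<otimes> s, m)) x)"
proof -
  have "frag_extend (\<lambda>(s, m). frag_of (r \<otimes> s, m)) t \<in> tensor_rels R M" if t: "t \<in> tensor_rels R M" for t
    using t[unfolded tensor_rels_def]
  proof (elim UnE CollectE exE conjE)
    fix a b m assume t: "t = frag_of (a \<oplus> b, m) - frag_of (a, m) - frag_of (b, m)"
      and mem: "a \<in> carrier R" "b \<in> carrier R" "m \<in> carrier M"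
    show ?thesis unfolding t tensor_rels_def
      by (intro UnI1 CollectI exI[of _ "r \<otimes> a"] exI[of _ "r \<otimes> b"] exI[of _ m])
        (use mem assms(1) in \<open>simp add: frag_extend_diff R.r_distr\<close>)
  next
    fix a m n assume t: "t = frag_of (a, m \<otimes>\<^bsub>M\<^esub> n) - frag_of (a, m) - frag_of (a, n)"
      and mem: "a \<in> carrier R" "m \<in> carrier M" "n \<in> carrier M"
    show ?thesis unfolding t tensor_rels_def
      by (intro UnI2 CollectI exI[of _ "r \<otimes> a"] exI[of _ m] exI[of _ n])
        (use mem assms(1) in \<open>simp add: frag_extend_diff\<close>)
  qed
  then show ?thesis
    using assms unfolding tensor_class_def tensor_module_def Let_def
    by (simp add: tensor_class_def, intro induced_linear[OF tensor.presentation_axioms tensor.presentation_axioms])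
      (auto intro: tensor.kernel_rel)
qed

lemma add_tens:
  "r \<in> carrier R \<Longrightarrow> s \<in> carrier R \<Longrightarrow> m \<in> carrier M \<Longrightarrow> tens (r \<oplus> s) m = tens r m \<oplus>\<^bsub>RM\<^esub> tens s m"
  "r \<in> carrier R \<Longrightarrow> m \<in> carrier M \<Longrightarrow> n \<in> carrier M \<Longrightarrow>
    tens r (m \<otimes>\<^bsub>M\<^esub> n) = tens r m \<oplus>\<^bsub>RM\<^esub> tens r n"
proof -
  have "frag_of (r \<oplus> s, m) - (frag_of (r, m) + frag_of (s, m)) \<in> tensor.K"
    if "r \<in> carrier R" "s \<in> carrier R" "m \<in> carrier M"
    by (rule tensor.kernel_rel) (use that in \<open>force simp: tensor_rels_def diff_diff_eq\<close>)
  then show "tens (r \<oplus> s) m = tens r m \<oplus>\<^bsub>RM\<^esub> tens s m"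
    if "r \<in> carrier R" "s \<in> carrier R" "m \<in> carrier M"
    using that by (simp add: add_RM[unfolded tensor_class_def] tensor_class_def tensor.cls_eq_iff keys_add_subset)
  have "frag_of (r, m \<otimes>\<^bsub>M\<^esub> n) - (frag_of (r, m) + frag_of (r, n)) \<in> tensor.K"
    if "r \<in> carrier R" "m \<in> carrier M" "n \<in> carrier M"
    by (rule tensor.kernel_rel) (use that in \<open>force simp: tensor_rels_def diff_diff_eq\<close>)
  then show "tens r (m \<otimes>\<^bsub>M\<^esub> n) = tens r m \<oplus>\<^bsub>RM\<^esub> tens r n"
    if "r \<in> carrier R" "m \<in> carrier M" "n \<in> carrier M"
    using that by (simp add: add_RM[unfolded tensor_class_def] tensor_class_def tensor.cls_eq_iff keys_add_subset)
qed

lemma abelian_group_RM: "abelian_group RM"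
proof -
  interpret Q: comm_group tensor.Q by (rule tensor.comm_group_Q)
  have simps: "carrier RM = carrier tensor.Q" "\<zero>\<^bsub>RM\<^esub> = \<one>\<^bsub>tensor.Q\<^esub>"
    "\<And>x y. x \<oplus>\<^bsub>RM\<^esub> y = x \<otimes>\<^bsub>tensor.Q\<^esub> y"
    by (simp_all add: tensor_module_def Let_def)
  show ?thesis
    by (rule abelian_groupI) (simp_all add: simps Q.m_ac Q.l_inv_ex)
qed

interpretation RM: abelian_group RM by (rule abelian_group_RM)

lemma tens_closed: "r \<in> carrier R \<Longrightarrow> m \<in> carrier M \<Longrightarrow> tens r m \<in> carrier RM"
  by (auto simp: carrier_RM)

text \<open>The element is an additive idempotent because zero is one in \<open>R\<close>, and a
  group has only one idempotent.\<close>

lemma tens_zero: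
  assumes m: "m \<in> carrier M"
  shows "tens \<zero> m = \<zero>\<^bsub>RM\<^esub>"
proof -
  have "tens \<zero> m \<oplus>\<^bsub>RM\<^esub> tens \<zero> m = tens \<zero> m"
    using m by (simp flip: add_tens(1))
  then show ?thesis using RM.add.r_cancel_one[OF tens_closed tens_closed] m by blast
qed

lemma tens_one:
  assumes r: "r \<in> carrier R"
  shows "tens r \<one>\<^bsub>M\<^esub> = \<zero>\<^bsub>RM\<^esub>"
proof -
  have "tens r \<one>\<^bsub>M\<^esub> \<oplus>\<^bsub>RM\<^esub> tens r \<one>\<^bsub>M\<^esub> = tens r \<one>\<^bsub>M\<^esub>"
    using r by (simp flip: add_tens(2))
  then show ?thesis using RM.add.r_cancel_one[OF tens_closed tens_closed] r by blast
qed

text \<open>Signs move into the scalar: both sides are additive inverses of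
  \<open>r \<otimes> m\<close>.\<close>

lemma tens_minus:
  assumes "r \<in> carrier R" "m \<in> carrier M"
  shows "tcls (- frag_of (r, m)) = tens (\<ominus> r) m"
proof -
  have "tens (\<ominus> r) m \<oplus>\<^bsub>RM\<^esub> tens r m = \<zero>\<^bsub>RM\<^esub>"
    using assms by (simp add: R.l_neg tens_zero flip: add_tens(1))
  moreover have "tcls (- frag_of (r, m)) \<oplus>\<^bsub>RM\<^esub> tens r m = \<zero>\<^bsub>RM\<^esub>"
    using assms by (simp add: add_RM zero_RM)
  moreover have "tcls (- frag_of (r, m)) \<in> carrier RM" using assms by (auto simp: carrier_RM)
  ultimately show ?thesis using assms tens_closed
    by (metis RM.minus_equality R.a_inv_closed)
qed

text \<open>Every element is a sum of pure tensors: a negated generator is a pure tensor with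
  negated scalar, and zero is the pure tensor of the zero scalar with the unit of
  \<open>M\<close>.\<close>

lemma RM_induct [consumes 1, case_names tens add]:
  assumes "A \<in> carrier RM"
    and "\<And>r m. r \<in> carrier R \<Longrightarrow> m \<in> carrier M \<Longrightarrow> P (tens r m)"
    and "\<And>A B. A \<in> carrier RM \<Longrightarrow> B \<in> carrier RM \<Longrightarrow> P A \<Longrightarrow> P B \<Longrightarrow> P (A \<oplus>\<^bsub>RM\<^esub> B)"
  shows "P A"
proof -
  obtain x where x: "Poly_Mapping.keys x \<subseteq> carrier R \<times> carrier M" "A = tcls x"
    using assms(1) carrier_RM by auto
  have "P (tcls x)" using x(1)
  proof (induction x rule: frag_induct_sum)
    case zero
    then show ?case using assms(2)[of \<zero> "\<one>\<^bsub>M\<^esub>"] tens_zero[of "\<one>\<^bsub>M\<^esub>"] zero_RM by simp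
  next
    case (of x)
    then show ?case using assms(2) by auto
  next
    case (neg x)
    then show ?case using assms(2) tens_minus by auto
  next
    case (add a b)
    then show ?case using assms(3)[of "tcls a" "tcls b"] by (auto simp: add_RM carrier_RM)
  qed
  then show ?thesis using x by simp
qed

lemma smult_tens:
  "r \<in> carrier R \<Longrightarrow> s \<in> carrier R \<Longrightarrow> m \<in> carrier M \<Longrightarrow> r \<odot>\<^bsub>RM\<^esub> tens s m = tens (r \<otimes> s) m"
  by (simp add: smult_RM)

lemma smult_add:
  assumes "r \<in> carrier R" "A \<in> carrier RM" "B \<in> carrier RM"
  shows "r \<odot>\<^bsub>RM\<^esub> (A \<oplus>\<^bsub>RM\<^esub> B) = r \<odot>\<^bsub>RM\<^esub> A \<oplus>\<^bsub>RM\<^esub> r \<odot>\<^bsub>RM\<^esub> B"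
proof -
  obtain x y where x: "Poly_Mapping.keys x \<subseteq> carrier R \<times> carrier M" "A = tcls x"
    and y: "Poly_Mapping.keys y \<subseteq> carrier R \<times> carrier M" "B = tcls y"
    using assms carrier_RM by auto
  show ?thesis
    unfolding x(2) y(2) using assms(1) x(1) y(1)
    by (simp only: add_RM smult_RM keys_add_subset keys_scale frag_extend_add)
qed

lemma smult_RM_closed:
  assumes "r \<in> carrier R" "A \<in> carrier RM"
  shows "r \<odot>\<^bsub>RM\<^esub> A \<in> carrier RM"
proof -
  obtain x where x: "Poly_Mapping.keys x \<subseteq> carrier R \<times> carrier M" "A = tcls x"
    using assms carrier_RM by auto
  show ?thesis
    unfolding x(2) smult_RM[OF assms(1) x(1)] carrier_RM
    using keys_scale[OF assms(1) x(1)] by (intro imageI CollectI)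
qed

lemma module_RM: "Module.module R RM"
proof (rule moduleI[OF R abelian_group_RM smult_RM_closed])
  fix a b A assume ab: "a \<in> carrier R" "b \<in> carrier R" and A: "A \<in> carrier RM"
  note closed = smult_RM_closed tens_closed
  show "(a \<oplus> b) \<odot>\<^bsub>RM\<^esub> A = a \<odot>\<^bsub>RM\<^esub> A \<oplus>\<^bsub>RM\<^esub> b \<odot>\<^bsub>RM\<^esub> A"
    using A
  proof (induction A rule: RM_induct)
    case (add A B)
    then show ?case using ab by (simp add: smult_add closed RM.a_ac)
  qed (use ab in \<open>simp add: smult_tens R.l_distr add_tens\<close>)
  show "(a \<otimes> b) \<odot>\<^bsub>RM\<^esub> A = a \<odot>\<^bsub>RM\<^esub> (b \<odot>\<^bsub>RM\<^esub> A)"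
    using A
  proof (induction A rule: RM_induct)
    case (add A B)
    then show ?case using ab by (simp add: smult_add closed)
  qed (use ab in \<open>simp add: smult_tens R.m_assoc\<close>)
next
  fix A assume "A \<in> carrier RM"
  then show "\<one> \<odot>\<^bsub>RM\<^esub> A = A"
    by (induction A rule: RM_induct) (simp_all add: smult_tens smult_add)
qed (simp_all add: smult_add)

end


section \<open>Linear and bilinear maps between extended modules\<close>

lemma module_map_zero:
  assumes "Module.module R M" "Module.module R N" "module_map R M N f"
  shows "f \<zero>\<^bsub>M\<^esub> = \<zero>\<^bsub>N\<^esub>"
proof -
  interpret M: Module.module R M by fact
  interpret N: Module.module R N by fact
  have "f \<zero>\<^bsub>M\<^esub> = f (\<zero>\<^bsub>R\<^esub> \<odot>\<^bsub>M\<^esub> \<zero>\<^bsub>M\<^esub>)" by simp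
  also have "\<dots> = \<zero>\<^bsub>R\<^esub> \<odot>\<^bsub>N\<^esub> f \<zero>\<^bsub>M\<^esub>"
    using assms(3) M.R.zero_closed M.zero_closed unfolding module_map_def by blast
  also have "\<dots> = \<zero>\<^bsub>N\<^esub>"
    using assms(3) M.zero_closed unfolding module_map_def by (intro N.smult_l_null) blast
  finally show ?thesis .
qed

text \<open>The map usually written \<open>id \<otimes> h\<close>; it acts on a chosen
  representative, in the manner of \<open>tensor_bilinear\<close>.\<close>

definition tensor_map ::
  "('r, 's) ring_scheme \<Rightarrow> 'n monoid \<Rightarrow> ('m \<Rightarrow> 'n) \<Rightarrow> ('r \<times> 'm) frag set \<Rightarrow> ('r \<times> 'n) frag set"
  where "tensor_map R N h A =
    tensor_class R N (frag_extend (\<lambda>(r, m). frag_of (r, h m)) (coset_rep A))"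

text \<open>Pure tensors generate additively, so an additive map is linear once scalars are
  respected on them; there the scalar multiple is again a pure tensor.\<close>

lemma module_mapI_tens:
  assumes "scalar_extension R M" "Module.module R N"
    and closed: "\<And>r m. r \<in> carrier R \<Longrightarrow> m \<in> carrier M \<Longrightarrow> f (tensor_class R M (frag_of (r, m))) \<in> carrier N"
    and add: "\<And>A B. A \<in> carrier (tensor_module R M) \<Longrightarrow> B \<in> carrier (tensor_module R M) \<Longrightarrow>
      f (A \<oplus>\<^bsub>tensor_module R M\<^esub> B) = f A \<oplus>\<^bsub>N\<^esub> f B"
    and smult: "\<And>r s m. r \<in> carrier R \<Longrightarrow> s \<in> carrier R \<Longrightarrow> m \<in> carrier M \<Longrightarrow>
      f (tensor_class R M (frag_of (r \<otimes>\<^bsub>R\<^esub> s, m))) = r \<odot>\<^bsub>N\<^esub> f (tensor_class R M (frag_of (s, m)))"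
  shows "module_map R (tensor_module R M) N f"
proof -
  interpret M: scalar_extension R M by fact
  interpret N: Module.module R N by fact
  have closed': "f A \<in> carrier N" if "A \<in> carrier M.RM" for A
    using that by (induction A rule: M.RM_induct) (simp_all add: closed add)
  have "f (r \<odot>\<^bsub>M.RM\<^esub> A) = r \<odot>\<^bsub>N\<^esub> f A" if "r \<in> carrier R" "A \<in> carrier M.RM" for r A
    using that(2)
    by (induction A rule: M.RM_induct)
      (simp_all add: that(1) M.smult_tens smult M.smult_add add M.smult_RM_closed closed' N.smult_r_distr)
  then show ?thesis unfolding module_map_def using closed' add by blast
qed

lemma tensor_map:
  assumes "scalar_extension R M" "scalar_extension R N" and h: "h \<in> hom M N"
  shows "module_map R (tensor_module R M) (tensor_module R N) (tensor_map R N h)"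
    and "r \<in> carrier R \<Longrightarrow> m \<in> carrier M \<Longrightarrow>
      tensor_map R N h (tensor_class R M (frag_of (r, m))) = tensor_class R N (frag_of (r, h m))"
proof -
  interpret M: scalar_extension R M by fact
  interpret N: scalar_extension R N by fact
  let ?F = "frag_extend (\<lambda>(r, m). frag_of (r, h m)) :: _ \<Rightarrow> _"
  have hc: "h m \<in> carrier N" if "m \<in> carrier M" for m using h that by (auto simp: hom_def)
  have rel: "?F t \<in> tensor_rels R N" if t: "t \<in> tensor_rels R M" for t
    using t[unfolded tensor_rels_def]
  proof (elim UnE CollectE exE conjE)
    fix a b m assume t: "t = frag_of (a \<oplus>\<^bsub>R\<^esub> b, m) - frag_of (a, m) - frag_of (b, m)"
      and mem: "a \<in> carrier R" "b \<in> carrier R" "m \<in> carrier M"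
    show ?thesis unfolding t tensor_rels_def
      by (intro UnI1 CollectI exI[of _ a] exI[of _ b] exI[of _ "h m"])
        (use mem hc in \<open>simp add: frag_extend_diff\<close>)
  next
    fix a m n assume t: "t = frag_of (a, m \<otimes>\<^bsub>M\<^esub> n) - frag_of (a, m) - frag_of (a, n)"
      and mem: "a \<in> carrier R" "m \<in> carrier M" "n \<in> carrier M"
    show ?thesis unfolding t tensor_rels_def
      by (intro UnI2 CollectI exI[of _ a] exI[of _ "h m"] exI[of _ "h n"])
        (use mem hc h in \<open>simp add: frag_extend_diff hom_def\<close>)
  qed
  have keys: "Poly_Mapping.keys (?F x) \<subseteq> carrier R \<times> carrier N"
    if "Poly_Mapping.keys x \<subseteq> carrier R \<times> carrier M" for x
    using that by (rule keys_frag_extend_subset) (use hc in auto)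
  have ev: "tensor_map R N h (M.tcls x) = N.tcls (?F x)"
    if "Poly_Mapping.keys x \<subseteq> carrier R \<times> carrier M" for x
    unfolding tensor_map_def tensor_class_def
    by (rule induced_linear[OF M.tensor.presentation_axioms N.tensor.presentation_axioms])
      (use that hc rel N.tensor.kernel_rel in auto)
  show tens: "tensor_map R N h (M.tens r m) = N.tens r (h m)"
    if "r \<in> carrier R" "m \<in> carrier M" for r m
    using ev[of "frag_of (r, m)"] that by simp
  show "module_map R M.RM N.RM (tensor_map R N h)"
  proof (rule module_mapI_tens[OF assms(1) N.module_RM])
    fix A B assume "A \<in> carrier M.RM" "B \<in> carrier M.RM"
    then obtain x y where x: "Poly_Mapping.keys x \<subseteq> carrier R \<times> carrier M" "A = M.tcls x"
      and y: "Poly_Mapping.keys y \<subseteq> carrier R \<times> carrier M" "B = M.tcls y"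
      using M.carrier_RM by auto
    show "tensor_map R N h (A \<oplus>\<^bsub>M.RM\<^esub> B) = tensor_map R N h A \<oplus>\<^bsub>N.RM\<^esub> tensor_map R N h B"
      using x y by (simp add: M.add_RM N.add_RM ev keys_add_subset keys frag_extend_add)
  qed (simp_all add: tens hc N.tens_closed N.smult_tens)
qed

text \<open>Additivity in each variable lifts from formal sums. Compatibility with scalars is then
  tested on pure tensors in both variables, where the value is explicit.\<close>

lemma tensor_bilinear:
  assumes "scalar_extension R M" "scalar_extension R N" "scalar_extension R P"
    and closed: "\<And>m n. m \<in> carrier M \<Longrightarrow> n \<in> carrier N \<Longrightarrow> c m n \<in> carrier P"
    and left: "\<And>m m' n. m \<in> carrier M \<Longrightarrow> m' \<in> carrier M \<Longrightarrow> n \<in> carrier N \<Longrightarrow>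
      c (m \<otimes>\<^bsub>M\<^esub> m') n = c m n \<otimes>\<^bsub>P\<^esub> c m' n"
    and right: "\<And>m n n'. m \<in> carrier M \<Longrightarrow> n \<in> carrier N \<Longrightarrow> n' \<in> carrier N \<Longrightarrow>
      c m (n \<otimes>\<^bsub>N\<^esub> n') = c m n \<otimes>\<^bsub>P\<^esub> c m n'"
  shows "B \<in> carrier (tensor_module R N) \<Longrightarrow>
      module_map R (tensor_module R M) (tensor_module R P) (\<lambda>A. tensor_bilinear R P c A B)"
    and "A \<in> carrier (tensor_module R M) \<Longrightarrow>
      module_map R (tensor_module R N) (tensor_module R P) (tensor_bilinear R P c A)"
    and "r \<in> carrier R \<Longrightarrow> s \<in> carrier R \<Longrightarrow> m \<in> carrier M \<Longrightarrow> n \<in> carrier N \<Longrightarrow>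
      tensor_bilinear R P c (tensor_class R M (frag_of (r, m))) (tensor_class R N (frag_of (s, n))) =
      tensor_class R P (frag_of (r \<otimes>\<^bsub>R\<^esub> s, c m n))"
proof -
  interpret M: scalar_extension R M by fact
  interpret N: scalar_extension R N by fact
  interpret P: scalar_extension R P by fact
  let ?b = "\<lambda>(r, m) (s, n). frag_of (r \<otimes>\<^bsub>R\<^esub> s, c m n)"
  have keys: "Poly_Mapping.keys (frag_bilinear ?b x y) \<subseteq> carrier R \<times> carrier P"
    if "Poly_Mapping.keys x \<subseteq> carrier R \<times> carrier M" "Poly_Mapping.keys y \<subseteq> carrier R \<times> carrier N" for x y
    by (rule keys_frag_bilinear_subset[OF that]) (use closed in auto)
  have rel1: "frag_bilinear ?b t (frag_of (s, n)) \<in> tensor_rels R P"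
    if t: "t \<in> tensor_rels R M" and s: "s \<in> carrier R" "n \<in> carrier N" for t s n
    using t[unfolded tensor_rels_def]
  proof (elim UnE CollectE exE conjE)
    fix a b m assume t: "t = frag_of (a \<oplus>\<^bsub>R\<^esub> b, m) - frag_of (a, m) - frag_of (b, m)"
      and mem: "a \<in> carrier R" "b \<in> carrier R" "m \<in> carrier M"
    show ?thesis unfolding t tensor_rels_def
      by (intro UnI1 CollectI exI[of _ "a \<otimes>\<^bsub>R\<^esub> s"] exI[of _ "b \<otimes>\<^bsub>R\<^esub> s"] exI[of _ "c m n"])
        (use mem s closed in \<open>simp add: frag_bilinear_simps M.R.l_distr\<close>)
  next
    fix a m m' assume t: "t = frag_of (a, m \<otimes>\<^bsub>M\<^esub> m') - frag_of (a, m) - frag_of (a, m')"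
      and mem: "a \<in> carrier R" "m \<in> carrier M" "m' \<in> carrier M"
    show ?thesis unfolding t tensor_rels_def
      by (intro UnI2 CollectI exI[of _ "a \<otimes>\<^bsub>R\<^esub> s"] exI[of _ "c m n"] exI[of _ "c m' n"])
        (use mem s closed left in \<open>simp add: frag_bilinear_simps\<close>)
  qed
  have rel2: "frag_bilinear ?b (frag_of (s, m)) t \<in> tensor_rels R P"
    if t: "t \<in> tensor_rels R N" and s: "s \<in> carrier R" "m \<in> carrier M" for t s m
    using t[unfolded tensor_rels_def]
  proof (elim UnE CollectE exE conjE)
    fix a b n assume t: "t = frag_of (a \<oplus>\<^bsub>R\<^esub> b, n) - frag_of (a, n) - frag_of (b, n)"
      and mem: "a \<in> carrier R" "b \<in> carrier R" "n \<in> carrier N"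
    show ?thesis unfolding t tensor_rels_def
      by (intro UnI1 CollectI exI[of _ "s \<otimes>\<^bsub>R\<^esub> a"] exI[of _ "s \<otimes>\<^bsub>R\<^esub> b"] exI[of _ "c m n"])
        (use mem s closed in \<open>simp add: frag_bilinear_simps M.R.r_distr\<close>)
  next
    fix a n n' assume t: "t = frag_of (a, n \<otimes>\<^bsub>N\<^esub> n') - frag_of (a, n) - frag_of (a, n')"
      and mem: "a \<in> carrier R" "n \<in> carrier N" "n' \<in> carrier N"
    show ?thesis unfolding t tensor_rels_def
      by (intro UnI2 CollectI exI[of _ "s \<otimes>\<^bsub>R\<^esub> a"] exI[of _ "c m n"] exI[of _ "c m n'"])
        (use mem s closed right in \<open>simp add: frag_bilinear_simps\<close>)
  qed
  have ev: "tensor_bilinear R P c (M.tcls x) (N.tcls y) = P.tcls (frag_bilinear ?b x y)"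
    if "Poly_Mapping.keys x \<subseteq> carrier R \<times> carrier M" "Poly_Mapping.keys y \<subseteq> carrier R \<times> carrier N" for x y
    unfolding tensor_bilinear_def tensor_class_def
    by (rule induced_bilinear[OF M.tensor.presentation_axioms N.tensor.presentation_axioms
          P.tensor.presentation_axioms _ _ _ that])
      (use closed rel1 rel2 P.tensor.kernel_rel in auto)
  show on_tens: "tensor_bilinear R P c (M.tens r m) (N.tens s n) = P.tens (r \<otimes>\<^bsub>R\<^esub> s) (c m n)"
    if "r \<in> carrier R" "s \<in> carrier R" "m \<in> carrier M" "n \<in> carrier N" for r s m n
    using ev[of "frag_of (r, m)" "frag_of (s, n)"] that by (simp add: frag_bilinear_simps)
  have add1: "tensor_bilinear R P c (A \<oplus>\<^bsub>M.RM\<^esub> A') B =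
      tensor_bilinear R P c A B \<oplus>\<^bsub>P.RM\<^esub> tensor_bilinear R P c A' B"
    if AB: "A \<in> carrier M.RM" "A' \<in> carrier M.RM" "B \<in> carrier N.RM" for A A' B
  proof -
    obtain x x' y where x: "Poly_Mapping.keys x \<subseteq> carrier R \<times> carrier M" "A = M.tcls x"
      and x': "Poly_Mapping.keys x' \<subseteq> carrier R \<times> carrier M" "A' = M.tcls x'"
      and y: "Poly_Mapping.keys y \<subseteq> carrier R \<times> carrier N" "B = N.tcls y"
      using AB M.carrier_RM N.carrier_RM by auto
    show ?thesis
      using x x' y by (simp add: M.add_RM P.add_RM ev keys_add_subset keys frag_bilinear_simps)
  qed
  have add2: "tensor_bilinear R P c A (B \<oplus>\<^bsub>N.RM\<^esub> B') =
      tensor_bilinear R P c A B \<oplus>\<^bsub>P.RM\<^esub> tensor_bilinear R P c A B'"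
    if AB: "A \<in> carrier M.RM" "B \<in> carrier N.RM" "B' \<in> carrier N.RM" for A B B'
  proof -
    obtain x y y' where x: "Poly_Mapping.keys x \<subseteq> carrier R \<times> carrier M" "A = M.tcls x"
      and y: "Poly_Mapping.keys y \<subseteq> carrier R \<times> carrier N" "B = N.tcls y"
      and y': "Poly_Mapping.keys y' \<subseteq> carrier R \<times> carrier N" "B' = N.tcls y'"
      using AB M.carrier_RM N.carrier_RM by auto
    show ?thesis
      using x y y' by (simp add: N.add_RM P.add_RM ev keys_add_subset keys frag_bilinear_simps)
  qed
  interpret RP: Module.module R P.RM by (rule P.module_RM)
  have closed': "tensor_bilinear R P c A B \<in> carrier P.RM"
    if "A \<in> carrier M.RM" "B \<in> carrier N.RM" for A B
    using that keys by (auto simp: M.carrier_RM N.carrier_RM P.carrier_RM ev)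
  have smult1: "tensor_bilinear R P c (M.tens (r \<otimes>\<^bsub>R\<^esub> s) m) B
      = r \<odot>\<^bsub>P.RM\<^esub> tensor_bilinear R P c (M.tens s m) B"
    if rm: "r \<in> carrier R" "s \<in> carrier R" "m \<in> carrier M" and B: "B \<in> carrier N.RM" for r s m B
    using B
  proof (induction B rule: N.RM_induct)
    case (tens s' n)
    then show ?case using rm closed tens by (simp add: on_tens P.smult_tens M.R.m_assoc)
  next
    case (add B B')
    then show ?case using rm by (simp add: add2 P.smult_add closed' M.tens_closed)
  qed
  \<comment> \<open>Here the scalar enters on the right and must pass the left factor
    \<open>s'\<close>, by commutativity of \<open>R\<close>.\<close>
  have smult2: "tensor_bilinear R P c A (N.tens (r \<otimes>\<^bsub>R\<^esub> s) n)
      = r \<odot>\<^bsub>P.RM\<^esub> tensor_bilinear R P c A (N.tens s n)"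
    if rm: "r \<in> carrier R" "s \<in> carrier R" "n \<in> carrier N" and A: "A \<in> carrier M.RM" for r s n A
    using A
  proof (induction A rule: M.RM_induct)
    case (tens s' m)
    then show ?case using rm closed tens by (simp add: on_tens P.smult_tens M.R.m_lcomm)
  next
    case (add A A')
    then show ?case using rm by (simp add: add1 P.smult_add closed' N.tens_closed)
  qed
  show "module_map R M.RM P.RM (\<lambda>A. tensor_bilinear R P c A B)" if "B \<in> carrier N.RM" for B
    by (rule module_mapI_tens[OF assms(1) P.module_RM])
      (simp_all add: that closed' M.tens_closed add1 smult1)
  show "module_map R N.RM P.RM (tensor_bilinear R P c A)" if "A \<in> carrier M.RM" for A
    by (rule module_mapI_tens[OF assms(2) P.module_RM])
      (simp_all add: that closed' N.tens_closed add2 smult2)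
qed


section \<open>Linearised Grothendieck groups\<close>

locale groth =
  fixes R :: "('r, 's) ring_scheme" and S :: "'a set"
    and I :: "'a \<Rightarrow> 'a \<Rightarrow> bool" and D :: "'a \<Rightarrow> 'a \<Rightarrow> 'a \<Rightarrow> bool"
  assumes cring: "cring R"
begin

abbreviation "rels \<equiv> groth_rels S I D"

sublocale P: presentation S rels
  by standard (auto simp: groth_rels_def keys_diff_subset subset_iff dest!: subsetD[OF keys_diff])

sublocale ext: scalar_extension R "presented_group S rels"
  by (rule scalar_extension.intro[OF cring P.comm_group_Q])

sublocale mod: Module.module R "tensor_module R (presented_group S rels)"
  by (rule ext.module_RM)

text \<open>The classes \<open>1 \<otimes> [s]\<close> generate over \<open>R\<close> and inherit
  both families of relations; identities between linear maps are tested on them.\<close>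

definition gen :: "'a \<Rightarrow> ('r \<times> 'a frag set) frag set"
  where "gen s = ext.tens \<one>\<^bsub>R\<^esub> (P.cls (frag_of s))"

lemma gen_closed: "s \<in> S \<Longrightarrow> gen s \<in> carrier ext.RM"
  by (simp add: gen_def ext.tens_closed P.cls_closed)

lemma cls_iso:
  assumes "s \<in> S" "t \<in> S" "I s t"
  shows "P.cls (frag_of s) = P.cls (frag_of t)"
proof -
  have "frag_of s - frag_of t \<in> rels" using assms by (auto simp: groth_rels_def)
  then show ?thesis using assms by (simp add: P.cls_eq_iff P.kernel_rel)
qed

lemma cls_sum:
  assumes "s \<in> S" "t \<in> S" "u \<in> S" "D s t u"
  shows "P.cls (frag_of s) = P.cls (frag_of t) \<otimes>\<^bsub>P.Q\<^esub> P.cls (frag_of u)"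
proof -
  have "frag_of s - frag_of t - frag_of u \<in> rels" using assms by (auto simp: groth_rels_def)
  then have "frag_of s - (frag_of t + frag_of u) \<in> P.K"
    by (simp add: diff_diff_eq P.kernel_rel)
  then show ?thesis using assms by (simp add: P.cls_mult P.cls_eq_iff keys_add_subset)
qed

lemma gen_iso: "s \<in> S \<Longrightarrow> t \<in> S \<Longrightarrow> I s t \<Longrightarrow> gen s = gen t"
  using cls_iso by (simp add: gen_def)

lemma gen_sum: "s \<in> S \<Longrightarrow> t \<in> S \<Longrightarrow> u \<in> S \<Longrightarrow> D s t u \<Longrightarrow> gen s = gen t \<oplus>\<^bsub>ext.RM\<^esub> gen u"
  using cls_sum by (simp add: gen_def ext.add_tens P.cls_closed)

text \<open>A pure tensor \<open>r \<otimes> [x]\<close> is expanded along the formal sum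
  \<open>x\<close>, and the sign of each term is moved into \<open>r\<close>; what remains is a sum
  of scalar multiples of generators.\<close>

lemma gen_induct [consumes 1, case_names zero gen add]:
  assumes A: "A \<in> carrier ext.RM"
    and 0: "P \<zero>\<^bsub>ext.RM\<^esub>" and gen: "\<And>r s. r \<in> carrier R \<Longrightarrow> s \<in> S \<Longrightarrow> P (r \<odot>\<^bsub>ext.RM\<^esub> gen s)"
    and add: "\<And>A B. A \<in> carrier ext.RM \<Longrightarrow> B \<in> carrier ext.RM \<Longrightarrow> P A \<Longrightarrow> P B \<Longrightarrow> P (A \<oplus>\<^bsub>ext.RM\<^esub> B)"
  shows "P A"
  using A
proof (induction A rule: ext.RM_induct)
  case (tens r m)
  obtain x where x: "Poly_Mapping.keys x \<subseteq> S" "m = P.cls x" using tens(2) P.carrier_Q by auto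
  have smult: "r \<odot>\<^bsub>ext.RM\<^esub> ext.tens \<one>\<^bsub>R\<^esub> m = ext.tens r m" if "r \<in> carrier R" "m \<in> carrier P.Q" for r m
    using that by (simp add: ext.smult_tens)
  have "\<forall>r \<in> carrier R. P (ext.tens r (P.cls x))" using x(1)
  proof (induction x rule: frag_induct_sum)
    case zero
    then show ?case using 0 ext.tens_one P.one_Q by simp
  next
    case (of s)
    then show ?case using gen smult P.cls_closed by (simp add: gen_def)
  next
    case (neg s)
    have "ext.tens r (P.cls (- frag_of s)) = (\<ominus>\<^bsub>R\<^esub> r) \<odot>\<^bsub>ext.RM\<^esub> gen s" if r: "r \<in> carrier R" for r
    proof -
      have c: "P.cls (- frag_of s) \<in> carrier P.Q" "P.cls (frag_of s) \<in> carrier P.Q"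
        using neg by (auto intro: P.cls_closed)
      have "ext.tens r (P.cls (- frag_of s)) \<oplus>\<^bsub>ext.RM\<^esub> ext.tens r (P.cls (frag_of s)) = \<zero>\<^bsub>ext.RM\<^esub>"
        using r c neg by (simp add: ext.tens_one P.cls_mult P.one_Q[symmetric] flip: ext.add_tens(2))
      moreover have "ext.tens (\<ominus>\<^bsub>R\<^esub> r) (P.cls (frag_of s)) \<oplus>\<^bsub>ext.RM\<^esub> ext.tens r (P.cls (frag_of s)) = \<zero>\<^bsub>ext.RM\<^esub>"
        using r c by (simp add: ext.tens_zero ext.R.l_neg flip: ext.add_tens(1))
      ultimately have "ext.tens r (P.cls (- frag_of s)) = ext.tens (\<ominus>\<^bsub>R\<^esub> r) (P.cls (frag_of s))"
        using r c by (metis mod.M.minus_equality ext.tens_closed ext.R.a_inv_closed)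
      then show ?thesis using r c smult by (simp add: gen_def)
    qed
    then show ?case using gen neg by simp
  next
    case (add a b)
    then show ?case
      using assms(4) P.cls_closed ext.tens_closed by (simp add: ext.add_tens flip: P.cls_mult)
  qed
  then show ?case using tens x by blast
qed (rule add)

lemma module: "Module.module R (tensor_module R (presented_group S rels))"
  by (rule ext.module_RM)

text \<open>The device that turns an identity between morphisms into one between classes of finite
  sets with action.\<close>

lemma map_eqI:
  assumes "Module.module R N" "module_map R ext.RM N f" "module_map R ext.RM N g"
    and "\<And>s. s \<in> S \<Longrightarrow> f (gen s) = g (gen s)" and A: "A \<in> carrier ext.RM"
  shows "f A = g A"
  using A
proof (induction A rule: gen_induct)
  case zero
  show ?case using module_map_zero[OF ext.module_RM assms(1)] assms(2,3) by metis
next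
  case (gen r s)
  then show ?case using assms(2-4) gen_closed by (simp add: module_map_def)
next
  case (add A B)
  then show ?case using assms(2,3) by (simp add: module_map_def)
qed

end

text \<open>A construction on sets that preserves isomorphism and disjoint unions maps the two
  families of relations into the corresponding families. It supplies the map that forgets anchors
  and also the inverse of that map.\<close>

lemma groth_linear:
  assumes "groth R"
    and f: "\<And>s. s \<in> S \<Longrightarrow> f s \<in> S'"
    and iso: "\<And>s t. s \<in> S \<Longrightarrow> t \<in> S \<Longrightarrow> I s t \<Longrightarrow> I' (f s) (f t)"
    and sum: "\<And>s t u. s \<in> S \<Longrightarrow> t \<in> S \<Longrightarrow> u \<in> S \<Longrightarrow> D s t u \<Longrightarrow> D' (f s) (f t) (f u)"
  shows "\<exists>\<Psi>. module_map R (tensor_module R (presented_group S (groth_rels S I D)))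
      (tensor_module R (presented_group S' (groth_rels S' I' D'))) \<Psi> \<and>
    (\<forall>s \<in> S. \<Psi> (groth.gen R S I D s) = groth.gen R S' I' D' (f s))"
proof -
  interpret A: groth R S I D by fact
  interpret B: groth R S' I' D' by fact
  define h where "h = (\<lambda>X. B.P.cls (frag_extend (frag_of \<circ> f) (coset_rep X)))"
  have keys: "Poly_Mapping.keys (frag_extend (frag_of \<circ> f) x) \<subseteq> S'" if "Poly_Mapping.keys x \<subseteq> S" for x
    using that by (rule keys_frag_extend_subset) (use f in auto)
  have rel: "frag_extend (frag_of \<circ> f) t \<in> B.rels" if t: "t \<in> A.rels" for t
    using t[unfolded groth_rels_def]
  proof (elim UnE CollectE exE conjE)
    fix a b assume t: "t = frag_of a - frag_of b" and mem: "a \<in> S" "b \<in> S" "I a b"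
    show ?thesis unfolding t groth_rels_def
      by (intro UnI1 CollectI exI[of _ "f a"] exI[of _ "f b"]) (use mem f iso in \<open>simp add: frag_extend_diff\<close>)
  next
    fix a b c assume t: "t = frag_of c - frag_of a - frag_of b" and mem: "a \<in> S" "b \<in> S" "c \<in> S" "D c a b"
    show ?thesis unfolding t groth_rels_def
      by (intro UnI2 CollectI exI[of _ "f a"] exI[of _ "f b"] exI[of _ "f c"])
        (use mem f sum in \<open>simp add: frag_extend_diff\<close>)
  qed
  have ev: "h (A.P.cls x) = B.P.cls (frag_extend (frag_of \<circ> f) x)" if "Poly_Mapping.keys x \<subseteq> S" for x
    unfolding h_def
    by (rule induced_linear[OF A.P.presentation_axioms B.P.presentation_axioms _ _ that])
      (use f rel B.P.kernel_rel in auto)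
  have hom: "h \<in> hom A.P.Q B.P.Q"
  proof (rule homI)
    fix X assume "X \<in> carrier A.P.Q"
    then show "h X \<in> carrier B.P.Q" by (elim A.P.carrier_QE) (simp add: ev keys B.P.cls_closed)
  next
    fix X Y assume "X \<in> carrier A.P.Q" "Y \<in> carrier A.P.Q"
    then show "h (X \<otimes>\<^bsub>A.P.Q\<^esub> Y) = h X \<otimes>\<^bsub>B.P.Q\<^esub> h Y"
      by (elim A.P.carrier_QE) (simp add: ev keys A.P.cls_mult B.P.cls_mult keys_add_subset frag_extend_add)
  qed
  note map = tensor_map[OF A.ext.scalar_extension_axioms B.ext.scalar_extension_axioms hom]
  show ?thesis
  proof (intro exI conjI ballI)
    show "module_map R A.ext.RM B.ext.RM (tensor_map R B.P.Q h)" by (rule map(1))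
    fix s assume "s \<in> S"
    then show "tensor_map R B.P.Q h (A.gen s) = B.gen (f s)"
      using map(2)[of "\<one>\<^bsub>R\<^esub>" "A.P.cls (frag_of s)"] ev[of "frag_of s"]
      by (simp add: A.gen_def B.gen_def A.P.cls_closed)
  qed
qed

text \<open>A construction on pairs that respects isomorphism and disjoint unions in each variable
  preserves relations paired with generators. \<open>C\<close> has the shape that composition takes
  in both categories after unfolding, so spans and bisets share the lemma.\<close>

lemma groth_bilinear:
  assumes "groth R"
    and c: "\<And>v u. v \<in> S1 \<Longrightarrow> u \<in> S2 \<Longrightarrow> c v u \<in> S3"
    and iso1: "\<And>v v' u. v \<in> S1 \<Longrightarrow> v' \<in> S1 \<Longrightarrow> u \<in> S2 \<Longrightarrow> I1 v v' \<Longrightarrow> I3 (c v u) (c v' u)"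
    and iso2: "\<And>v u u'. v \<in> S1 \<Longrightarrow> u \<in> S2 \<Longrightarrow> u' \<in> S2 \<Longrightarrow> I2 u u' \<Longrightarrow> I3 (c v u) (c v u')"
    and sum1: "\<And>v v1 v2 u. v \<in> S1 \<Longrightarrow> v1 \<in> S1 \<Longrightarrow> v2 \<in> S1 \<Longrightarrow> u \<in> S2 \<Longrightarrow> D1 v v1 v2 \<Longrightarrow>
      D3 (c v u) (c v1 u) (c v2 u)"
    and sum2: "\<And>v u u1 u2. v \<in> S1 \<Longrightarrow> u \<in> S2 \<Longrightarrow> u1 \<in> S2 \<Longrightarrow> u2 \<in> S2 \<Longrightarrow> D2 u u1 u2 \<Longrightarrow>
      D3 (c v u) (c v u1) (c v u2)"
  defines "M1 \<equiv> tensor_module R (presented_group S1 (groth_rels S1 I1 D1))"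
    and "M2 \<equiv> tensor_module R (presented_group S2 (groth_rels S2 I2 D2))"
    and "M3 \<equiv> tensor_module R (presented_group S3 (groth_rels S3 I3 D3))"
    and "C \<equiv> tensor_bilinear R (presented_group S3 (groth_rels S3 I3 D3))
      (\<lambda>A B. presented_class S3 (groth_rels S3 I3 D3)
        (frag_bilinear (\<lambda>v u. frag_of (c v u)) (coset_rep A) (coset_rep B)))"
  shows "B \<in> carrier M2 \<Longrightarrow> module_map R M1 M3 (\<lambda>A. C A B)"
    and "A \<in> carrier M1 \<Longrightarrow> module_map R M2 M3 (C A)"
    and "v \<in> S1 \<Longrightarrow> u \<in> S2 \<Longrightarrow>
      C (groth.gen R S1 I1 D1 v) (groth.gen R S2 I2 D2 u) = groth.gen R S3 I3 D3 (c v u)"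
proof -
  interpret A: groth R S1 I1 D1 by fact
  interpret B: groth R S2 I2 D2 by fact
  interpret G: groth R S3 I3 D3 by fact
  let ?b = "\<lambda>v u. frag_of (c v u)"
  let ?d = "\<lambda>A B. G.P.cls (frag_bilinear ?b (coset_rep A) (coset_rep B))"
  have keys: "Poly_Mapping.keys (frag_bilinear ?b x y) \<subseteq> S3"
    if "Poly_Mapping.keys x \<subseteq> S1" "Poly_Mapping.keys y \<subseteq> S2" for x y
    by (rule keys_frag_bilinear_subset[OF that]) (use c in auto)
  have rel1: "frag_bilinear ?b t (frag_of u) \<in> G.rels" if t: "t \<in> A.rels" and u: "u \<in> S2" for t u
    using t[unfolded groth_rels_def]
  proof (elim UnE CollectE exE conjE)
    fix a b assume t: "t = frag_of a - frag_of b" and mem: "a \<in> S1" "b \<in> S1" "I1 a b"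
    show ?thesis unfolding t groth_rels_def
      by (intro UnI1 CollectI exI[of _ "c a u"] exI[of _ "c b u"])
        (use mem u c iso1 in \<open>simp add: frag_bilinear_simps\<close>)
  next
    fix a b d assume t: "t = frag_of d - frag_of a - frag_of b" and mem: "a \<in> S1" "b \<in> S1" "d \<in> S1" "D1 d a b"
    show ?thesis unfolding t groth_rels_def
      by (intro UnI2 CollectI exI[of _ "c a u"] exI[of _ "c b u"] exI[of _ "c d u"])
        (use mem u c sum1 in \<open>simp add: frag_bilinear_simps\<close>)
  qed
  have rel2: "frag_bilinear ?b (frag_of v) t \<in> G.rels" if t: "t \<in> B.rels" and v: "v \<in> S1" for t v
    using t[unfolded groth_rels_def]
  proof (elim UnE CollectE exE conjE)
    fix a b assume t: "t = frag_of a - frag_of b" and mem: "a \<in> S2" "b \<in> S2" "I2 a b"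
    show ?thesis unfolding t groth_rels_def
      by (intro UnI1 CollectI exI[of _ "c v a"] exI[of _ "c v b"])
        (use mem v c iso2 in \<open>simp add: frag_bilinear_simps\<close>)
  next
    fix a b d assume t: "t = frag_of d - frag_of a - frag_of b" and mem: "a \<in> S2" "b \<in> S2" "d \<in> S2" "D2 d a b"
    show ?thesis unfolding t groth_rels_def
      by (intro UnI2 CollectI exI[of _ "c v a"] exI[of _ "c v b"] exI[of _ "c v d"])
        (use mem v c sum2 in \<open>simp add: frag_bilinear_simps\<close>)
  qed
  have ev: "?d (A.P.cls x) (B.P.cls y) = G.P.cls (frag_bilinear ?b x y)"
    if "Poly_Mapping.keys x \<subseteq> S1" "Poly_Mapping.keys y \<subseteq> S2" for x y
    by (rule induced_bilinear[OF A.P.presentation_axioms B.P.presentation_axioms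
          G.P.presentation_axioms _ _ _ that]) (use c rel1 rel2 G.P.kernel_rel in auto)
  have closed: "?d X Y \<in> carrier G.P.Q" if "X \<in> carrier A.P.Q" "Y \<in> carrier B.P.Q" for X Y
    using that by (elim A.P.carrier_QE B.P.carrier_QE) (simp add: ev keys G.P.cls_closed)
  have left: "?d (X \<otimes>\<^bsub>A.P.Q\<^esub> X') Y = ?d X Y \<otimes>\<^bsub>G.P.Q\<^esub> ?d X' Y"
    if "X \<in> carrier A.P.Q" "X' \<in> carrier A.P.Q" "Y \<in> carrier B.P.Q" for X X' Y
    using that by (elim A.P.carrier_QE B.P.carrier_QE)
      (simp add: ev keys A.P.cls_mult G.P.cls_mult keys_add_subset frag_bilinear_simps)
  have right: "?d X (Y \<otimes>\<^bsub>B.P.Q\<^esub> Y') = ?d X Y \<otimes>\<^bsub>G.P.Q\<^esub> ?d X Y'"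
    if "X \<in> carrier A.P.Q" "Y \<in> carrier B.P.Q" "Y' \<in> carrier B.P.Q" for X Y Y'
    using that by (elim A.P.carrier_QE B.P.carrier_QE)
      (simp add: ev keys B.P.cls_mult G.P.cls_mult keys_add_subset frag_bilinear_simps)
  note bil = tensor_bilinear[where c = ?d, OF A.ext.scalar_extension_axioms B.ext.scalar_extension_axioms
      G.ext.scalar_extension_axioms closed left right]
  show "module_map R M1 M3 (\<lambda>A. C A B)" if "B \<in> carrier M2"
    using bil(1)[of B] that by (simp only: M1_def M2_def M3_def C_def)
  show "module_map R M2 M3 (C A)" if "A \<in> carrier M1"
    using bil(2)[of A] that by (simp only: M1_def M2_def M3_def C_def)
  show "C (A.gen v) (B.gen u) = G.gen (c v u)" if "v \<in> S1" "u \<in> S2"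
    using bil(3)[of "\<one>\<^bsub>R\<^esub>" "\<one>\<^bsub>R\<^esub>" "A.P.cls (frag_of v)" "B.P.cls (frag_of u)"] that
      ev[of "frag_of v" "frag_of u"]
    by (simp add: C_def A.gen_def B.gen_def G.gen_def A.P.cls_closed B.P.cls_closed frag_bilinear_simps)
qed


section \<open>Recognising equivalences of linear categories\<close>

lemma lin_module: "linear_category R C \<Longrightarrow> X \<in> Obj C \<Longrightarrow> Y \<in> Obj C \<Longrightarrow> Module.module R (Hom C X Y)"
  and lin_ident: "linear_category R C \<Longrightarrow> X \<in> Obj C \<Longrightarrow> Ident C X \<in> carrier (Hom C X X)"
  and lin_post: "linear_category R C \<Longrightarrow> X \<in> Obj C \<Longrightarrow> Y \<in> Obj C \<Longrightarrow> Z \<in> Obj C \<Longrightarrow>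
    g \<in> carrier (Hom C Y Z) \<Longrightarrow> module_map R (Hom C X Y) (Hom C X Z) (Comp C X Y Z g)"
  and lin_pre: "linear_category R C \<Longrightarrow> X \<in> Obj C \<Longrightarrow> Y \<in> Obj C \<Longrightarrow> Z \<in> Obj C \<Longrightarrow>
    f \<in> carrier (Hom C X Y) \<Longrightarrow> module_map R (Hom C Y Z) (Hom C X Z) (\<lambda>g. Comp C X Y Z g f)"
  and lin_id_left: "linear_category R C \<Longrightarrow> X \<in> Obj C \<Longrightarrow> Y \<in> Obj C \<Longrightarrow>
    f \<in> carrier (Hom C X Y) \<Longrightarrow> Comp C X Y Y (Ident C Y) f = f"
  and lin_id_right: "linear_category R C \<Longrightarrow> X \<in> Obj C \<Longrightarrow> Y \<in> Obj C \<Longrightarrow>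
    f \<in> carrier (Hom C X Y) \<Longrightarrow> Comp C X X Y f (Ident C X) = f"
  and lin_assoc: "linear_category R C \<Longrightarrow> W \<in> Obj C \<Longrightarrow> X \<in> Obj C \<Longrightarrow> Y \<in> Obj C \<Longrightarrow> Z \<in> Obj C \<Longrightarrow>
    f \<in> carrier (Hom C W X) \<Longrightarrow> g \<in> carrier (Hom C X Y) \<Longrightarrow> h \<in> carrier (Hom C Y Z) \<Longrightarrow>
    Comp C W Y Z h (Comp C W X Y g f) = Comp C W X Z (Comp C X Y Z h g) f"
  by (simp_all add: linear_category_def)

lemma lin_comp:
  "linear_category R C \<Longrightarrow> X \<in> Obj C \<Longrightarrow> Y \<in> Obj C \<Longrightarrow> Z \<in> Obj C \<Longrightarrow>
    f \<in> carrier (Hom C X Y) \<Longrightarrow> g \<in> carrier (Hom C Y Z) \<Longrightarrow> Comp C X Y Z g f \<in> carrier (Hom C X Z)"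
  using lin_post[of R C X Y Z g] by (auto simp: module_map_def)

lemma comp_zero:
  "linear_category R C \<Longrightarrow> X \<in> Obj C \<Longrightarrow> Y \<in> Obj C \<Longrightarrow> Z \<in> Obj C \<Longrightarrow>
    g \<in> carrier (Hom C Y Z) \<Longrightarrow> Comp C X Y Z g \<zero>\<^bsub>Hom C X Y\<^esub> = \<zero>\<^bsub>Hom C X Z\<^esub>"
  and zero_comp:
  "linear_category R C \<Longrightarrow> X \<in> Obj C \<Longrightarrow> Y \<in> Obj C \<Longrightarrow> Z \<in> Obj C \<Longrightarrow>
    f \<in> carrier (Hom C X Y) \<Longrightarrow> Comp C X Y Z \<zero>\<^bsub>Hom C Y Z\<^esub> f = \<zero>\<^bsub>Hom C X Z\<^esub>"
  using module_map_zero[OF lin_module lin_module lin_post] module_map_zero[OF lin_module lin_module lin_pre]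
  by metis+

section \<open>Transport of linear structure along bijections\<close>

lemma module_transport:
  assumes "Module.module R M"
    and bij: "bij_betw p (carrier M) (carrier N)"
    and add: "\<And>x y. x \<in> carrier M \<Longrightarrow> y \<in> carrier M \<Longrightarrow> p (x \<oplus>\<^bsub>M\<^esub> y) = p x \<oplus>\<^bsub>N\<^esub> p y"
    and smult: "\<And>r x. r \<in> carrier R \<Longrightarrow> x \<in> carrier M \<Longrightarrow> p (r \<odot>\<^bsub>M\<^esub> x) = r \<odot>\<^bsub>N\<^esub> p x"
    and zero: "p \<zero>\<^bsub>M\<^esub> = \<zero>\<^bsub>N\<^esub>"
  shows "Module.module R N"
proof -
  interpret M: Module.module R M by fact
  have carrier: "carrier N = p ` carrier M" using bij by (simp add: bij_betw_def)
  note simps = add[symmetric] smult[symmetric] zero[symmetric]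
  have ab: "abelian_group N"
  proof (rule abelian_groupI)
    fix x assume "x \<in> carrier N"
    then obtain a where a: "a \<in> carrier M" "x = p a" using carrier by auto
    then have "p (\<ominus>\<^bsub>M\<^esub> a) \<oplus>\<^bsub>N\<^esub> x = \<zero>\<^bsub>N\<^esub>" by (simp add: simps M.M.l_neg)
    then show "\<exists>y\<in>carrier N. y \<oplus>\<^bsub>N\<^esub> x = \<zero>\<^bsub>N\<^esub>" using carrier a by blast
  qed (unfold carrier; (elim imageE)?; simp add: simps M.a_ac)+
  show ?thesis
    by (rule moduleI[OF M.R.is_cring ab]; unfold carrier; (elim imageE)?;
      simp add: simps M.smult_l_distr M.smult_r_distr M.smult_assoc1)
qed

text \<open>All arrows of \<open>D\<close> are images under \<open>p\<close>, and \<open>p\<close>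
  is compatible with every operation; so each axiom of \<open>D\<close> is the image of the same
  axiom of \<open>C\<close>. This replaces a direct verification that matrices form a linear
  category.\<close>

lemma linear_category_transport:
  assumes C: "linear_category R C" and Go: "Go \<in> Obj D \<rightarrow> Obj C"
    and bij: "\<And>X Y. X \<in> Obj D \<Longrightarrow> Y \<in> Obj D \<Longrightarrow>
      bij_betw (p X Y) (carrier (Hom C (Go X) (Go Y))) (carrier (Hom D X Y))"
    and map: "\<And>X Y. X \<in> Obj D \<Longrightarrow> Y \<in> Obj D \<Longrightarrow> module_map R (Hom C (Go X) (Go Y)) (Hom D X Y) (p X Y)"
    and zero: "\<And>X Y. X \<in> Obj D \<Longrightarrow> Y \<in> Obj D \<Longrightarrow> p X Y \<zero>\<^bsub>Hom C (Go X) (Go Y)\<^esub> = \<zero>\<^bsub>Hom D X Y\<^esub>"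
    and ident: "\<And>X. X \<in> Obj D \<Longrightarrow> p X X (Ident C (Go X)) = Ident D X"
    and comp: "\<And>X Y Z f g. X \<in> Obj D \<Longrightarrow> Y \<in> Obj D \<Longrightarrow> Z \<in> Obj D \<Longrightarrow>
      f \<in> carrier (Hom C (Go X) (Go Y)) \<Longrightarrow> g \<in> carrier (Hom C (Go Y) (Go Z)) \<Longrightarrow>
      p X Z (Comp C (Go X) (Go Y) (Go Z) g f) = Comp D X Y Z (p Y Z g) (p X Y f)"
  shows "linear_category R D"
proof -
  have Go': "X \<in> Obj D \<Longrightarrow> Go X \<in> Obj C" for X using Go by auto
  have carrier: "carrier (Hom D X Y) = p X Y ` carrier (Hom C (Go X) (Go Y))"
    if "X \<in> Obj D" "Y \<in> Obj D" for X Y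
    using bij[OF that] by (simp add: bij_betw_def)
  have add: "p X Y (f \<oplus>\<^bsub>Hom C (Go X) (Go Y)\<^esub> g) = p X Y f \<oplus>\<^bsub>Hom D X Y\<^esub> p X Y g"
    if "X \<in> Obj D" "Y \<in> Obj D" "f \<in> carrier (Hom C (Go X) (Go Y))" "g \<in> carrier (Hom C (Go X) (Go Y))" for X Y f g
    using map[OF that(1,2)] that(3-) by (simp add: module_map_def)
  have smult: "p X Y (r \<odot>\<^bsub>Hom C (Go X) (Go Y)\<^esub> g) = r \<odot>\<^bsub>Hom D X Y\<^esub> p X Y g"
    if "X \<in> Obj D" "Y \<in> Obj D" "r \<in> carrier R" "g \<in> carrier (Hom C (Go X) (Go Y))" for X Y r g
    using map[OF that(1,2)] that(3-) by (simp add: module_map_def)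
  note Cm = lin_module[OF C Go' Go'] and Cc = lin_comp[OF C Go' Go' Go']
  have add_closed: "f \<oplus>\<^bsub>Hom C (Go X) (Go Y)\<^esub> g \<in> carrier (Hom C (Go X) (Go Y))"
    if "X \<in> Obj D" "Y \<in> Obj D" "f \<in> carrier (Hom C (Go X) (Go Y))" "g \<in> carrier (Hom C (Go X) (Go Y))" for X Y f g
  proof -
    interpret Module.module R "Hom C (Go X) (Go Y)" using Cm that by blast
    show ?thesis using that by simp
  qed
  have smult_closed: "r \<odot>\<^bsub>Hom C (Go X) (Go Y)\<^esub> g \<in> carrier (Hom C (Go X) (Go Y))"
    if "X \<in> Obj D" "Y \<in> Obj D" "r \<in> carrier R" "g \<in> carrier (Hom C (Go X) (Go Y))" for X Y r g
  proof -
    interpret Module.module R "Hom C (Go X) (Go Y)" using Cm that by blast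
    show ?thesis using that by simp
  qed
  show ?thesis
    unfolding linear_category_def
  proof (intro conjI ballI)
    fix X Y assume XY: "X \<in> Obj D" "Y \<in> Obj D"
    show "Module.module R (Hom D X Y)"
      by (rule module_transport[OF Cm[OF XY] bij[OF XY]]) (simp_all add: add smult zero XY)
  next
    fix X assume "X \<in> Obj D"
    then show "Ident D X \<in> carrier (Hom D X X)"
      using lin_ident[OF C Go'] by (simp add: ident[symmetric] carrier)
  next
    fix X Y Z g assume XYZ: "X \<in> Obj D" "Y \<in> Obj D" "Z \<in> Obj D" and "g \<in> carrier (Hom D Y Z)"
    then obtain g' where g': "g' \<in> carrier (Hom C (Go Y) (Go Z))" "g = p Y Z g'" using carrier by auto
    have "module_map R (Hom C (Go X) (Go Y)) (Hom C (Go X) (Go Z)) (Comp C (Go X) (Go Y) (Go Z) g')"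
      using lin_post[OF C Go' Go' Go'] XYZ g' by blast
    then show "module_map R (Hom D X Y) (Hom D X Z) (Comp D X Y Z g)"
      unfolding module_map_def carrier[OF XYZ(1,2)] carrier[OF XYZ(1,3)] using XYZ g' Cc
      by (auto simp: add[symmetric] smult[symmetric] comp[symmetric] add_closed smult_closed Pi_iff)
  next
    fix X Y Z f assume XYZ: "X \<in> Obj D" "Y \<in> Obj D" "Z \<in> Obj D" and "f \<in> carrier (Hom D X Y)"
    then obtain f' where f': "f' \<in> carrier (Hom C (Go X) (Go Y))" "f = p X Y f'" using carrier by auto
    have "module_map R (Hom C (Go Y) (Go Z)) (Hom C (Go X) (Go Z)) (\<lambda>g. Comp C (Go X) (Go Y) (Go Z) g f')"
      using lin_pre[OF C Go' Go' Go'] XYZ f' by blast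
    then show "module_map R (Hom D Y Z) (Hom D X Z) (\<lambda>g. Comp D X Y Z g f)"
      unfolding module_map_def carrier[OF XYZ(2,3)] carrier[OF XYZ(1,3)] using XYZ f' Cc
      by (auto simp: add[symmetric] smult[symmetric] comp[symmetric] add_closed smult_closed Pi_iff)
  next
    fix X Y f assume XY: "X \<in> Obj D" "Y \<in> Obj D" and "f \<in> carrier (Hom D X Y)"
    then obtain f' where f': "f' \<in> carrier (Hom C (Go X) (Go Y))" "f = p X Y f'" using carrier by auto
    show "Comp D X Y Y (Ident D Y) f = f" "Comp D X X Y f (Ident D X) = f"
      using XY f' Go' lin_ident[OF C] lin_id_left[OF C] lin_id_right[OF C]
      by (simp_all add: ident[symmetric] comp[symmetric])
  next
    fix W X Y Z f g h assume WXYZ: "W \<in> Obj D" "X \<in> Obj D" "Y \<in> Obj D" "Z \<in> Obj D"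
      and "f \<in> carrier (Hom D W X)" "g \<in> carrier (Hom D X Y)" "h \<in> carrier (Hom D Y Z)"
    then obtain f' g' h' where
      "f' \<in> carrier (Hom C (Go W) (Go X))" "f = p W X f'"
      "g' \<in> carrier (Hom C (Go X) (Go Y))" "g = p X Y g'"
      "h' \<in> carrier (Hom C (Go Y) (Go Z))" "h = p Y Z h'"
      using carrier by auto
    then show "Comp D W Y Z h (Comp D W X Y g f) = Comp D W X Z (Comp D X Y Z h g) f"
      using WXYZ Go' Cc lin_assoc[OF C] by (simp add: comp[symmetric])
  qed
qed

text \<open>
  Each \<open>d \<in> T\<close> is a presentation of the object \<open>ob d\<close> of \<open>C\<close> by the object \<open>lab d\<close> of \<open>A\<close>, relative
  to which the arrows of \<open>C\<close> have coordinates in \<open>A\<close>.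
\<close>

locale coordinates =
  fixes R :: "('r, 's) ring_scheme" and C :: "('o, 'm, 'r) lincat" and A :: "('p, 'n, 'r) lincat"
    and T :: "'t set" and ob :: "'t \<Rightarrow> 'o" and lab :: "'t \<Rightarrow> 'p" and mat :: "'t \<Rightarrow> 't \<Rightarrow> 'm \<Rightarrow> 'n"
  assumes C: "linear_category R C"
    and ob: "d \<in> T \<Longrightarrow> ob d \<in> Obj C" and lab: "d \<in> T \<Longrightarrow> lab d \<in> Obj A"
    and ob_surj: "X \<in> Obj C \<Longrightarrow> \<exists>d \<in> T. ob d = X" and lab_surj: "a \<in> Obj A \<Longrightarrow> \<exists>d \<in> T. lab d = a"
    and bij: "d \<in> T \<Longrightarrow> e \<in> T \<Longrightarrow>
      bij_betw (mat d e) (carrier (Hom C (ob d) (ob e))) (carrier (Hom A (lab d) (lab e)))"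
    and map: "d \<in> T \<Longrightarrow> e \<in> T \<Longrightarrow> module_map R (Hom C (ob d) (ob e)) (Hom A (lab d) (lab e)) (mat d e)"
    and zero: "d \<in> T \<Longrightarrow> e \<in> T \<Longrightarrow> mat d e \<zero>\<^bsub>Hom C (ob d) (ob e)\<^esub> = \<zero>\<^bsub>Hom A (lab d) (lab e)\<^esub>"
    and ident: "d \<in> T \<Longrightarrow> mat d d (Ident C (ob d)) = Ident A (lab d)"
    and comp: "d \<in> T \<Longrightarrow> e \<in> T \<Longrightarrow> k \<in> T \<Longrightarrow>
      f \<in> carrier (Hom C (ob d) (ob e)) \<Longrightarrow> g \<in> carrier (Hom C (ob e) (ob k)) \<Longrightarrow>
      mat d k (Comp C (ob d) (ob e) (ob k) g f) = Comp A (lab d) (lab e) (lab k) (mat e k g) (mat d e f)"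
begin

text \<open>A presentation is chosen for each object of \<open>C\<close> and, independently, for
  each object of \<open>A\<close>. Going around both ways compares two presentations that share only
  the label or only the object.\<close>

definition "dC X = (SOME d. d \<in> T \<and> ob d = X)"
definition "dA a = (SOME d. d \<in> T \<and> lab d = a)"
definition "unmat d e = inv_into (carrier (Hom C (ob d) (ob e))) (mat d e)"

lemma dC: "X \<in> Obj C \<Longrightarrow> dC X \<in> T" "X \<in> Obj C \<Longrightarrow> ob (dC X) = X"
  using someI_ex[of "\<lambda>d. d \<in> T \<and> ob d = X"] ob_surj unfolding dC_def by blast+

lemma dA: "a \<in> Obj A \<Longrightarrow> dA a \<in> T" "a \<in> Obj A \<Longrightarrow> lab (dA a) = a"
  using someI_ex[of "\<lambda>d. d \<in> T \<and> lab d = a"] lab_surj unfolding dA_def by blast+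

lemma mat_closed:
  "d \<in> T \<Longrightarrow> e \<in> T \<Longrightarrow> f \<in> carrier (Hom C (ob d) (ob e)) \<Longrightarrow> mat d e f \<in> carrier (Hom A (lab d) (lab e))"
  using bij[of d e] by (auto simp: bij_betw_def)

lemma mat_inj:
  "mat d e f = mat d e g \<Longrightarrow> d \<in> T \<Longrightarrow> e \<in> T \<Longrightarrow> f \<in> carrier (Hom C (ob d) (ob e)) \<Longrightarrow>
    g \<in> carrier (Hom C (ob d) (ob e)) \<Longrightarrow> f = g"
  using bij[of d e] by (auto simp: bij_betw_def inj_on_def)

lemma unmat:
  assumes "d \<in> T" "e \<in> T" "M \<in> carrier (Hom A (lab d) (lab e))"
  shows "unmat d e M \<in> carrier (Hom C (ob d) (ob e))" "mat d e (unmat d e M) = M"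
  using assms bij[OF assms(1,2)] unfolding unmat_def
  by (auto simp: bij_betw_def inv_into_into f_inv_into_f)

text \<open>Every object of \<open>A\<close> is the label of the presentation \<open>dA\<close>, so
  \<open>mat\<close> between these presentations transports the linear structure of
  \<open>C\<close>.\<close>

lemma linear_A: "linear_category R A"
proof (rule linear_category_transport[OF C, where Go = "\<lambda>a. ob (dA a)" and p = "\<lambda>a b. mat (dA a) (dA b)"])
  fix X Y assume "X \<in> Obj A" "Y \<in> Obj A"
  then show "bij_betw (mat (dA X) (dA Y)) (carrier (Hom C (ob (dA X)) (ob (dA Y)))) (carrier (Hom A X Y))"
    and "module_map R (Hom C (ob (dA X)) (ob (dA Y))) (Hom A X Y) (mat (dA X) (dA Y))"
    and "mat (dA X) (dA Y) \<zero>\<^bsub>Hom C (ob (dA X)) (ob (dA Y))\<^esub> = \<zero>\<^bsub>Hom A X Y\<^esub>"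
    using bij[of "dA X" "dA Y"] map[of "dA X" "dA Y"] zero[of "dA X" "dA Y"] dA by simp_all
next
  fix X assume "X \<in> Obj A"
  then show "mat (dA X) (dA X) (Ident C (ob (dA X))) = Ident A X"
    using ident[of "dA X"] dA by simp
next
  fix X Y Z f g assume "X \<in> Obj A" "Y \<in> Obj A" "Z \<in> Obj A"
    "f \<in> carrier (Hom C (ob (dA X)) (ob (dA Y)))" "g \<in> carrier (Hom C (ob (dA Y)) (ob (dA Z)))"
  then show "mat (dA X) (dA Z) (Comp C (ob (dA X)) (ob (dA Y)) (ob (dA Z)) g f) =
      Comp A X Y Z (mat (dA Y) (dA Z) g) (mat (dA X) (dA Y) f)"
    using comp[of "dA X" "dA Y" "dA Z" f g] dA by simp
qed (use dA ob in auto)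

lemma unmat_map:
  assumes "d \<in> T" "e \<in> T"
  shows "module_map R (Hom A (lab d) (lab e)) (Hom C (ob d) (ob e)) (unmat d e)"
proof -
  interpret H: Module.module R "Hom C (ob d) (ob e)" using lin_module[OF C] ob assms by blast
  interpret K: Module.module R "Hom A (lab d) (lab e)" using lin_module[OF linear_A] lab assms by blast
  note u = unmat[OF assms]
  have m: "mat d e (f \<oplus>\<^bsub>Hom C (ob d) (ob e)\<^esub> g) = mat d e f \<oplus>\<^bsub>Hom A (lab d) (lab e)\<^esub> mat d e g"
    if "f \<in> carrier (Hom C (ob d) (ob e))" "g \<in> carrier (Hom C (ob d) (ob e))" for f g
    using map[OF assms] that by (simp add: module_map_def)
  have m': "mat d e (r \<odot>\<^bsub>Hom C (ob d) (ob e)\<^esub> f) = r \<odot>\<^bsub>Hom A (lab d) (lab e)\<^esub> mat d e f"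
    if "r \<in> carrier R" "f \<in> carrier (Hom C (ob d) (ob e))" for f r
    using map[OF assms] that by (simp add: module_map_def)
  show ?thesis
    unfolding module_map_def
  proof (intro conjI ballI funcsetI)
    fix M N assume "M \<in> carrier (Hom A (lab d) (lab e))" "N \<in> carrier (Hom A (lab d) (lab e))"
    then show "unmat d e (M \<oplus>\<^bsub>Hom A (lab d) (lab e)\<^esub> N) = unmat d e M \<oplus>\<^bsub>Hom C (ob d) (ob e)\<^esub> unmat d e N"
      by (intro mat_inj[OF _ assms]) (simp_all add: u m)
  next
    fix r M assume "r \<in> carrier R" "M \<in> carrier (Hom A (lab d) (lab e))"
    then show "unmat d e (r \<odot>\<^bsub>Hom A (lab d) (lab e)\<^esub> M) = r \<odot>\<^bsub>Hom C (ob d) (ob e)\<^esub> unmat d e M"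
      by (intro mat_inj[OF _ assms]) (simp_all add: u m')
  qed (rule u)
qed

text \<open>Both functors act by coordinates in the chosen presentations. \<open>dC X\<close> and
  \<open>dA (Fo X)\<close> have the same label, so the identity matrix between them is the matrix of
  an arrow \<open>\<eta> X\<close> between their objects. \<open>dC (Go a)\<close> and
  \<open>dA a\<close> have the same object, so its identity arrow has a matrix
  \<open>\<epsilon> a\<close> between their labels.\<close>

theorem equivalence: "linear_equivalent R C A"
proof -
  define Fo Fm Go Gm \<eta> \<epsilon> where "Fo = (\<lambda>X. lab (dC X))" and "Fm = (\<lambda>X Y. mat (dC X) (dC Y))"
    and "Go = (\<lambda>a. ob (dA a))" and "Gm = (\<lambda>a b. unmat (dA a) (dA b))"
    and "\<eta> = (\<lambda>X. unmat (dC X) (dA (Fo X)) (Ident A (Fo X)))"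
    and "\<epsilon> = (\<lambda>a. mat (dC (Go a)) (dA a) (Ident C (Go a)))"
  have Fo: "X \<in> Obj C \<Longrightarrow> Fo X \<in> Obj A" and Go: "a \<in> Obj A \<Longrightarrow> Go a \<in> Obj C" for X a
    using dC dA ob lab by (auto simp: Fo_def Go_def)
  note idA = lin_ident[OF linear_A] and idC = lin_ident[OF C]
  note Cc = lin_comp[OF C] and Ac = lin_comp[OF linear_A]
  have F: "linear_functor R C A Fo Fm"
    unfolding linear_functor_def
  proof (intro conjI ballI)
    fix X Y assume "X \<in> Obj C" "Y \<in> Obj C"
    then show "module_map R (Hom C X Y) (Hom A (Fo X) (Fo Y)) (Fm X Y)"
      using map[of "dC X" "dC Y"] dC by (simp add: Fo_def Fm_def)
  next
    fix X assume "X \<in> Obj C"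
    then show "Fm X X (Ident C X) = Ident A (Fo X)"
      using ident[of "dC X"] dC by (simp add: Fo_def Fm_def)
  next
    fix X Y Z f g assume "X \<in> Obj C" "Y \<in> Obj C" "Z \<in> Obj C" "f \<in> carrier (Hom C X Y)" "g \<in> carrier (Hom C Y Z)"
    then show "Fm X Z (Comp C X Y Z g f) = Comp A (Fo X) (Fo Y) (Fo Z) (Fm Y Z g) (Fm X Y f)"
      using comp[of "dC X" "dC Y" "dC Z" f g] dC by (simp add: Fo_def Fm_def)
  qed (use Fo in auto)
  have Gm: "Gm a b M \<in> carrier (Hom C (Go a) (Go b))" "mat (dA a) (dA b) (Gm a b M) = M"
    if "a \<in> Obj A" "b \<in> Obj A" "M \<in> carrier (Hom A a b)" for a b M
    using unmat[of "dA a" "dA b" M] dA that by (auto simp: Gm_def Go_def)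
  have G: "linear_functor R A C Go Gm"
    unfolding linear_functor_def
  proof (intro conjI ballI)
    fix a b assume "a \<in> Obj A" "b \<in> Obj A"
    then show "module_map R (Hom A a b) (Hom C (Go a) (Go b)) (Gm a b)"
      using unmat_map[of "dA a" "dA b"] dA by (simp add: Go_def Gm_def)
  next
    fix a assume a: "a \<in> Obj A"
    \<comment> \<open>Arrows of \<open>C\<close> are compared through their matrices, here and in
      the equations for \<open>\<eta>\<close>.\<close>
    show "Gm a a (Ident A a) = Ident C (Go a)"
      by (rule mat_inj[of "dA a" "dA a"])
        (use a Gm[OF a a] idA[OF a] idC[OF Go[OF a]] ident[of "dA a"] dA in \<open>auto simp: Go_def\<close>)
  next
    fix a b c M N assume abc: "a \<in> Obj A" "b \<in> Obj A" "c \<in> Obj A"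
      and MN: "M \<in> carrier (Hom A a b)" "N \<in> carrier (Hom A b c)"
    note GM = Gm[OF abc(1,2) MN(1)] and GN = Gm[OF abc(2,3) MN(2)]
    note GNM = Gm[OF abc(1,3) Ac[OF abc MN]]
    show "Gm a c (Comp A a b c N M) = Comp C (Go a) (Go b) (Go c) (Gm b c N) (Gm a b M)"
      by (rule mat_inj[of "dA a" "dA c"])
        (use abc MN GM GN GNM Cc[OF Go Go Go] comp[of "dA a" "dA b" "dA c"] dA in \<open>auto simp: Go_def\<close>)
  qed (use Go in auto)
  have \<eta>: "\<eta> X \<in> carrier (Hom C X (Go (Fo X)))" "mat (dC X) (dA (Fo X)) (\<eta> X) = Ident A (Fo X)"
    if X: "X \<in> Obj C" for X
    using unmat[of "dC X" "dA (Fo X)" "Ident A (Fo X)"] dC[OF X] dA[OF Fo[OF X]] idA[OF Fo[OF X]]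
    by (auto simp: \<eta>_def Go_def Fo_def)
  have "natural_iso C C (\<lambda>X. X) (\<lambda>X Y f. f) (\<lambda>X. Go (Fo X)) (\<lambda>X Y f. Gm (Fo X) (Fo Y) (Fm X Y f)) \<eta>"
    unfolding natural_iso_def
  proof (intro conjI ballI)
    fix X assume X: "X \<in> Obj C"
    \<comment> \<open>\<open>g\<close>, the prospective inverse of \<open>\<eta> X\<close>, is the
      arrow with identity matrix in the opposite direction.\<close>
    define d e g where "d = dC X" and "e = dA (Fo X)" and "g = unmat e d (Ident A (Fo X))"
    have d: "d \<in> T" "ob d = X" "lab d = Fo X" and e: "e \<in> T" "lab e = Fo X" "ob e = Go (Fo X)"
      using dC[OF X] dA[OF Fo[OF X]] by (auto simp: d_def e_def Fo_def Go_def)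
    have g: "g \<in> carrier (Hom C (Go (Fo X)) X)" "mat e d g = Ident A (Fo X)"
      using unmat[OF e(1) d(1)] d e idA[OF Fo[OF X]] by (auto simp: g_def)
    note h = \<eta>[OF X, folded d_def e_def]
    note id = lin_id_left[OF linear_A _ _ idA, of "Fo X"]
    show "iso_arrow C X (Go (Fo X)) (\<eta> X)"
      unfolding iso_arrow_def
    proof (intro conjI bexI)
      show "Comp C X (Go (Fo X)) X g (\<eta> X) = Ident C X"
        by (rule mat_inj[of d d])
          (use X Fo Go d e g h id comp[of d e d "\<eta> X" g] ident[of d] idC Cc in auto)
      show "Comp C (Go (Fo X)) X (Go (Fo X)) (\<eta> X) g = Ident C (Go (Fo X))"
        by (rule mat_inj[of e e])
          (use X Fo Go d e g h id comp[of e d e g "\<eta> X"] ident[of e] idC Cc in auto)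
    qed (use g h in auto)
  next
    fix X Y f assume XY: "X \<in> Obj C" "Y \<in> Obj C" and f: "f \<in> carrier (Hom C X Y)"
    define d e d' e' where "d = dC X" and "e = dA (Fo X)" and "d' = dC Y" and "e' = dA (Fo Y)"
    have d: "d \<in> T" "ob d = X" "lab d = Fo X" and e: "e \<in> T" "lab e = Fo X" "ob e = Go (Fo X)"
      and d': "d' \<in> T" "ob d' = Y" "lab d' = Fo Y" and e': "e' \<in> T" "lab e' = Fo Y" "ob e' = Go (Fo Y)"
      using dC[OF XY(1)] dA[OF Fo[OF XY(1)]] dC[OF XY(2)] dA[OF Fo[OF XY(2)]]
      by (auto simp: d_def e_def d'_def e'_def Fo_def Go_def)
    note h = \<eta>[OF XY(1), folded d_def e_def] and h' = \<eta>[OF XY(2), folded d'_def e'_def]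
    have m: "Fm X Y f = mat d d' f" by (simp add: Fm_def d_def d'_def)
    have mc: "mat d d' f \<in> carrier (Hom A (Fo X) (Fo Y))" using mat_closed[OF d(1) d'(1)] d d' f by simp
    have gm: "Gm (Fo X) (Fo Y) (mat d d' f) \<in> carrier (Hom C (Go (Fo X)) (Go (Fo Y)))"
      "mat e e' (Gm (Fo X) (Fo Y) (mat d d' f)) = mat d d' f"
      using Gm[OF Fo Fo mc] XY by (auto simp: e_def e'_def)
    show "Comp C X Y (Go (Fo Y)) (\<eta> Y) f =
      Comp C X (Go (Fo X)) (Go (Fo Y)) (Gm (Fo X) (Fo Y) (Fm X Y f)) (\<eta> X)"
      unfolding m
    proof (rule mat_inj[of d e'])
      \<comment> \<open>Since \<open>\<eta>\<close> has identity matrices, both sides of the square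
        have the matrix of \<open>f\<close>.\<close>
      have "mat d e' (Comp C X Y (Go (Fo Y)) (\<eta> Y) f) = mat d d' f"
        using comp[of d d' e' f "\<eta> Y"] d d' e' f h' mc lin_id_left[OF linear_A Fo Fo] XY by simp
      moreover have "mat d e' (Comp C X (Go (Fo X)) (Go (Fo Y)) (Gm (Fo X) (Fo Y) (mat d d' f)) (\<eta> X)) = mat d d' f"
        using comp[of d e e' "\<eta> X" "Gm (Fo X) (Fo Y) (mat d d' f)"] d e e' h gm mc
          lin_id_right[OF linear_A Fo Fo] XY by simp
      ultimately show "mat d e' (Comp C X Y (Go (Fo Y)) (\<eta> Y) f) =
        mat d e' (Comp C X (Go (Fo X)) (Go (Fo Y)) (Gm (Fo X) (Fo Y) (mat d d' f)) (\<eta> X))" by simp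
    qed (use XY Fo Go d d' e e' f h h' gm Cc in auto)
  qed
  moreover have "natural_iso A A (\<lambda>a. Fo (Go a)) (\<lambda>a b M. Fm (Go a) (Go b) (Gm a b M)) (\<lambda>a. a) (\<lambda>a b M. M) \<epsilon>"
    unfolding natural_iso_def
  proof (intro conjI ballI)
    fix a assume a: "a \<in> Obj A"
    define d e where "d = dC (Go a)" and "e = dA a"
    have d: "d \<in> T" "ob d = Go a" "lab d = Fo (Go a)" and e: "e \<in> T" "lab e = a" "ob e = Go a"
      using dC[OF Go[OF a]] dA[OF a] by (auto simp: d_def e_def Fo_def Go_def)
    note idG = idC[OF Go[OF a]] lin_id_left[OF C Go[OF a] Go[OF a] idC[OF Go[OF a]]]
    show "iso_arrow A (Fo (Go a)) a (\<epsilon> a)"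
      unfolding iso_arrow_def
    proof (intro conjI bexI)
      \<comment> \<open>A change of coordinates is inverted by the change in the other direction; by
        multiplicativity of \<open>mat\<close> both equations reduce to
        \<open>Ident C (Go a)\<close> composed with itself.\<close>
      show "Comp A (Fo (Go a)) a (Fo (Go a)) (mat e d (Ident C (Go a))) (\<epsilon> a) = Ident A (Fo (Go a))"
        using comp[of d e d "Ident C (Go a)" "Ident C (Go a)"] d e idG ident[of d]
        by (simp add: \<epsilon>_def flip: d_def e_def)
      show "Comp A a (Fo (Go a)) a (\<epsilon> a) (mat e d (Ident C (Go a))) = Ident A a"
        using comp[of e d e "Ident C (Go a)" "Ident C (Go a)"] d e idG ident[of e]
        by (simp add: \<epsilon>_def flip: d_def e_def)
    qed (use mat_closed[of d e] mat_closed[of e d] d e idG in \<open>auto simp: \<epsilon>_def simp flip: d_def e_def\<close>)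
  next
    fix a b M assume ab: "a \<in> Obj A" "b \<in> Obj A" and M: "M \<in> carrier (Hom A a b)"
    define d e d' e' where "d = dC (Go a)" and "e = dA a" and "d' = dC (Go b)" and "e' = dA b"
    have d: "d \<in> T" "ob d = Go a" "lab d = Fo (Go a)" and e: "e \<in> T" "lab e = a" "ob e = Go a"
      and d': "d' \<in> T" "ob d' = Go b" "lab d' = Fo (Go b)" and e': "e' \<in> T" "lab e' = b" "ob e' = Go b"
      using dC[OF Go[OF ab(1)]] dA[OF ab(1)] dC[OF Go[OF ab(2)]] dA[OF ab(2)]
      by (auto simp: d_def e_def d'_def e'_def Fo_def Go_def)
    note g = Gm[OF ab M, folded e_def e'_def]
    note l = lin_id_left[OF C Go[OF ab(1)] Go[OF ab(2)] g(1)] and r = lin_id_right[OF C Go[OF ab(1)] Go[OF ab(2)] g(1)]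
    have "Comp A (Fo (Go a)) (Fo (Go b)) b (\<epsilon> b) (Fm (Go a) (Go b) (Gm a b M)) = mat d e' (Gm a b M)"
      using comp[of d d' e' "Gm a b M" "Ident C (Go b)"] d d' e' g l idC[OF Go[OF ab(2)]]
      by (simp add: \<epsilon>_def Fm_def flip: d_def d'_def e'_def)
    moreover have "Comp A (Fo (Go a)) a b M (\<epsilon> a) = mat d e' (Gm a b M)"
      using comp[of d e e' "Ident C (Go a)" "Gm a b M"] d e e' g r idC[OF Go[OF ab(1)]]
      by (simp add: \<epsilon>_def flip: d_def e_def)
    ultimately show "Comp A (Fo (Go a)) (Fo (Go b)) b (\<epsilon> b) (Fm (Go a) (Go b) (Gm a b M)) =
      Comp A (Fo (Go a)) a b M (\<epsilon> a)" by simp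
  qed
  ultimately show ?thesis
    unfolding linear_equivalent_def using C linear_A F G by blast
qed

end


section \<open>Categories generated by finite biproducts\<close>

lemma module_map_finsum:
  assumes "Module.module R M" "Module.module R N" and f: "module_map R M N f"
    and "finite A" "g \<in> A \<rightarrow> carrier M"
  shows "f (\<Oplus>\<^bsub>M\<^esub> i\<in>A. g i) = (\<Oplus>\<^bsub>N\<^esub> i\<in>A. f (g i))"
  using assms(4,5)
proof (induction A rule: finite_induct)
  interpret M: Module.module R M by fact
  interpret N: Module.module R N by fact
  have closed: "f x \<in> carrier N" if "x \<in> carrier M" for x
    using f that by (auto simp: module_map_def)
  {
    case empty
    show ?case using module_map_zero[OF assms(1-3)] by simp
  next
    case (insert a A)
    then have g: "g \<in> A \<rightarrow> carrier M" "g a \<in> carrier M" by auto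
    then have fg: "(\<lambda>i. f (g i)) \<in> A \<rightarrow> carrier N" "f (g a) \<in> carrier N" using closed by auto
    have "f (g a \<oplus>\<^bsub>M\<^esub> (\<Oplus>\<^bsub>M\<^esub> i\<in>A. g i)) = f (g a) \<oplus>\<^bsub>N\<^esub> f (\<Oplus>\<^bsub>M\<^esub> i\<in>A. g i)"
      using f g by (simp add: module_map_def)
    then show ?case
      using insert.IH[OF g(1)] M.M.finsum_insert[OF insert.hyps g] N.M.finsum_insert[OF insert.hyps fg] by simp
  }
qed

lemma (in abelian_monoid) finsum_delta:
  assumes "finite A" "k \<in> A" "f k \<in> carrier G" "\<And>i. i \<in> A \<Longrightarrow> i \<noteq> k \<Longrightarrow> f i = \<zero>"
  shows "(\<Oplus>i\<in>A. f i) = f k"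
proof -
  have "(\<Oplus>i\<in>A. f i) = (\<Oplus>i\<in>A. if k = i then f i else \<zero>)"
    using assms by (intro finsum_cong') auto
  also have "\<dots> = (\<Oplus>i\<in>A. if k = i then (\<lambda>_. f k) i else \<zero>)"
    using assms by (intro finsum_cong') auto
  also have "\<dots> = f k"
    using add.finprod_singleton[of k A "\<lambda>_. f k"] assms by simp
  finally show ?thesis .
qed

text \<open>\<open>P\<close> and the inverse of \<open>\<Psi>\<close> embed \<open>D\<close> fully
  faithfully into \<open>C\<close>. On the side of \<open>D\<close> only modules of morphisms are
  assumed; its composition and identities are known through \<open>\<Psi>\<close>.\<close>

locale biproduct_cover =
  fixes R :: "('r, 's) ring_scheme" and C :: "('o, 'm, 'r) lincat" and D :: "('d, 'n, 'r) lincat"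
    and P :: "'d \<Rightarrow> 'o" and \<Psi> :: "'d \<Rightarrow> 'd \<Rightarrow> 'm \<Rightarrow> 'n"
  assumes C: "linear_category R C"
    and D_module: "x \<in> Obj D \<Longrightarrow> y \<in> Obj D \<Longrightarrow> Module.module R (Hom D x y)"
    and P: "x \<in> Obj D \<Longrightarrow> P x \<in> Obj C"
    and \<Psi>_bij: "x \<in> Obj D \<Longrightarrow> y \<in> Obj D \<Longrightarrow>
      bij_betw (\<Psi> x y) (carrier (Hom C (P x) (P y))) (carrier (Hom D x y))"
    and \<Psi>_map: "x \<in> Obj D \<Longrightarrow> y \<in> Obj D \<Longrightarrow> module_map R (Hom C (P x) (P y)) (Hom D x y) (\<Psi> x y)"
    and \<Psi>_ident: "x \<in> Obj D \<Longrightarrow> \<Psi> x x (Ident C (P x)) = Ident D x"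
    and \<Psi>_comp: "x \<in> Obj D \<Longrightarrow> y \<in> Obj D \<Longrightarrow> z \<in> Obj D \<Longrightarrow>
      f \<in> carrier (Hom C (P x) (P y)) \<Longrightarrow> g \<in> carrier (Hom C (P y) (P z)) \<Longrightarrow>
      \<Psi> x z (Comp C (P x) (P y) (P z) g f) = Comp D x y z (\<Psi> y z g) (\<Psi> x y f)"
begin

text \<open>The equational form of a biproduct, with injections \<open>\<iota>\<close> and
  projections \<open>\<pi>\<close>, which is all that bilinear calculations use. The empty list is
  allowed and says that \<open>Ident C X\<close> is zero.\<close>

definition decomposition :: "'o \<Rightarrow> 'd list \<Rightarrow> (nat \<Rightarrow> 'm) \<Rightarrow> (nat \<Rightarrow> 'm) \<Rightarrow> bool"
  where "decomposition X xs \<iota> \<pi> \<longleftrightarrow> X \<in> Obj C \<and> xs \<in> lists (Obj D) \<and>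
    (\<forall>i<length xs. \<iota> i \<in> carrier (Hom C (P (xs ! i)) X) \<and> \<pi> i \<in> carrier (Hom C X (P (xs ! i)))) \<and>
    (\<forall>i<length xs. \<forall>j<length xs. Comp C (P (xs ! j)) X (P (xs ! i)) (\<pi> i) (\<iota> j) =
      (if i = j then Ident C (P (xs ! i)) else \<zero>\<^bsub>Hom C (P (xs ! j)) (P (xs ! i))\<^esub>)) \<and>
    (\<Oplus>\<^bsub>Hom C X X\<^esub> i\<in>{..<length xs}. Comp C X (P (xs ! i)) X (\<iota> i) (\<pi> i)) = Ident C X"

definition "coord X xs \<iota> Y ys \<rho> f = (\<lambda>(i, j) \<in> mat_index xs ys.
  \<Psi> (xs ! j) (ys ! i) (Comp C (P (xs ! j)) Y (P (ys ! i)) (\<rho> i) (Comp C (P (xs ! j)) X Y f (\<iota> j))))"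

lemma decompositionD:
  assumes "decomposition X xs \<iota> \<pi>"
  shows "X \<in> Obj C" "i < length xs \<Longrightarrow> xs ! i \<in> Obj D" "i < length xs \<Longrightarrow> P (xs ! i) \<in> Obj C"
    "i < length xs \<Longrightarrow> \<iota> i \<in> carrier (Hom C (P (xs ! i)) X)"
    "i < length xs \<Longrightarrow> \<pi> i \<in> carrier (Hom C X (P (xs ! i)))"
    "i < length xs \<Longrightarrow> Comp C (P (xs ! i)) X (P (xs ! i)) (\<pi> i) (\<iota> i) = Ident C (P (xs ! i))"
    "i < length xs \<Longrightarrow> j < length xs \<Longrightarrow> i \<noteq> j \<Longrightarrow>
      Comp C (P (xs ! j)) X (P (xs ! i)) (\<pi> i) (\<iota> j) = \<zero>\<^bsub>Hom C (P (xs ! j)) (P (xs ! i))\<^esub>"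
    "(\<Oplus>\<^bsub>Hom C X X\<^esub> i\<in>{..<length xs}. Comp C X (P (xs ! i)) X (\<iota> i) (\<pi> i)) = Ident C X"
  using assms P by (auto simp: decomposition_def in_lists_conv_set)

text \<open>\<open>Ident C X\<close> is inserted between \<open>u\<close> and \<open>v\<close>,
  expanded as the sum of the composites of \<open>\<pi> i\<close> with \<open>\<iota> i\<close>, and
  the sum is pulled out by bilinearity. The formula yields both injectivity of coordinates and the
  rule for matrix products.\<close>

lemma through:
  assumes d: "decomposition X xs \<iota> \<pi>" and W: "W \<in> Obj C" and Z: "Z \<in> Obj C"
    and u: "u \<in> carrier (Hom C X Z)" and v: "v \<in> carrier (Hom C W X)"
  shows "Comp C W X Z u v = (\<Oplus>\<^bsub>Hom C W Z\<^esub> i\<in>{..<length xs}.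
    Comp C W (P (xs ! i)) Z (Comp C (P (xs ! i)) X Z u (\<iota> i)) (Comp C W X (P (xs ! i)) (\<pi> i) v))"
proof -
  note [simp] = decompositionD(1-5)[OF d] and Cc = lin_comp[OF C]
  interpret WZ: Module.module R "Hom C W Z" using lin_module[OF C W Z] .
  have "Comp C W X Z u v = Comp C W X Z u (Comp C W X X (Ident C X) v)"
    using lin_id_left[OF C W _ v] by simp
  also have "Comp C W X X (Ident C X) v =
    (\<Oplus>\<^bsub>Hom C W X\<^esub> i\<in>{..<length xs}. Comp C W X X (Comp C X (P (xs ! i)) X (\<iota> i) (\<pi> i)) v)"
    unfolding decompositionD(8)[OF d, symmetric]
    by (rule module_map_finsum[where f = "\<lambda>g. Comp C W X X g v", OF lin_module[OF C] lin_module[OF C] lin_pre[OF C]])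
      (use W v Cc in auto)
  also have "Comp C W X Z u \<dots> =
    (\<Oplus>\<^bsub>Hom C W Z\<^esub> i\<in>{..<length xs}. Comp C W X Z u (Comp C W X X (Comp C X (P (xs ! i)) X (\<iota> i) (\<pi> i)) v))"
    by (rule module_map_finsum[OF lin_module[OF C] lin_module[OF C] lin_post[OF C]])
      (use W Z u v Cc in auto)
  also have "\<dots> = (\<Oplus>\<^bsub>Hom C W Z\<^esub> i\<in>{..<length xs}.
    Comp C W (P (xs ! i)) Z (Comp C (P (xs ! i)) X Z u (\<iota> i)) (Comp C W X (P (xs ! i)) (\<pi> i) v))"
  proof (intro WZ.M.finsum_cong')
    fix i assume i: "i \<in> {..<length xs}"
    have "Comp C W X X (Comp C X (P (xs ! i)) X (\<iota> i) (\<pi> i)) v =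
      Comp C W (P (xs ! i)) X (\<iota> i) (Comp C W X (P (xs ! i)) (\<pi> i) v)"
      using i W v by (simp add: lin_assoc[OF C])
    then show "Comp C W X Z u (Comp C W X X (Comp C X (P (xs ! i)) X (\<iota> i) (\<pi> i)) v) =
      Comp C W (P (xs ! i)) Z (Comp C (P (xs ! i)) X Z u (\<iota> i)) (Comp C W X (P (xs ! i)) (\<pi> i) v)"
      using i W Z u v by (simp add: lin_assoc[OF C] Cc)
  qed (use W Z u v Cc in auto)
  finally show ?thesis .
qed

lemma coord_apply:
  "i < length ys \<Longrightarrow> j < length xs \<Longrightarrow> coord X xs \<iota> Y ys \<rho> f (i, j) =
    \<Psi> (xs ! j) (ys ! i) (Comp C (P (xs ! j)) Y (P (ys ! i)) (\<rho> i) (Comp C (P (xs ! j)) X Y f (\<iota> j)))"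
  by (simp add: coord_def mat_index_def)

lemma \<Psi>_closed: "x \<in> Obj D \<Longrightarrow> y \<in> Obj D \<Longrightarrow> f \<in> carrier (Hom C (P x) (P y)) \<Longrightarrow> \<Psi> x y f \<in> carrier (Hom D x y)"
  using \<Psi>_map[of x y] by (auto simp: module_map_def)

lemma \<Psi>_zero: "x \<in> Obj D \<Longrightarrow> y \<in> Obj D \<Longrightarrow> \<Psi> x y \<zero>\<^bsub>Hom C (P x) (P y)\<^esub> = \<zero>\<^bsub>Hom D x y\<^esub>"
  by (rule module_map_zero[OF lin_module[OF C] D_module \<Psi>_map]) (auto simp: P)

abbreviation "entry X xs \<iota> Y ys \<rho> i j f \<equiv>
  Comp C (P (xs ! j)) Y (P (ys ! i)) (\<rho> i) (Comp C (P (xs ! j)) X Y f (\<iota> j))"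

lemma entry_map:
  assumes d: "decomposition X xs \<iota> \<pi>" and e: "decomposition Y ys \<kappa> \<rho>" and "i < length ys" "j < length xs"
  shows "module_map R (Hom C X Y) (Hom C (P (xs ! j)) (P (ys ! i))) (entry X xs \<iota> Y ys \<rho> i j)"
proof -
  note [simp] = decompositionD(1-5)[OF d] decompositionD(1-5)[OF e]
  have "module_map R (Hom C X Y) (Hom C (P (xs ! j)) Y) (\<lambda>f. Comp C (P (xs ! j)) X Y f (\<iota> j))"
    "module_map R (Hom C (P (xs ! j)) Y) (Hom C (P (xs ! j)) (P (ys ! i))) (Comp C (P (xs ! j)) Y (P (ys ! i)) (\<rho> i))"
    by (rule lin_pre[OF C] lin_post[OF C]; simp add: assms)+
  then show ?thesis unfolding module_map_def by (simp add: Pi_iff)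
qed

lemma entry_closed:
  assumes "decomposition X xs \<iota> \<pi>" "decomposition Y ys \<kappa> \<rho>" "i < length ys" "j < length xs"
    "f \<in> carrier (Hom C X Y)"
  shows "entry X xs \<iota> Y ys \<rho> i j f \<in> carrier (Hom C (P (xs ! j)) (P (ys ! i)))"
  using entry_map[OF assms(1-4)] assms(5) by (auto simp: module_map_def)

text \<open>An arrow is recovered from its entries in two stages: row \<open>i\<close> is the sum
  over \<open>j\<close> of entry \<open>(i, j)\<close> composed with \<open>\<pi> j\<close>, and the
  arrow is the sum of its rows followed by \<open>\<kappa> i\<close>.\<close>

lemma entries_inj:
  assumes d: "decomposition X xs \<iota> \<pi>" and e: "decomposition Y ys \<kappa> \<rho>"
    and f: "f \<in> carrier (Hom C X Y)" and g: "g \<in> carrier (Hom C X Y)"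
    and eq: "\<And>i j. i < length ys \<Longrightarrow> j < length xs \<Longrightarrow> entry X xs \<iota> Y ys \<rho> i j f = entry X xs \<iota> Y ys \<rho> i j g"
  shows "f = g"
proof -
  note [simp] = decompositionD(1-5)[OF d] decompositionD(1-5)[OF e] and Cc = lin_comp[OF C]
  have row: "Comp C X Y (P (ys ! i)) (\<rho> i) f = Comp C X Y (P (ys ! i)) (\<rho> i) g" if i: "i < length ys" for i
  proof -
    interpret H: Module.module R "Hom C X (P (ys ! i))" using lin_module[OF C] i by simp
    have expand: "Comp C X Y (P (ys ! i)) (\<rho> i) h = (\<Oplus>\<^bsub>Hom C X (P (ys ! i))\<^esub> j\<in>{..<length xs}.
      Comp C X (P (xs ! j)) (P (ys ! i)) (entry X xs \<iota> Y ys \<rho> i j h) (\<pi> j))"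
      if h: "h \<in> carrier (Hom C X Y)" for h
    proof -
      \<comment> \<open>The expansion applies to a composite through \<open>X\<close>; an identity
        is put on the right to create one.\<close>
      have "Comp C X Y (P (ys ! i)) (\<rho> i) h = Comp C X X (P (ys ! i)) (Comp C X Y (P (ys ! i)) (\<rho> i) h) (Ident C X)"
        using i h Cc by (simp add: lin_id_right[OF C])
      also have "\<dots> = (\<Oplus>\<^bsub>Hom C X (P (ys ! i))\<^esub> j\<in>{..<length xs}.
        Comp C X (P (xs ! j)) (P (ys ! i)) (Comp C (P (xs ! j)) X (P (ys ! i)) (Comp C X Y (P (ys ! i)) (\<rho> i) h) (\<iota> j))
          (Comp C X X (P (xs ! j)) (\<pi> j) (Ident C X)))"
        using i h Cc lin_ident[OF C] by (intro through[OF d]) auto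
      also have "\<dots> = (\<Oplus>\<^bsub>Hom C X (P (ys ! i))\<^esub> j\<in>{..<length xs}.
        Comp C X (P (xs ! j)) (P (ys ! i)) (entry X xs \<iota> Y ys \<rho> i j h) (\<pi> j))"
        using i h Cc entry_closed[OF d e i]
        by (intro H.M.finsum_cong') (auto simp: lin_id_right[OF C] lin_assoc[OF C])
      finally show ?thesis .
    qed
    show ?thesis unfolding expand[OF f] expand[OF g]
      using i f g eq entry_closed[OF d e i] Cc by (intro H.M.finsum_cong') auto
  qed
  interpret H: Module.module R "Hom C X Y" using lin_module[OF C] by simp
  have expand: "h = (\<Oplus>\<^bsub>Hom C X Y\<^esub> i\<in>{..<length ys}. Comp C X (P (ys ! i)) Y (\<kappa> i) (Comp C X Y (P (ys ! i)) (\<rho> i) h))"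
    if h: "h \<in> carrier (Hom C X Y)" for h
  proof -
    have "h = Comp C X Y Y (Ident C Y) h" using h by (simp add: lin_id_left[OF C])
    also have "\<dots> = (\<Oplus>\<^bsub>Hom C X Y\<^esub> i\<in>{..<length ys}.
      Comp C X (P (ys ! i)) Y (Comp C (P (ys ! i)) Y Y (Ident C Y) (\<kappa> i)) (Comp C X Y (P (ys ! i)) (\<rho> i) h))"
      using h lin_ident[OF C] by (intro through[OF e]) auto
    also have "\<dots> = (\<Oplus>\<^bsub>Hom C X Y\<^esub> i\<in>{..<length ys}. Comp C X (P (ys ! i)) Y (\<kappa> i) (Comp C X Y (P (ys ! i)) (\<rho> i) h))"
      using h Cc by (intro H.M.finsum_cong') (auto simp: lin_id_left[OF C])
    finally show ?thesis .
  qed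
  show ?thesis
    apply (subst expand[OF f], subst expand[OF g])
    using row f g Cc by (intro H.M.finsum_cong') auto
qed

text \<open>The required arrow is the double sum of
  \<open>\<kappa> i \<circ> N i j \<circ> \<pi> j\<close>, assembled by rows. When an entry is
  taken, the orthogonality relations leave a single term of each sum.\<close>

lemma entries_surj:
  assumes d: "decomposition X xs \<iota> \<pi>" and e: "decomposition Y ys \<kappa> \<rho>"
    and N: "\<And>i j. i < length ys \<Longrightarrow> j < length xs \<Longrightarrow> N i j \<in> carrier (Hom C (P (xs ! j)) (P (ys ! i)))"
  shows "\<exists>f \<in> carrier (Hom C X Y). \<forall>i<length ys. \<forall>j<length xs. entry X xs \<iota> Y ys \<rho> i j f = N i j"
proof -
  note [simp] = decompositionD(1-5)[OF d] decompositionD(1-5)[OF e] and Cc = lin_comp[OF C]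
  define row where "row i = (\<Oplus>\<^bsub>Hom C X (P (ys ! i))\<^esub> j\<in>{..<length xs}. Comp C X (P (xs ! j)) (P (ys ! i)) (N i j) (\<pi> j))" for i
  have row: "row i \<in> carrier (Hom C X (P (ys ! i)))" if i: "i < length ys" for i
  proof -
    interpret H: Module.module R "Hom C X (P (ys ! i))" using lin_module[OF C] i by simp
    show ?thesis unfolding row_def using N i Cc by (intro H.M.finsum_closed) auto
  qed
  have row_entry: "Comp C (P (xs ! l)) X (P (ys ! i)) (row i) (\<iota> l) = N i l" if i: "i < length ys" and l: "l < length xs" for i l
  proof -
    interpret H: Module.module R "Hom C (P (xs ! l)) (P (ys ! i))" using lin_module[OF C] i l by simp
    have "Comp C (P (xs ! l)) X (P (ys ! i)) (row i) (\<iota> l) = (\<Oplus>\<^bsub>Hom C (P (xs ! l)) (P (ys ! i))\<^esub> j\<in>{..<length xs}.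
      Comp C (P (xs ! l)) X (P (ys ! i)) (Comp C X (P (xs ! j)) (P (ys ! i)) (N i j) (\<pi> j)) (\<iota> l))"
      unfolding row_def
      by (rule module_map_finsum[where f = "\<lambda>g. Comp C (P (xs ! l)) X (P (ys ! i)) g (\<iota> l)",
            OF lin_module[OF C] lin_module[OF C] lin_pre[OF C]]) (use N i l Cc in auto)
    also have "\<dots> = (\<Oplus>\<^bsub>Hom C (P (xs ! l)) (P (ys ! i))\<^esub> j\<in>{..<length xs}.
      Comp C (P (xs ! l)) (P (xs ! j)) (P (ys ! i)) (N i j) (Comp C (P (xs ! l)) X (P (xs ! j)) (\<pi> j) (\<iota> l)))"
      using N i l Cc by (intro H.M.finsum_cong') (auto simp: lin_assoc[OF C])
    also have "\<dots> = Comp C (P (xs ! l)) (P (xs ! l)) (P (ys ! i)) (N i l) (Comp C (P (xs ! l)) X (P (xs ! l)) (\<pi> l) (\<iota> l))"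
    proof (rule H.M.finsum_delta)
      fix j assume j: "j \<in> {..<length xs}" "j \<noteq> l"
      show "Comp C (P (xs ! l)) (P (xs ! j)) (P (ys ! i)) (N i j) (Comp C (P (xs ! l)) X (P (xs ! j)) (\<pi> j) (\<iota> l)) =
        \<zero>\<^bsub>Hom C (P (xs ! l)) (P (ys ! i))\<^esub>"
        using j decompositionD(7)[OF d, of j l] N[of i j] i l
        by (simp add: comp_zero[OF C])
    qed (use N i l Cc in auto)
    also have "\<dots> = N i l" using decompositionD(6)[OF d] N i l by (simp add: lin_id_right[OF C])
    finally show ?thesis .
  qed
  define f where "f = (\<Oplus>\<^bsub>Hom C X Y\<^esub> i\<in>{..<length ys}. Comp C X (P (ys ! i)) Y (\<kappa> i) (row i))"
  interpret H: Module.module R "Hom C X Y" using lin_module[OF C] by simp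
  have f: "f \<in> carrier (Hom C X Y)" unfolding f_def using row Cc by (intro H.M.finsum_closed) auto
  have f_row: "Comp C X Y (P (ys ! k)) (\<rho> k) f = row k" if k: "k < length ys" for k
  proof -
    interpret H: Module.module R "Hom C X (P (ys ! k))" using lin_module[OF C] k by simp
    have "Comp C X Y (P (ys ! k)) (\<rho> k) f = (\<Oplus>\<^bsub>Hom C X (P (ys ! k))\<^esub> i\<in>{..<length ys}.
      Comp C X Y (P (ys ! k)) (\<rho> k) (Comp C X (P (ys ! i)) Y (\<kappa> i) (row i)))"
      unfolding f_def
      by (rule module_map_finsum[OF lin_module[OF C] lin_module[OF C] lin_post[OF C]]) (use row k Cc in auto)
    also have "\<dots> = (\<Oplus>\<^bsub>Hom C X (P (ys ! k))\<^esub> i\<in>{..<length ys}.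
      Comp C X (P (ys ! i)) (P (ys ! k)) (Comp C (P (ys ! i)) Y (P (ys ! k)) (\<rho> k) (\<kappa> i)) (row i))"
      using row k Cc by (intro H.M.finsum_cong') (auto simp: lin_assoc[OF C])
    also have "\<dots> = Comp C X (P (ys ! k)) (P (ys ! k)) (Comp C (P (ys ! k)) Y (P (ys ! k)) (\<rho> k) (\<kappa> k)) (row k)"
    proof (rule H.M.finsum_delta)
      fix i assume i: "i \<in> {..<length ys}" "i \<noteq> k"
      show "Comp C X (P (ys ! i)) (P (ys ! k)) (Comp C (P (ys ! i)) Y (P (ys ! k)) (\<rho> k) (\<kappa> i)) (row i) =
        \<zero>\<^bsub>Hom C X (P (ys ! k))\<^esub>"
        using i decompositionD(7)[OF e, of k i] row[of i] k
        by (simp add: zero_comp[OF C])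
    qed (use row k Cc in auto)
    also have "\<dots> = row k" using decompositionD(6)[OF e] row k by (simp add: lin_id_left[OF C])
    finally show ?thesis .
  qed
  have "entry X xs \<iota> Y ys \<rho> i j f = N i j" if "i < length ys" "j < length xs" for i j
    using that f row_entry[OF that] f_row by (simp add: lin_assoc[OF C])
  then show ?thesis using f by blast
qed

lemma coord_closed:
  assumes d: "decomposition X xs \<iota> \<pi>" and e: "decomposition Y ys \<kappa> \<rho>" and f: "f \<in> carrier (Hom C X Y)"
  shows "coord X xs \<iota> Y ys \<rho> f \<in> carrier (mat_hom D xs ys)"
  using \<Psi>_closed decompositionD(2)[OF d] decompositionD(2)[OF e] entry_closed[OF d e _ _ f]
  by (auto simp: mat_hom_def coord_def mat_index_def)

lemma coord_bij:
  assumes d: "decomposition X xs \<iota> \<pi>" and e: "decomposition Y ys \<kappa> \<rho>"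
  shows "bij_betw (coord X xs \<iota> Y ys \<rho>) (carrier (Hom C X Y)) (carrier (mat_hom D xs ys))"
proof (intro bij_betw_imageI inj_onI equalityI subsetI)
  note Dobj = decompositionD(2)[OF d] decompositionD(2)[OF e]
  fix f g assume f: "f \<in> carrier (Hom C X Y)" and g: "g \<in> carrier (Hom C X Y)"
    and eq: "coord X xs \<iota> Y ys \<rho> f = coord X xs \<iota> Y ys \<rho> g"
  show "f = g"
  proof (rule entries_inj[OF d e f g])
    fix i j assume ij: "i < length ys" "j < length xs"
    have "\<Psi> (xs ! j) (ys ! i) (entry X xs \<iota> Y ys \<rho> i j f) = \<Psi> (xs ! j) (ys ! i) (entry X xs \<iota> Y ys \<rho> i j g)"
      using coord_apply[OF ij, of X \<iota> Y \<rho>] eq by metis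
    then show "entry X xs \<iota> Y ys \<rho> i j f = entry X xs \<iota> Y ys \<rho> i j g"
      using \<Psi>_bij[of "xs ! j" "ys ! i"] entry_closed[OF d e ij] f g Dobj ij
      by (meson bij_betw_imp_inj_on inj_on_eq_iff)
  qed
next
  fix M assume "M \<in> coord X xs \<iota> Y ys \<rho> ` carrier (Hom C X Y)"
  then show "M \<in> carrier (mat_hom D xs ys)" using coord_closed[OF d e] by auto
next
  note Dobj = decompositionD(2)[OF d] decompositionD(2)[OF e]
  fix M assume "M \<in> carrier (mat_hom D xs ys)"
  then have M: "M (i, j) \<in> carrier (Hom D (xs ! j) (ys ! i))" if "i < length ys" "j < length xs" for i j
    using that by (force simp: mat_hom_def mat_index_def PiE_iff)
  have ext: "M \<in> extensional (mat_index xs ys)"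
    using \<open>M \<in> carrier (mat_hom D xs ys)\<close> by (auto simp: mat_hom_def PiE_iff)
  define N where "N i j = inv_into (carrier (Hom C (P (xs ! j)) (P (ys ! i)))) (\<Psi> (xs ! j) (ys ! i)) (M (i, j))" for i j
  have N: "N i j \<in> carrier (Hom C (P (xs ! j)) (P (ys ! i)))" "\<Psi> (xs ! j) (ys ! i) (N i j) = M (i, j)"
    if "i < length ys" "j < length xs" for i j
    using M[OF that] \<Psi>_bij[OF Dobj(1) Dobj(2), OF that(2,1)] unfolding N_def
    by (auto simp: bij_betw_def inv_into_into f_inv_into_f)
  obtain f where f: "f \<in> carrier (Hom C X Y)"
    "\<And>i j. i < length ys \<Longrightarrow> j < length xs \<Longrightarrow> entry X xs \<iota> Y ys \<rho> i j f = N i j"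
    using entries_surj[OF d e, of N] N(1) by blast
  have "M = coord X xs \<iota> Y ys \<rho> f"
  proof (rule extensionalityI[OF ext])
    show "coord X xs \<iota> Y ys \<rho> f \<in> extensional (mat_index xs ys)" by (simp add: coord_def)
  qed (auto simp: mat_index_def coord_apply f N)
  then show "M \<in> coord X xs \<iota> Y ys \<rho> ` carrier (Hom C X Y)" using f by blast
qed

lemma coord_map:
  assumes d: "decomposition X xs \<iota> \<pi>" and e: "decomposition Y ys \<kappa> \<rho>"
  shows "module_map R (Hom C X Y) (mat_hom D xs ys) (coord X xs \<iota> Y ys \<rho>)"
proof -
  note Dobj = decompositionD(2)[OF d] decompositionD(2)[OF e]
  note cl = entry_closed[OF d e]
  interpret H: Module.module R "Hom C X Y"
    using lin_module[OF C] decompositionD(1)[OF d] decompositionD(1)[OF e] by simp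
  have entry_add: "entry X xs \<iota> Y ys \<rho> i j (f \<oplus>\<^bsub>Hom C X Y\<^esub> g) =
      entry X xs \<iota> Y ys \<rho> i j f \<oplus>\<^bsub>Hom C (P (xs ! j)) (P (ys ! i))\<^esub> entry X xs \<iota> Y ys \<rho> i j g"
    if "i < length ys" "j < length xs" "f \<in> carrier (Hom C X Y)" "g \<in> carrier (Hom C X Y)" for i j f g
    using entry_map[OF d e that(1,2)] that(3,4) by (simp add: module_map_def)
  have entry_smult: "entry X xs \<iota> Y ys \<rho> i j (r \<odot>\<^bsub>Hom C X Y\<^esub> g) =
      r \<odot>\<^bsub>Hom C (P (xs ! j)) (P (ys ! i))\<^esub> entry X xs \<iota> Y ys \<rho> i j g"
    if "i < length ys" "j < length xs" "r \<in> carrier R" "g \<in> carrier (Hom C X Y)" for i j r g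
    using entry_map[OF d e that(1,2)] that(3,4) by (simp add: module_map_def)
  have \<Psi>_add: "\<Psi> x y (f \<oplus>\<^bsub>Hom C (P x) (P y)\<^esub> g) = \<Psi> x y f \<oplus>\<^bsub>Hom D x y\<^esub> \<Psi> x y g"
    if "x \<in> Obj D" "y \<in> Obj D" "f \<in> carrier (Hom C (P x) (P y))" "g \<in> carrier (Hom C (P x) (P y))" for x y f g
    using \<Psi>_map[OF that(1,2)] that by (simp add: module_map_def)
  have \<Psi>_smult: "\<Psi> x y (r \<odot>\<^bsub>Hom C (P x) (P y)\<^esub> g) = r \<odot>\<^bsub>Hom D x y\<^esub> \<Psi> x y g"
    if "x \<in> Obj D" "y \<in> Obj D" "r \<in> carrier R" "g \<in> carrier (Hom C (P x) (P y))" for x y r g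
    using \<Psi>_map[OF that(1,2)] that by (simp add: module_map_def)
  show ?thesis
    unfolding module_map_def
  proof (intro conjI ballI funcsetI)
    fix f assume "f \<in> carrier (Hom C X Y)"
    then show "coord X xs \<iota> Y ys \<rho> f \<in> carrier (mat_hom D xs ys)" by (rule coord_closed[OF d e])
  next
    fix f g assume "f \<in> carrier (Hom C X Y)" "g \<in> carrier (Hom C X Y)"
    then show "coord X xs \<iota> Y ys \<rho> (f \<oplus>\<^bsub>Hom C X Y\<^esub> g) =
      coord X xs \<iota> Y ys \<rho> f \<oplus>\<^bsub>mat_hom D xs ys\<^esub> coord X xs \<iota> Y ys \<rho> g"
      using Dobj cl by (auto simp: mat_hom_def coord_def mat_index_def entry_add \<Psi>_add intro!: restrict_ext)
  next
    fix r f assume "r \<in> carrier R" "f \<in> carrier (Hom C X Y)"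
    then show "coord X xs \<iota> Y ys \<rho> (r \<odot>\<^bsub>Hom C X Y\<^esub> f) = r \<odot>\<^bsub>mat_hom D xs ys\<^esub> coord X xs \<iota> Y ys \<rho> f"
      using Dobj cl by (auto simp: mat_hom_def coord_def mat_index_def entry_smult \<Psi>_smult intro!: restrict_ext)
  qed
qed

lemma coord_zero:
  assumes d: "decomposition X xs \<iota> \<pi>" and e: "decomposition Y ys \<kappa> \<rho>"
  shows "coord X xs \<iota> Y ys \<rho> \<zero>\<^bsub>Hom C X Y\<^esub> = \<zero>\<^bsub>mat_hom D xs ys\<^esub>"
proof -
  have "entry X xs \<iota> Y ys \<rho> i j \<zero>\<^bsub>Hom C X Y\<^esub> = \<zero>\<^bsub>Hom C (P (xs ! j)) (P (ys ! i))\<^esub>"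
    if "i < length ys" "j < length xs" for i j
    by (rule module_map_zero[OF lin_module[OF C] lin_module[OF C] entry_map[OF d e that]])
      (use decompositionD(1,3)[OF d] decompositionD(1,3)[OF e] that in auto)
  then show ?thesis
    using decompositionD(2)[OF d] decompositionD(2)[OF e]
    by (auto simp: mat_hom_def coord_def mat_index_def \<Psi>_zero intro!: restrict_ext)
qed

lemma coord_ident:
  assumes d: "decomposition X xs \<iota> \<pi>"
  shows "coord X xs \<iota> X xs \<pi> (Ident C X) = Ident (additive_completion D) xs"
proof -
  have "entry X xs \<iota> X xs \<pi> i j (Ident C X) =
    (if i = j then Ident C (P (xs ! i)) else \<zero>\<^bsub>Hom C (P (xs ! j)) (P (xs ! i))\<^esub>)"
    if "i < length xs" "j < length xs" for i j
    using decompositionD[OF d] that by (auto simp: lin_id_left[OF C])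
  then show ?thesis
    using decompositionD(2)[OF d]
    by (auto simp: additive_completion_def coord_def mat_index_def \<Psi>_zero \<Psi>_ident intro!: restrict_ext)
qed

text \<open>Expanding at the middle object \<open>Y\<close> gives the product rule:
  \<open>\<nu> i \<circ> g \<circ> f \<circ> \<iota> l\<close> is the sum over \<open>j\<close> of
  \<open>(\<nu> i \<circ> g \<circ> \<kappa> j) \<circ> (\<rho> j \<circ> f \<circ> \<iota>
  l)\<close>, and \<open>\<Psi>\<close> carries each factor into \<open>D\<close>.\<close>

lemma coord_comp:
  assumes d: "decomposition X xs \<iota> \<pi>" and e: "decomposition Y ys \<kappa> \<rho>" and k: "decomposition Z zs \<mu> \<nu>"
    and f: "f \<in> carrier (Hom C X Y)" and g: "g \<in> carrier (Hom C Y Z)"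
  shows "coord X xs \<iota> Z zs \<nu> (Comp C X Y Z g f) =
    Comp (additive_completion D) xs ys zs (coord Y ys \<kappa> Z zs \<nu> g) (coord X xs \<iota> Y ys \<rho> f)"
proof -
  note [simp] = decompositionD(1-5)[OF d] decompositionD(1-5)[OF e] decompositionD(1-5)[OF k]
  note Cc = lin_comp[OF C]
  have "\<Psi> (xs ! l) (zs ! i) (entry X xs \<iota> Z zs \<nu> i l (Comp C X Y Z g f)) =
    (\<Oplus>\<^bsub>Hom D (xs ! l) (zs ! i)\<^esub> j\<in>{..<length ys}. Comp D (xs ! l) (ys ! j) (zs ! i)
      (coord Y ys \<kappa> Z zs \<nu> g (i, j)) (coord X xs \<iota> Y ys \<rho> f (j, l)))"
    if i: "i < length zs" and l: "l < length xs" for i l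
  proof -
    interpret H: Module.module R "Hom C (P (xs ! l)) (P (zs ! i))" using lin_module[OF C] i l by simp
    interpret K: Module.module R "Hom D (xs ! l) (zs ! i)" using D_module i l by simp
    have *: "entry X xs \<iota> Z zs \<nu> i l (Comp C X Y Z g f) =
      Comp C (P (xs ! l)) Y (P (zs ! i)) (Comp C Y Z (P (zs ! i)) (\<nu> i) g) (Comp C (P (xs ! l)) X Y f (\<iota> l))"
      using i l f g by (simp add: lin_assoc[OF C] Cc)
    also have "\<dots> = (\<Oplus>\<^bsub>Hom C (P (xs ! l)) (P (zs ! i))\<^esub> j\<in>{..<length ys}.
      Comp C (P (xs ! l)) (P (ys ! j)) (P (zs ! i))
        (Comp C (P (ys ! j)) Y (P (zs ! i)) (Comp C Y Z (P (zs ! i)) (\<nu> i) g) (\<kappa> j)) (entry X xs \<iota> Y ys \<rho> j l f))"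
      using i l f g Cc by (intro through[OF e]) auto
    also have "\<dots> = (\<Oplus>\<^bsub>Hom C (P (xs ! l)) (P (zs ! i))\<^esub> j\<in>{..<length ys}.
      Comp C (P (xs ! l)) (P (ys ! j)) (P (zs ! i)) (entry Y ys \<kappa> Z zs \<nu> i j g) (entry X xs \<iota> Y ys \<rho> j l f))"
      using i l f g entry_closed[OF d e _ l f] entry_closed[OF e k i _ g] Cc
      by (intro H.M.finsum_cong') (auto simp: lin_assoc[OF C])
    finally have "\<Psi> (xs ! l) (zs ! i) (entry X xs \<iota> Z zs \<nu> i l (Comp C X Y Z g f)) = (\<Oplus>\<^bsub>Hom D (xs ! l) (zs ! i)\<^esub> j\<in>{..<length ys}.
      \<Psi> (xs ! l) (zs ! i) (Comp C (P (xs ! l)) (P (ys ! j)) (P (zs ! i)) (entry Y ys \<kappa> Z zs \<nu> i j g) (entry X xs \<iota> Y ys \<rho> j l f)))"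
      using i l f g entry_closed[OF d e _ l f] entry_closed[OF e k i _ g] Cc
      by (simp add: module_map_finsum[OF H.module_axioms K.module_axioms \<Psi>_map])
    also have "\<dots> = (\<Oplus>\<^bsub>Hom D (xs ! l) (zs ! i)\<^esub> j\<in>{..<length ys}. Comp D (xs ! l) (ys ! j) (zs ! i)
      (coord Y ys \<kappa> Z zs \<nu> g (i, j)) (coord X xs \<iota> Y ys \<rho> f (j, l)))"
      using i l f g entry_closed[OF d e _ l f] entry_closed[OF e k i _ g]  Cc
      by (intro K.M.finsum_cong') (auto simp: coord_apply \<Psi>_comp intro!: \<Psi>_closed simp flip: \<Psi>_comp)
    finally show ?thesis .
  qed
  then show ?thesis
    by (auto simp: additive_completion_def coord_def[of X xs \<iota> Z] mat_index_def intro!: restrict_ext)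
qed

text \<open>Presentations are taken to be all decompositions. The two assumptions are exactly what
  makes every object of \<open>C\<close>, and every list of objects of \<open>D\<close>, occur in
  one of them.\<close>

theorem additive_completion_equivalence:
  assumes "\<And>X. X \<in> Obj C \<Longrightarrow> \<exists>xs \<iota> \<pi>. decomposition X xs \<iota> \<pi>"
    and "\<And>xs. xs \<in> lists (Obj D) \<Longrightarrow> \<exists>X \<iota> \<pi>. decomposition X xs \<iota> \<pi>"
  shows "linear_equivalent R C (additive_completion D)"
proof -
  let ?A = "additive_completion D"
  interpret coordinates R C ?A "{(X, xs, \<iota>, \<pi>). decomposition X xs \<iota> \<pi>}" fst "\<lambda>(X, xs, \<iota>, \<pi>). xs"
    "\<lambda>(X, xs, \<iota>, \<pi>) (Y, ys, \<kappa>, \<rho>). coord X xs \<iota> Y ys \<rho>"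
  proof (unfold_locales, goal_cases)
    case (4 X)
    then show ?case using assms(1)[OF 4] by force
  next
    case (5 xs)
    then show ?case using assms(2)[of xs] by (force simp: additive_completion_def)
  next
    case (6 d e)
    then show ?case using coord_bij by (auto simp: additive_completion_def)
  next
    case (7 d e)
    then show ?case using coord_map by (auto simp: additive_completion_def)
  next
    case (8 d e)
    then show ?case using coord_zero by (auto simp: additive_completion_def)
  next
    case (9 d)
    then show ?case using coord_ident by auto
  next
    case (10 d e k f g)
    then show ?case using coord_comp by auto
  qed (auto simp: C decomposition_def additive_completion_def)
  show ?thesis by (rule equivalence)
qed

end


section \<open>Finite sets with a group action\<close>

text \<open>The library's notion is a homomorphism into the group of extensional bijections;
  bijectivity comes from the action of the inverse element.\<close>

lemma group_actionI:
  assumes "group \<Gamma>"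
    and closed: "\<And>g s. g \<in> carrier \<Gamma> \<Longrightarrow> s \<in> E \<Longrightarrow> \<phi> g s \<in> E"
    and one: "\<And>s. s \<in> E \<Longrightarrow> \<phi> \<one>\<^bsub>\<Gamma>\<^esub> s = s"
    and mult: "\<And>g h s. g \<in> carrier \<Gamma> \<Longrightarrow> h \<in> carrier \<Gamma> \<Longrightarrow> s \<in> E \<Longrightarrow> \<phi> (g \<otimes>\<^bsub>\<Gamma>\<^esub> h) s = \<phi> g (\<phi> h s)"
    and ext: "\<And>g. g \<in> carrier \<Gamma> \<Longrightarrow> \<phi> g \<in> extensional E"
  shows "group_action \<Gamma> E \<phi>"
proof -
  interpret group \<Gamma> by fact
  have "\<phi> (inv\<^bsub>\<Gamma>\<^esub> g) (\<phi> g s) = s" "\<phi> g (\<phi> (inv\<^bsub>\<Gamma>\<^esub> g) s) = s" if "g \<in> carrier \<Gamma>" "s \<in> E" for g s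
    using that mult[of "inv\<^bsub>\<Gamma>\<^esub> g" g s] mult[of g "inv\<^bsub>\<Gamma>\<^esub> g" s] one by auto
  then have "bij_betw (\<phi> g) E E" if "g \<in> carrier \<Gamma>" for g
    using that closed by (intro bij_betw_byWitness[where f' = "\<phi> (inv\<^bsub>\<Gamma>\<^esub> g)"]) auto
  then have Bij: "\<phi> g \<in> Bij E" if "g \<in> carrier \<Gamma>" for g
    using that ext by (auto simp: Bij_def)
  have "\<phi> (g \<otimes>\<^bsub>\<Gamma>\<^esub> h) = compose E (\<phi> g) (\<phi> h)" if "g \<in> carrier \<Gamma>" "h \<in> carrier \<Gamma>" for g h
    by (rule extensionalityI[of _ E]) (use that ext mult in \<open>auto simp: compose_eq\<close>)
  then have "\<phi> \<in> hom \<Gamma> (BijGroup E)"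
    using Bij by (auto simp: hom_def BijGroup_def)
  then show ?thesis
    by (simp add: group_action_def group_hom_def group_hom_axioms_def group_BijGroup \<open>group \<Gamma>\<close>)
qed

lemma finite_gsetI:
  assumes "group \<Gamma>" "finite (pts S)"
    and "\<And>g s. g \<in> carrier \<Gamma> \<Longrightarrow> s \<in> pts S \<Longrightarrow> act S g s \<in> pts S"
    and "\<And>s. s \<in> pts S \<Longrightarrow> act S \<one>\<^bsub>\<Gamma>\<^esub> s = s"
    and "\<And>g h s. g \<in> carrier \<Gamma> \<Longrightarrow> h \<in> carrier \<Gamma> \<Longrightarrow> s \<in> pts S \<Longrightarrow>
      act S (g \<otimes>\<^bsub>\<Gamma>\<^esub> h) s = act S g (act S h s)"
    and "\<And>g. g \<in> carrier \<Gamma> \<Longrightarrow> act S g \<in> extensional (pts S)"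
  shows "finite_gset \<Gamma> S"
  unfolding finite_gset_def using assms group_actionI[of \<Gamma> "pts S" "act S"] by blast

lemma finite_gsetD:
  assumes "finite_gset \<Gamma> S"
  shows "group \<Gamma>" "finite (pts S)"
    "g \<in> carrier \<Gamma> \<Longrightarrow> s \<in> pts S \<Longrightarrow> act S g s \<in> pts S"
    "s \<in> pts S \<Longrightarrow> act S \<one>\<^bsub>\<Gamma>\<^esub> s = s"
    "g \<in> carrier \<Gamma> \<Longrightarrow> h \<in> carrier \<Gamma> \<Longrightarrow> s \<in> pts S \<Longrightarrow>
      act S g (act S h s) = act S (g \<otimes>\<^bsub>\<Gamma>\<^esub> h) s"
proof -
  interpret group_action \<Gamma> "pts S" "act S" using assms by (simp add: finite_gset_def)
  show "group \<Gamma>" using group_hom by (simp add: group_hom_def)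
  show "finite (pts S)" using assms by (simp add: finite_gset_def)
  show "g \<in> carrier \<Gamma> \<Longrightarrow> s \<in> pts S \<Longrightarrow> act S g s \<in> pts S" using element_image by blast
  show "s \<in> pts S \<Longrightarrow> act S \<one>\<^bsub>\<Gamma>\<^esub> s = s" using id_eq_one by (metis restrict_apply')
  show "g \<in> carrier \<Gamma> \<Longrightarrow> h \<in> carrier \<Gamma> \<Longrightarrow> s \<in> pts S \<Longrightarrow>
      act S g (act S h s) = act S (g \<otimes>\<^bsub>\<Gamma>\<^esub> h) s" using composition_rule by simp
qed

lemma act_inv_eq_iff:
  assumes S: "finite_gset \<Gamma> S" and mem: "g \<in> carrier \<Gamma>" "s \<in> pts S" "t \<in> pts S"
  shows "act S (inv\<^bsub>\<Gamma>\<^esub> g) s = t \<longleftrightarrow> s = act S g t"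
proof -
  interpret group \<Gamma> using finite_gsetD(1)[OF S] .
  show ?thesis using mem finite_gsetD(4,5)[OF S] by auto
qed

lemma finite_gset_cong:
  "pts S = pts T \<Longrightarrow> act S = act T \<Longrightarrow> finite_gset \<Gamma> S \<longleftrightarrow> finite_gset \<Gamma> T"
  by (simp add: finite_gset_def)

text \<open>The general way to change the type of points, along an injection \<open>e\<close>: it
  moves sets into the natural numbers and, for the realization of lists of groups, a set of cosets
  into the given universe.\<close>

lemma finite_gset_transport:
  assumes S: "finite_gset \<Gamma> S" and e: "inj_on e (pts S)"
    and pts: "pts T = e ` pts S"
    and act: "\<And>g. act T g = restrict (\<lambda>t. e (act S g (inv_into (pts S) e t))) (e ` pts S)"
  shows "finite_gset \<Gamma> T" "s \<in> pts S \<Longrightarrow> act T g (e s) = e (act S g s)"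
proof -
  note [simp] = finite_gsetD[OF S]
  show act': "act T g (e s) = e (act S g s)" if "s \<in> pts S" for g s
    using that e by (simp add: act)
  show "finite_gset \<Gamma> T"
    by (rule finite_gsetI) (auto simp: pts act', auto simp: act)
qed

lemma over_iso_refl: "over_iso \<Gamma> S S"
  unfolding over_iso_def by (rule exI[of _ id]) (simp add: gset_map_def)

lemma over_iso_sym:
  assumes S: "finite_gset \<Gamma> S" and "over_iso \<Gamma> S T"
  shows "over_iso \<Gamma> T S"
proof -
  obtain f where f: "gset_map \<Gamma> S T f" "bij_betw f (pts S) (pts T)"
    "\<forall>s \<in> pts S. anchor T (f s) = anchor S s"
    using assms(2) by (auto simp: over_iso_def)
  define g where "g = inv_into (pts S) f"
  have g: "g t \<in> pts S" "f (g t) = t" if "t \<in> pts T" for t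
    using f(2) that unfolding g_def by (auto simp: bij_betw_def inv_into_into f_inv_into_f)
  have gf: "g (f s) = s" if "s \<in> pts S" for s
    using f(2) that unfolding g_def by (simp add: bij_betw_def)
  have "g (act T a t) = act S a (g t)" if "a \<in> carrier \<Gamma>" "t \<in> pts T" for a t
    using f(1) g[OF that(2)] that gf[of "act S a (g t)"] finite_gsetD(3)[OF S, of a "g t"]
    by (auto simp: gset_map_def)
  moreover have "bij_betw g (pts T) (pts S)" unfolding g_def by (rule bij_betw_inv_into[OF f(2)])
  ultimately show ?thesis
    unfolding over_iso_def using f(3) g by (intro exI[of _ g]) (auto simp: gset_map_def, metis)
qed

lemma over_iso_trans:
  assumes "over_iso \<Gamma> S T" "over_iso \<Gamma> T U"
  shows "over_iso \<Gamma> S U"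
proof -
  obtain f g where f: "gset_map \<Gamma> S T f" "bij_betw f (pts S) (pts T)" "\<forall>s \<in> pts S. anchor T (f s) = anchor S s"
    and g: "gset_map \<Gamma> T U g" "bij_betw g (pts T) (pts U)" "\<forall>s \<in> pts T. anchor U (g s) = anchor T s"
    using assms by (auto simp: over_iso_def)
  have "bij_betw (g \<circ> f) (pts S) (pts U)" using f(2) g(2) by (rule bij_betw_trans)
  moreover have "gset_map \<Gamma> S U (g \<circ> f)"
    using f(1) g(1) by (auto simp: gset_map_def Pi_iff)
  ultimately show ?thesis
    unfolding over_iso_def using f g by (intro exI[of _ "g \<circ> f"]) (auto simp: gset_map_def Pi_iff)
qed

lemma gset_overD:
  assumes "gset_over \<Gamma> Z S"
  shows "finite_gset \<Gamma> S" "s \<in> pts S \<Longrightarrow> anchor S s \<in> pts Z"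
    "g \<in> carrier \<Gamma> \<Longrightarrow> s \<in> pts S \<Longrightarrow> anchor S (act S g s) = act Z g (anchor S s)"
  using assms by (auto simp: gset_over_def gset_map_def)

text \<open>A finite set injects into the natural numbers, and action and anchor are carried along.
  This is the existence on which the Hilbert choice in \<open>over_copy\<close> rests.\<close>

lemma over_copy:
  assumes S: "gset_over \<Gamma> Z S"
  shows "over_copy \<Gamma> Z S \<in> gsets_over \<Gamma> Z" "over_iso \<Gamma> S (over_copy \<Gamma> Z S)"
proof -
  note S' = gset_overD[OF S]
  obtain e :: "_ \<Rightarrow> nat" where e: "inj_on e (pts S)"
    using finite_imp_inj_to_nat_seg[OF finite_gsetD(2)[OF S'(1)]] by auto
  define T :: "('a, nat, 'b) over_gset" where "T = \<lparr>pts = e ` pts S,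
    act = (\<lambda>g. restrict (\<lambda>t. e (act S g (inv_into (pts S) e t))) (e ` pts S)),
    anchor = (\<lambda>t. anchor S (inv_into (pts S) e t))\<rparr>"
  have pts: "pts T = e ` pts S" by (simp add: T_def)
  have anchor: "anchor T (e s) = anchor S s" if "s \<in> pts S" for s
    using e that by (simp add: T_def)
  note T = finite_gset_transport[OF S'(1) e, of T]
  have T1: "finite_gset \<Gamma> T" using T by (simp add: T_def)
  have T2: "act T g (e s) = e (act S g s)" if "s \<in> pts S" for g s
    using T that by (simp add: T_def)
  have "gset_over \<Gamma> Z T"
    unfolding gset_over_def gset_map_def
    using T1 T2 S' finite_gsetD(3)[OF S'(1)] by (auto simp: pts anchor)
  moreover have "over_iso \<Gamma> S T"
    unfolding over_iso_def gset_map_def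
    using e T2 by (intro exI[of _ e]) (auto simp: pts anchor bij_betw_def)
  ultimately have "T \<in> gsets_over \<Gamma> Z \<and> over_iso \<Gamma> S T" by (simp add: gsets_over_def)
  from someI[of "\<lambda>T. T \<in> gsets_over \<Gamma> Z \<and> over_iso \<Gamma> S T", OF this]
  show "over_copy \<Gamma> Z S \<in> gsets_over \<Gamma> Z" "over_iso \<Gamma> S (over_copy \<Gamma> Z S)"
    by (simp_all add: over_copy_def)
qed

lemma over_sum_simps:
  "pts (over_sum S T) = pts S <+> pts T"
  "s \<in> pts S \<Longrightarrow> act (over_sum S T) g (Inl s) = Inl (act S g s)"
  "t \<in> pts T \<Longrightarrow> act (over_sum S T) g (Inr t) = Inr (act T g t)"
  "anchor (over_sum S T) (Inl s) = anchor S s"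
  "anchor (over_sum S T) (Inr t) = anchor T t"
  by (auto simp: over_sum_def)

lemma gset_over_sum:
  assumes "gset_over \<Gamma> Z S" "gset_over \<Gamma> Z T"
  shows "gset_over \<Gamma> Z (over_sum S T)"
proof -
  note S = gset_overD[OF assms(1)] and T = gset_overD[OF assms(2)]
  note [simp] = over_sum_simps finite_gsetD[OF S(1)] finite_gsetD[OF T(1)] S(2,3) T(2,3)
  have "finite_gset \<Gamma> (over_sum S T)"
  proof (rule finite_gsetI)
    fix g assume "g \<in> carrier \<Gamma>"
    show "act (over_sum S T) g \<in> extensional (pts (over_sum S T))" by (simp add: over_sum_def)
  qed auto
  then show ?thesis by (auto simp: gset_over_def gset_map_def)
qed

lemma over_iso_sum:
  assumes "over_iso \<Gamma> S S'" "over_iso \<Gamma> T T'"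
  shows "over_iso \<Gamma> (over_sum S T) (over_sum S' T')"
proof -
  obtain f g where f: "gset_map \<Gamma> S S' f" "bij_betw f (pts S) (pts S')" "\<forall>s \<in> pts S. anchor S' (f s) = anchor S s"
    and g: "gset_map \<Gamma> T T' g" "bij_betw g (pts T) (pts T')" "\<forall>s \<in> pts T. anchor T' (g s) = anchor T s"
    using assms by (auto simp: over_iso_def)
  have "inj_on (map_sum f g) (pts S <+> pts T)"
    using bij_betw_imp_inj_on[OF f(2)] bij_betw_imp_inj_on[OF g(2)]
    by (intro inj_onI) (auto dest: inj_onD)
  moreover have "map_sum f g ` (pts S <+> pts T) = f ` pts S <+> g ` pts T"
    by (auto simp: Plus_def image_Un image_image)
  ultimately have "bij_betw (map_sum f g) (pts S <+> pts T) (pts S' <+> pts T')"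
    using f(2) g(2) by (simp add: bij_betw_def)
  then show ?thesis
    unfolding over_iso_def using f g
    by (intro exI[of _ "map_sum f g"]) (auto simp: gset_map_def over_sum_simps Pi_iff)
qed

section \<open>Composition of spans\<close>

lemma gset_prod_simps:
  "pts (gset_prod Y X) = pts Y \<times> pts X"
  "y \<in> pts Y \<Longrightarrow> x \<in> pts X \<Longrightarrow> act (gset_prod Y X) (h, g) (y, x) = (act Y h y, act X g x)"
  by (auto simp: gset_prod_def)

lemma spanD:
  assumes "gset_over (H \<times>\<times> G) (gset_prod Y X) U"
  shows "finite (pts U)"
    "h \<in> carrier H \<Longrightarrow> g \<in> carrier G \<Longrightarrow> u \<in> pts U \<Longrightarrow> act U (h, g) u \<in> pts U"
    "u \<in> pts U \<Longrightarrow> act U (\<one>\<^bsub>H\<^esub>, \<one>\<^bsub>G\<^esub>) u = u"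
    "h \<in> carrier H \<Longrightarrow> g \<in> carrier G \<Longrightarrow> h' \<in> carrier H \<Longrightarrow> g' \<in> carrier G \<Longrightarrow> u \<in> pts U \<Longrightarrow>
      act U (h, g) (act U (h', g') u) = act U (h \<otimes>\<^bsub>H\<^esub> h', g \<otimes>\<^bsub>G\<^esub> g') u"
    "u \<in> pts U \<Longrightarrow> fst (anchor U u) \<in> pts Y"
    "u \<in> pts U \<Longrightarrow> snd (anchor U u) \<in> pts X"
    "h \<in> carrier H \<Longrightarrow> g \<in> carrier G \<Longrightarrow> u \<in> pts U \<Longrightarrow>
      anchor U (act U (h, g) u) = (act Y h (fst (anchor U u)), act X g (snd (anchor U u)))"
proof -
  note U = gset_overD[OF assms] and U' = finite_gsetD[OF gset_overD(1)[OF assms]]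
  show "finite (pts U)" by (rule U')
  show "h \<in> carrier H \<Longrightarrow> g \<in> carrier G \<Longrightarrow> u \<in> pts U \<Longrightarrow> act U (h, g) u \<in> pts U"
    by (rule U') auto
  show "u \<in> pts U \<Longrightarrow> act U (\<one>\<^bsub>H\<^esub>, \<one>\<^bsub>G\<^esub>) u = u" using U'(4) by simp
  show "h \<in> carrier H \<Longrightarrow> g \<in> carrier G \<Longrightarrow> h' \<in> carrier H \<Longrightarrow> g' \<in> carrier G \<Longrightarrow> u \<in> pts U \<Longrightarrow>
      act U (h, g) (act U (h', g') u) = act U (h \<otimes>\<^bsub>H\<^esub> h', g \<otimes>\<^bsub>G\<^esub> g') u"
    using U'(5)[of "(h, g)" "(h', g')" u] by simp
  show 1: "u \<in> pts U \<Longrightarrow> fst (anchor U u) \<in> pts Y"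
    and 2: "u \<in> pts U \<Longrightarrow> snd (anchor U u) \<in> pts X"
    using U(2)[of u] by (auto simp: gset_prod_simps)
  assume *: "h \<in> carrier H" "g \<in> carrier G" "u \<in> pts U"
  show "anchor U (act U (h, g) u) = (act Y h (fst (anchor U u)), act X g (snd (anchor U u)))"
    using U(3)[of "(h, g)" u] * 1 2 gset_prod_simps(2)[of "fst (anchor U u)" Y "snd (anchor U u)" X h g] by simp
qed

text \<open>The points of \<open>V\<close> and \<open>U\<close> may have any type, so that
  composites, whose points are sets of pairs, and explicit models can be composed again without
  copying.\<close>

locale composable =
  fixes K :: "'k monoid" and H :: "'h monoid" and G :: "'g monoid"
    and Z :: "('k, 'z) gset" and Y :: "('h, 'y) gset" and X :: "('g, 'x) gset"
    and V :: "('k \<times> 'h, 'v, 'z \<times> 'y) over_gset" and U :: "('h \<times> 'g, 'u, 'y \<times> 'x) over_gset"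
  assumes Z: "finite_gset K Z" and Y: "finite_gset H Y" and X: "finite_gset G X"
    and V: "gset_over (K \<times>\<times> H) (gset_prod Z Y) V" and U: "gset_over (H \<times>\<times> G) (gset_prod Y X) U"
begin

sublocale K: group K by (rule finite_gsetD(1)[OF Z])
sublocale H: group H by (rule finite_gsetD(1)[OF Y])
sublocale G: group G by (rule finite_gsetD(1)[OF X])

lemmas [simp] = spanD[OF V] spanD[OF U] finite_gsetD[OF X] finite_gsetD[OF Y] finite_gsetD[OF Z]

text \<open>The pullback condition on representatives. The action of \<open>H\<close> moves both
  middle legs alike, so it is a condition on orbits.\<close>

definition matched :: "'v \<Rightarrow> 'u \<Rightarrow> bool"
  where "matched v u \<longleftrightarrow> v \<in> pts V \<and> u \<in> pts U \<and> snd (anchor V v) = fst (anchor U u)"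

abbreviation "bal \<equiv> bal_class K H G V U"
abbreviation "W \<equiv> span_comp K H G V U"

text \<open>Substituting \<open>h\<inverse>\<close> for \<open>h\<close> leaves only the left actions of \<open>V\<close> and \<open>U\<close>.\<close>

lemma bal_alt: "bal v u = {(act V (\<one>\<^bsub>K\<^esub>, h) v, act U (h, \<one>\<^bsub>G\<^esub>) u) | h. h \<in> carrier H}"
proof -
  have "bal v u = (\<lambda>h. (act V (\<one>\<^bsub>K\<^esub>, h) v, act U (h, \<one>\<^bsub>G\<^esub>) u)) ` ((\<lambda>h. inv\<^bsub>H\<^esub> h) ` carrier H)"
    unfolding bal_class_def rmul_def lmul_def by auto
  also have "(\<lambda>h. inv\<^bsub>H\<^esub> h) ` carrier H = carrier H"
    by (metis H.inv_inv H.inv_closed image_eqI image_subset_iff subsetI subset_antisym)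
  finally show ?thesis by auto
qed

lemma matched_shift: "matched v u \<Longrightarrow> h \<in> carrier H \<Longrightarrow> matched (act V (\<one>\<^bsub>K\<^esub>, h) v) (act U (h, \<one>\<^bsub>G\<^esub>) u)"
  by (simp add: matched_def)

lemma matched_act:
  "matched v u \<Longrightarrow> k \<in> carrier K \<Longrightarrow> g \<in> carrier G \<Longrightarrow> matched (act V (k, \<one>\<^bsub>H\<^esub>) v) (act U (\<one>\<^bsub>H\<^esub>, g) u)"
  by (simp add: matched_def)

lemma bal_shift:
  assumes "v \<in> pts V" "u \<in> pts U" "h \<in> carrier H"
  shows "bal (act V (\<one>\<^bsub>K\<^esub>, h) v) (act U (h, \<one>\<^bsub>G\<^esub>) u) = bal v u"
proof -
  have sub: "bal (act V (\<one>\<^bsub>K\<^esub>, h) v) (act U (h, \<one>\<^bsub>G\<^esub>) u) \<subseteq> bal v u"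
    if "v \<in> pts V" "u \<in> pts U" "h \<in> carrier H" for v u h
    using that unfolding bal_alt by auto
  \<comment> \<open>The reverse inclusion is the same statement for the shifted pair and the inverse
    of \<open>h\<close>.\<close>
  from sub[OF assms] sub[of "act V (\<one>\<^bsub>K\<^esub>, h) v" "act U (h, \<one>\<^bsub>G\<^esub>) u" "inv\<^bsub>H\<^esub> h"] assms
  show ?thesis by simp
qed

text \<open>The pair \<open>(v', u')\<close> belongs to its own orbit, hence to that of
  \<open>(v, u)\<close>.\<close>

lemma bal_eqD:
  assumes "bal v u = bal v' u'" "v' \<in> pts V" "u' \<in> pts U"
  shows "\<exists>h \<in> carrier H. v' = act V (\<one>\<^bsub>K\<^esub>, h) v \<and> u' = act U (h, \<one>\<^bsub>G\<^esub>) u"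
proof -
  have "(act V (\<one>\<^bsub>K\<^esub>, \<one>\<^bsub>H\<^esub>) v', act U (\<one>\<^bsub>H\<^esub>, \<one>\<^bsub>G\<^esub>) u') \<in> bal v' u'" unfolding bal_alt by blast
  then have "(v', u') \<in> bal v u" using assms by simp
  then show ?thesis unfolding bal_alt by auto
qed

lemma coset_rep_bal:
  obtains h where "h \<in> carrier H" "coset_rep (bal v u) = (act V (\<one>\<^bsub>K\<^esub>, h) v, act U (h, \<one>\<^bsub>G\<^esub>) u)"
proof -
  have "(act V (\<one>\<^bsub>K\<^esub>, \<one>\<^bsub>H\<^esub>) v, act U (\<one>\<^bsub>H\<^esub>, \<one>\<^bsub>G\<^esub>) u) \<in> bal v u" unfolding bal_alt by blast
  then have "coset_rep (bal v u) \<in> bal v u" unfolding coset_rep_def by (rule someI)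
  then show ?thesis using that unfolding bal_alt by blast
qed

text \<open>The outer actions commute with the shift by \<open>H\<close>, so moving an orbit
  pointwise gives the orbit of the moved pair. The inverse in \<open>bal_act\<close> cancels the one
  hidden in \<open>rmul\<close>.\<close>

lemma bal_act:
  assumes "v \<in> pts V" "u \<in> pts U" "k \<in> carrier K" "g \<in> carrier G"
  shows "bal_act K H G V U (k, g) (bal v u) = bal (act V (k, \<one>\<^bsub>H\<^esub>) v) (act U (\<one>\<^bsub>H\<^esub>, g) u)"
  unfolding bal_alt bal_act_def lmul_def rmul_def using assms
  by (simp add: setcompr_eq_image image_image cong: image_cong)

lemma pts_W: "pts W = {bal v u | v u. matched v u}"
  by (simp add: span_comp_def Let_def matched_def)

lemma bal_in_W: "matched v u \<Longrightarrow> bal v u \<in> pts W"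
  using pts_W by auto

lemma pts_WE:
  assumes "c \<in> pts W" obtains v u where "matched v u" "c = bal v u"
  using assms pts_W by auto

lemma act_W:
  assumes "matched v u" "k \<in> carrier K" "g \<in> carrier G"
  shows "act W (k, g) (bal v u) = bal (act V (k, \<one>\<^bsub>H\<^esub>) v) (act U (\<one>\<^bsub>H\<^esub>, g) u)"
proof -
  have "bal v u \<in> pts W" using assms pts_W by auto
  then have "act W (k, g) (bal v u) = bal_act K H G V U (k, g) (bal v u)"
    by (simp add: span_comp_def Let_def)
  then show ?thesis using assms bal_act by (simp add: matched_def)
qed

text \<open>The anchor of an orbit is read at a chosen pair. Another choice moves \<open>v\<close>
  by \<open>(\<one>, h)\<close> and \<open>u\<close> by \<open>(h, \<one>)\<close>, which fixes the
  outer leg of each.\<close>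

lemma anchor_W:
  assumes "matched v u" shows "anchor W (bal v u) = (fst (anchor V v), snd (anchor U u))"
proof -
  obtain h where "h \<in> carrier H" "coset_rep (bal v u) = (act V (\<one>\<^bsub>K\<^esub>, h) v, act U (h, \<one>\<^bsub>G\<^esub>) u)"
    by (rule coset_rep_bal)
  then show ?thesis using assms by (simp add: span_comp_def Let_def matched_def)
qed

lemma span_comp_over: "gset_over (K \<times>\<times> G) (gset_prod Z X) W"
proof -
  have sub: "pts W \<subseteq> (\<lambda>(v, u). bal v u) ` (pts V \<times> pts U)" unfolding pts_W matched_def by auto
  have fin: "finite_gset (K \<times>\<times> G) W"
  proof (rule finite_gsetI)
    show "finite (pts W)" by (rule finite_subset[OF sub]) simp
  next
    fix g show "act W g \<in> extensional (pts W)" by (simp add: span_comp_def Let_def)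
  next
    fix s assume s: "s \<in> pts W"
    then show "act W \<one>\<^bsub>K \<times>\<times> G\<^esub> s = s" by (elim pts_WE) (simp add: act_W, simp add: matched_def)
    fix g assume "g \<in> carrier (K \<times>\<times> G)"
    then show "act W g s \<in> pts W"
      using s by (elim pts_WE) (auto simp: act_W bal_in_W matched_act)
    fix h assume "h \<in> carrier (K \<times>\<times> G)"
    then show "act W (g \<otimes>\<^bsub>K \<times>\<times> G\<^esub> h) s = act W g (act W h s)"
      using s \<open>g \<in> carrier (K \<times>\<times> G)\<close>
      by (elim pts_WE) (auto simp: act_W matched_act, auto simp: matched_def)
  qed (simp add: DirProd_group K.is_group G.is_group)
  have "anchor W s \<in> pts (gset_prod Z X)" if "s \<in> pts W" for s
    using that by (elim pts_WE) (simp add: anchor_W gset_prod_simps, simp add: matched_def)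
  moreover have "anchor W (act W g s) = act (gset_prod Z X) g (anchor W s)"
    if g: "g \<in> carrier (K \<times>\<times> G)" and s: "s \<in> pts W" for g s
  proof -
    obtain k a where ka: "g = (k, a)" "k \<in> carrier K" "a \<in> carrier G" using g by auto
    obtain v u where vu: "matched v u" "s = bal v u" using s by (elim pts_WE)
    then have "v \<in> pts V" "u \<in> pts U" by (simp_all add: matched_def)
    then show ?thesis using ka vu by (simp add: act_W anchor_W matched_act gset_prod_simps)
  qed
  ultimately show ?thesis using fin by (auto simp: gset_over_def gset_map_def)
qed

text \<open>A map out of the composite is prescribed on matched pairs and is bijective when its
  fibres are exactly the orbits: \<open>shift\<close> makes it constant on orbits,
  \<open>inj\<close> separates them. The concrete models of composites below are all recognised by
  this criterion.\<close>

lemma span_comp_isoI: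
  fixes T :: "('k \<times> 'g, 't, 'z \<times> 'x) over_gset"
  assumes closed: "\<And>v u. matched v u \<Longrightarrow> f v u \<in> pts T"
    and shift: "\<And>v u h. matched v u \<Longrightarrow> h \<in> carrier H \<Longrightarrow>
      f (act V (\<one>\<^bsub>K\<^esub>, h) v) (act U (h, \<one>\<^bsub>G\<^esub>) u) = f v u"
    and equi: "\<And>v u k g. matched v u \<Longrightarrow> k \<in> carrier K \<Longrightarrow> g \<in> carrier G \<Longrightarrow>
      f (act V (k, \<one>\<^bsub>H\<^esub>) v) (act U (\<one>\<^bsub>H\<^esub>, g) u) = act T (k, g) (f v u)"
    and anchor: "\<And>v u. matched v u \<Longrightarrow> anchor T (f v u) = (fst (anchor V v), snd (anchor U u))"
    and inj: "\<And>v u v' u'. matched v u \<Longrightarrow> matched v' u' \<Longrightarrow> f v u = f v' u' \<Longrightarrow>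
      \<exists>h \<in> carrier H. v' = act V (\<one>\<^bsub>K\<^esub>, h) v \<and> u' = act U (h, \<one>\<^bsub>G\<^esub>) u"
    and surj: "\<And>t. t \<in> pts T \<Longrightarrow> \<exists>v u. matched v u \<and> f v u = t"
  shows "over_iso (K \<times>\<times> G) W T"
proof -
  \<comment> \<open>Evaluation at the chosen pair of an orbit; \<open>shift\<close> removes the
    dependence on the choice.\<close>
  define F where "F c = (\<lambda>(v, u). f v u) (coset_rep c)" for c
  have F: "F (bal v u) = f v u" if "matched v u" for v u
    by (rule coset_rep_bal[of v u]) (simp add: F_def shift[OF that])
  have "inj_on F (pts W)"
  proof (rule inj_onI)
    fix c c' assume "c \<in> pts W" "c' \<in> pts W" "F c = F c'"
    then obtain v u v' u' where *: "matched v u" "matched v' u'" "c = bal v u" "c' = bal v' u'" "f v u = f v' u'"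
      by (elim pts_WE) (simp add: F)
    then obtain h where "h \<in> carrier H" "v' = act V (\<one>\<^bsub>K\<^esub>, h) v" "u' = act U (h, \<one>\<^bsub>G\<^esub>) u"
      using inj by blast
    then show "c = c'" using * bal_shift by (simp add: matched_def)
  qed
  moreover have "F ` pts W = pts T"
  proof (intro equalityI subsetI)
    fix t assume "t \<in> F ` pts W"
    then obtain c where "c \<in> pts W" "t = F c" by blast
    then show "t \<in> pts T" by (elim pts_WE) (simp add: F closed)
  next
    fix t assume "t \<in> pts T"
    then obtain v u where "matched v u" "f v u = t" using surj by blast
    then show "t \<in> F ` pts W" using F[of v u] bal_in_W[of v u] by (metis image_eqI)
  qed
  moreover have "gset_map (K \<times>\<times> G) W T F"
    unfolding gset_map_def
  proof (intro conjI ballI funcsetI)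
    fix c assume "c \<in> pts W"
    then obtain v u where c: "matched v u" "c = bal v u" by (elim pts_WE)
    show "F c \<in> pts T" using c by (simp add: F closed)
    fix a assume "a \<in> carrier (K \<times>\<times> G)"
    then obtain k g where a: "a = (k, g)" "k \<in> carrier K" "g \<in> carrier G" by auto
    then show "F (act W a c) = act T a (F c)"
      using c by (simp add: F act_W matched_act equi)
  qed
  moreover have "anchor T (F c) = anchor W c" if "c \<in> pts W" for c
    using that by (elim pts_WE) (simp add: F anchor anchor_W)
  ultimately show ?thesis unfolding over_iso_def bij_betw_def by blast
qed

end


section \<open>Span composition under isomorphisms, sums and iteration\<close>

lemma over_sum_cases:
  "(\<And>s. s \<in> pts S \<Longrightarrow> P (Inl s)) \<Longrightarrow> (\<And>t. t \<in> pts T \<Longrightarrow> P (Inr t)) \<Longrightarrow> x \<in> pts (over_sum S T) \<Longrightarrow> P x"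
  by (auto simp: over_sum_simps)

lemma over_isoE:
  assumes "over_iso \<Gamma> S T"
  obtains f where "\<And>s. s \<in> pts S \<Longrightarrow> f s \<in> pts T"
    "\<And>g s. g \<in> carrier \<Gamma> \<Longrightarrow> s \<in> pts S \<Longrightarrow> f (act S g s) = act T g (f s)"
    "\<And>s. s \<in> pts S \<Longrightarrow> anchor T (f s) = anchor S s"
    "\<And>s s'. s \<in> pts S \<Longrightarrow> s' \<in> pts S \<Longrightarrow> f s = f s' \<Longrightarrow> s = s'"
    "\<And>t. t \<in> pts T \<Longrightarrow> \<exists>s \<in> pts S. f s = t"
  using assms that unfolding over_iso_def gset_map_def bij_betw_def inj_on_def
  by (smt (verit, best) Pi_iff image_iff)

text \<open>Compatibility with the anchors preserves matching, and equivariance sends orbits to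
  orbits. For injectivity the shifting element found in \<open>V'\<close> and \<open>U'\<close> is
  used unchanged in \<open>V\<close> and \<open>U\<close>.\<close>

lemma span_comp_cong:
  assumes "composable K H G Z Y X V U" "composable K H G Z Y X V' U'"
    and V: "over_iso (K \<times>\<times> H) V V'" and U: "over_iso (H \<times>\<times> G) U U'"
  shows "over_iso (K \<times>\<times> G) (span_comp K H G V U) (span_comp K H G V' U')"
proof -
  interpret A: composable K H G Z Y X V U by fact
  interpret B: composable K H G Z Y X V' U' by fact
  obtain \<phi> where \<phi>: "\<And>s. s \<in> pts V \<Longrightarrow> \<phi> s \<in> pts V'"
    "\<And>g s. g \<in> carrier (K \<times>\<times> H) \<Longrightarrow> s \<in> pts V \<Longrightarrow> \<phi> (act V g s) = act V' g (\<phi> s)"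
    "\<And>s. s \<in> pts V \<Longrightarrow> anchor V' (\<phi> s) = anchor V s"
    "\<And>s s'. s \<in> pts V \<Longrightarrow> s' \<in> pts V \<Longrightarrow> \<phi> s = \<phi> s' \<Longrightarrow> s = s'"
    "\<And>t. t \<in> pts V' \<Longrightarrow> \<exists>s \<in> pts V. \<phi> s = t" by (rule over_isoE[OF V]) (rule that; assumption)
  obtain \<psi> where \<psi>: "\<And>s. s \<in> pts U \<Longrightarrow> \<psi> s \<in> pts U'"
    "\<And>g s. g \<in> carrier (H \<times>\<times> G) \<Longrightarrow> s \<in> pts U \<Longrightarrow> \<psi> (act U g s) = act U' g (\<psi> s)"
    "\<And>s. s \<in> pts U \<Longrightarrow> anchor U' (\<psi> s) = anchor U s"
    "\<And>s s'. s \<in> pts U \<Longrightarrow> s' \<in> pts U \<Longrightarrow> \<psi> s = \<psi> s' \<Longrightarrow> s = s'"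
    "\<And>t. t \<in> pts U' \<Longrightarrow> \<exists>s \<in> pts U. \<psi> s = t" by (rule over_isoE[OF U]) (rule that; assumption)
  note [simp] = \<phi>(1-3) \<psi>(1-3)
  have matched: "B.matched (\<phi> v) (\<psi> u)" if "A.matched v u" for v u
    using that by (simp add: A.matched_def B.matched_def)
  note m = A.matched_def B.matched_def
  show ?thesis
  proof (rule A.span_comp_isoI[where f = "\<lambda>v u. B.bal (\<phi> v) (\<psi> u)"])
    fix v u v' u' assume vu: "A.matched v u" and vu': "A.matched v' u'" and eq: "B.bal (\<phi> v) (\<psi> u) = B.bal (\<phi> v') (\<psi> u')"
    then obtain h where h: "h \<in> carrier H" "\<phi> v' = act V' (\<one>\<^bsub>K\<^esub>, h) (\<phi> v)" "\<psi> u' = act U' (h, \<one>\<^bsub>G\<^esub>) (\<psi> u)"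
      using B.bal_eqD[OF eq] by (auto simp: m)
    then have "\<phi> v' = \<phi> (act V (\<one>\<^bsub>K\<^esub>, h) v)" "\<psi> u' = \<psi> (act U (h, \<one>\<^bsub>G\<^esub>) u)"
      using vu by (simp_all add: m)
    then have "v' = act V (\<one>\<^bsub>K\<^esub>, h) v \<and> u' = act U (h, \<one>\<^bsub>G\<^esub>) u"
      using \<phi>(4)[of v'] \<psi>(4)[of u'] vu vu' h(1) by (simp add: m)
    then show "\<exists>h \<in> carrier H. v' = act V (\<one>\<^bsub>K\<^esub>, h) v \<and> u' = act U (h, \<one>\<^bsub>G\<^esub>) u" using h by blast
  next
    fix c assume "c \<in> pts B.W"
    then obtain v' u' where vu': "B.matched v' u'" "c = B.bal v' u'" by (elim B.pts_WE)
    then obtain v u where "v \<in> pts V" "\<phi> v = v'" "u \<in> pts U" "\<psi> u = u'"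
      using \<phi>(5) \<psi>(5) by (metis B.matched_def)
    then show "\<exists>v u. A.matched v u \<and> B.bal (\<phi> v) (\<psi> u) = c"
      using vu' \<phi>(3)[of v] \<psi>(3)[of u] by (intro exI[of _ v] exI[of _ u]) (auto simp: m)
  next
    fix v u h assume "A.matched v u" "h \<in> carrier H"
    then show "B.bal (\<phi> (act V (\<one>\<^bsub>K\<^esub>, h) v)) (\<psi> (act U (h, \<one>\<^bsub>G\<^esub>) u)) = B.bal (\<phi> v) (\<psi> u)"
      by (simp add: A.matched_def B.bal_shift)
  next
    fix v u k g assume "A.matched v u" "k \<in> carrier K" "g \<in> carrier G"
    then show "B.bal (\<phi> (act V (k, \<one>\<^bsub>H\<^esub>) v)) (\<psi> (act U (\<one>\<^bsub>H\<^esub>, g) u)) = act B.W (k, g) (B.bal (\<phi> v) (\<psi> u))"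
      by (simp add: B.act_W matched) (simp add: A.matched_def)
  next
    fix v u assume "A.matched v u"
    then show "anchor B.W (B.bal (\<phi> v) (\<psi> u)) = (fst (anchor V v), snd (anchor U u))"
      by (simp add: B.anchor_W matched) (simp add: A.matched_def)
  qed (simp add: matched B.bal_in_W)
qed

text \<open>Shifting by \<open>H\<close> does not leave a summand, so every orbit has its first
  components in exactly one of \<open>V1\<close> and \<open>V2\<close>.\<close>

lemma span_comp_sum_left:
  assumes "composable K H G Z Y X V1 U" "composable K H G Z Y X V2 U"
  shows "over_iso (K \<times>\<times> G) (span_comp K H G (over_sum V1 V2) U)
    (over_sum (span_comp K H G V1 U) (span_comp K H G V2 U))"
proof -
  interpret A: composable K H G Z Y X V1 U by fact
  interpret B: composable K H G Z Y X V2 U by fact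
  interpret S: composable K H G Z Y X "over_sum V1 V2" U
    by (intro composable.intro A.Z A.Y A.X gset_over_sum A.V B.V A.U)
  have mI [simp]: "S.matched (Inl v) u \<longleftrightarrow> A.matched v u" "S.matched (Inr w) u \<longleftrightarrow> B.matched w u" for v w u
    by (auto simp: S.matched_def A.matched_def B.matched_def over_sum_simps)
  note [simp] = over_sum_simps A.bal_in_W B.bal_in_W A.act_W B.act_W A.anchor_W B.anchor_W
  have mem: "A.matched v u \<Longrightarrow> v \<in> pts V1" "A.matched v u \<Longrightarrow> u \<in> pts U"
    "B.matched w u \<Longrightarrow> w \<in> pts V2" "B.matched w u \<Longrightarrow> u \<in> pts U" for v w u
    by (simp_all add: A.matched_def B.matched_def)
  define f where "f x u = (case x of Inl v \<Rightarrow> Inl (A.bal v u) | Inr w \<Rightarrow> Inr (B.bal w u))" for x u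
  have [simp]: "f (Inl v) u = Inl (A.bal v u)" "f (Inr w) u = Inr (B.bal w u)" for v w u
    by (simp_all add: f_def)
  show ?thesis
  proof (rule S.span_comp_isoI[where f = f])
    fix x u y u' assume "S.matched x u" "S.matched y u'" "f x u = f y u'"
    then show "\<exists>h \<in> carrier H. y = act (over_sum V1 V2) (\<one>\<^bsub>K\<^esub>, h) x \<and> u' = act U (h, \<one>\<^bsub>G\<^esub>) u"
      by (cases x; cases y; simp add: mem) (metis A.bal_eqD B.bal_eqD mem)+
  next
    fix t assume "t \<in> pts (over_sum A.W B.W)"
    then show "\<exists>x u. S.matched x u \<and> f x u = t"
    proof (rule over_sum_cases[rotated 2])
      fix s assume "s \<in> pts A.W"
      then obtain v u where "A.matched v u" "s = A.bal v u" by (elim A.pts_WE)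
      then show "\<exists>x u. S.matched x u \<and> f x u = Inl s" by (intro exI[of _ "Inl v"] exI[of _ u]) simp
    next
      fix s assume "s \<in> pts B.W"
      then obtain v u where "B.matched v u" "s = B.bal v u" by (elim B.pts_WE)
      then show "\<exists>x u. S.matched x u \<and> f x u = Inr s" by (intro exI[of _ "Inr v"] exI[of _ u]) simp
    qed
  next
    fix x u assume *: "S.matched x u"
    then show "f x u \<in> pts (over_sum A.W B.W)" by (cases x) auto
    show "anchor (over_sum A.W B.W) (f x u) = (fst (anchor (over_sum V1 V2) x), snd (anchor U u))"
      using * by (cases x) auto
    fix h assume "h \<in> carrier H"
    then show "f (act (over_sum V1 V2) (\<one>\<^bsub>K\<^esub>, h) x) (act U (h, \<one>\<^bsub>G\<^esub>) u) = f x u"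
      using * by (cases x) (auto simp: mem A.bal_shift B.bal_shift)
  next
    fix x u k g assume "S.matched x u" "k \<in> carrier K" "g \<in> carrier G"
    then show "f (act (over_sum V1 V2) (k, \<one>\<^bsub>H\<^esub>) x) (act U (\<one>\<^bsub>H\<^esub>, g) u) = act (over_sum A.W B.W) (k, g) (f x u)"
      by (cases x) (auto simp: mem)
  qed
qed

lemma span_comp_sum_right:
  assumes "composable K H G Z Y X V U1" "composable K H G Z Y X V U2"
  shows "over_iso (K \<times>\<times> G) (span_comp K H G V (over_sum U1 U2))
    (over_sum (span_comp K H G V U1) (span_comp K H G V U2))"
proof -
  interpret A: composable K H G Z Y X V U1 by fact
  interpret B: composable K H G Z Y X V U2 by fact
  interpret S: composable K H G Z Y X V "over_sum U1 U2"
    by (intro composable.intro A.Z A.Y A.X gset_over_sum A.V B.U A.U)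
  have mI [simp]: "S.matched v (Inl u) \<longleftrightarrow> A.matched v u" "S.matched v (Inr w) \<longleftrightarrow> B.matched v w" for v w u
    by (auto simp: S.matched_def A.matched_def B.matched_def over_sum_simps)
  note [simp] = over_sum_simps A.bal_in_W B.bal_in_W A.act_W B.act_W A.anchor_W B.anchor_W
  have mem: "A.matched v u \<Longrightarrow> v \<in> pts V" "A.matched v u \<Longrightarrow> u \<in> pts U1"
    "B.matched v w \<Longrightarrow> v \<in> pts V" "B.matched v w \<Longrightarrow> w \<in> pts U2" for v w u
    by (simp_all add: A.matched_def B.matched_def)
  define f where "f v x = (case x of Inl u \<Rightarrow> Inl (A.bal v u) | Inr u \<Rightarrow> Inr (B.bal v u))" for v x
  have [simp]: "f v (Inl u) = Inl (A.bal v u)" "f v (Inr w) = Inr (B.bal v w)" for v w u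
    by (simp_all add: f_def)
  show ?thesis
  proof (rule S.span_comp_isoI[where f = f])
    fix v x v' y assume "S.matched v x" "S.matched v' y" "f v x = f v' y"
    then show "\<exists>h \<in> carrier H. v' = act V (\<one>\<^bsub>K\<^esub>, h) v \<and> y = act (over_sum U1 U2) (h, \<one>\<^bsub>G\<^esub>) x"
      by (cases x; cases y; simp add: mem) (metis A.bal_eqD B.bal_eqD mem)+
  next
    fix t assume "t \<in> pts (over_sum A.W B.W)"
    then show "\<exists>v x. S.matched v x \<and> f v x = t"
    proof (rule over_sum_cases[rotated 2])
      fix s assume "s \<in> pts A.W"
      then obtain v u where "A.matched v u" "s = A.bal v u" by (elim A.pts_WE)
      then show "\<exists>v x. S.matched v x \<and> f v x = Inl s" by (intro exI[of _ v] exI[of _ "Inl u"]) simp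
    next
      fix s assume "s \<in> pts B.W"
      then obtain v u where "B.matched v u" "s = B.bal v u" by (elim B.pts_WE)
      then show "\<exists>v x. S.matched v x \<and> f v x = Inr s" by (intro exI[of _ v] exI[of _ "Inr u"]) simp
    qed
  next
    fix v x assume *: "S.matched v x"
    then show "f v x \<in> pts (over_sum A.W B.W)" by (cases x) auto
    show "anchor (over_sum A.W B.W) (f v x) = (fst (anchor V v), snd (anchor (over_sum U1 U2) x))"
      using * by (cases x) auto
    fix h assume "h \<in> carrier H"
    then show "f (act V (\<one>\<^bsub>K\<^esub>, h) v) (act (over_sum U1 U2) (h, \<one>\<^bsub>G\<^esub>) x) = f v x"
      using * by (cases x) (auto simp: mem A.bal_shift B.bal_shift)
  next
    fix v x k g assume "S.matched v x" "k \<in> carrier K" "g \<in> carrier G"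
    then show "f (act V (k, \<one>\<^bsub>H\<^esub>) v) (act (over_sum U1 U2) (\<one>\<^bsub>H\<^esub>, g) x) = act (over_sum A.W B.W) (k, g) (f v x)"
      by (cases x) (auto simp: mem)
  qed
qed

text \<open>The isomorphism is \<open>[w, [v, u]] \<mapsto> [[w, v], u]\<close>. Its second argument
  is an orbit, so a pair is chosen in it; another choice shifts \<open>v\<close> and
  \<open>u\<close> by an element of \<open>H\<close>, which the outer balancing on the right-hand
  side absorbs.\<close>

lemma span_comp_assoc:
  assumes "composable L K H Q Z Y W V" "composable K H G Z Y X V U"
  shows "over_iso (L \<times>\<times> G) (span_comp L K G W (span_comp K H G V U))
    (span_comp L H G (span_comp L K H W V) U)"
proof -
  interpret WV: composable L K H Q Z Y W V by fact
  interpret VU: composable K H G Z Y X V U by fact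
  interpret A: composable L K G Q Z X W VU.W
    by (intro composable.intro WV.Z WV.Y VU.X WV.V VU.span_comp_over)
  interpret B: composable L H G Q Y X WV.W U
    by (intro composable.intro WV.Z VU.Y VU.X WV.span_comp_over VU.U)
  have mA: "A.matched w (VU.bal v u) \<longleftrightarrow> WV.matched w v" if "VU.matched v u" for w v u
    using that VU.bal_in_W[OF that] by (auto simp: A.matched_def VU.anchor_W WV.matched_def VU.matched_def)
  have mB: "B.matched (WV.bal w v) u \<longleftrightarrow> VU.matched v u" if "WV.matched w v" for w v u
    using that WV.bal_in_W[OF that] by (auto simp: B.matched_def WV.anchor_W WV.matched_def VU.matched_def)
  have mem: "WV.matched w v \<Longrightarrow> w \<in> pts W" "WV.matched w v \<Longrightarrow> v \<in> pts V" "VU.matched v u \<Longrightarrow> v \<in> pts V"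
    "VU.matched v u \<Longrightarrow> u \<in> pts U" for w v u
    by (simp_all add: WV.matched_def VU.matched_def)
  define f where "f w c = (\<lambda>(v, u). B.bal (WV.bal w v) u) (coset_rep c)" for w c
  have f: "f w (VU.bal v u) = B.bal (WV.bal w v) u" if "VU.matched v u" "WV.matched w v" for w v u
  proof -
    obtain h where h: "h \<in> carrier H" "coset_rep (VU.bal v u) = (act V (\<one>\<^bsub>K\<^esub>, h) v, act U (h, \<one>\<^bsub>G\<^esub>) u)"
      by (rule VU.coset_rep_bal)
    have "WV.bal w (act V (\<one>\<^bsub>K\<^esub>, h) v) = act WV.W (\<one>\<^bsub>L\<^esub>, h) (WV.bal w v)"
      using h that by (simp add: WV.act_W mem)
    then show ?thesis
      unfolding f_def h(2) using h(1) that B.bal_shift[of "WV.bal w v" u h] WV.bal_in_W by (simp add: mem)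
  qed
  have AE: "\<exists>v u. c = VU.bal v u \<and> VU.matched v u \<and> WV.matched w v" if "A.matched w c" for w c
  proof -
    have "c \<in> pts VU.W" using that by (simp add: A.matched_def)
    then show ?thesis using that mA by (elim VU.pts_WE) blast
  qed
  show ?thesis
  proof (rule A.span_comp_isoI[where f = f])
    fix w c assume "A.matched w c"
    then obtain v u where c: "c = VU.bal v u" "VU.matched v u" "WV.matched w v" using AE by blast
    show "f w c \<in> pts B.W" using c by (simp add: f mB B.bal_in_W)
    show "anchor B.W (f w c) = (fst (anchor W w), snd (anchor VU.W c))"
      using c by (simp add: f mB B.anchor_W VU.anchor_W WV.anchor_W)
    fix k assume k: "k \<in> carrier K"
    have "act VU.W (k, \<one>\<^bsub>G\<^esub>) c = VU.bal (act V (k, \<one>\<^bsub>H\<^esub>) v) u"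
      using c k by (simp add: VU.act_W mem)
    moreover have "VU.matched (act V (k, \<one>\<^bsub>H\<^esub>) v) u" using VU.matched_act[OF c(2) k, of "\<one>\<^bsub>G\<^esub>"] c by (simp add: mem)
    moreover have "WV.matched (act W (\<one>\<^bsub>L\<^esub>, k) w) (act V (k, \<one>\<^bsub>H\<^esub>) v)" using WV.matched_shift[OF c(3) k] .
    ultimately show "f (act W (\<one>\<^bsub>L\<^esub>, k) w) (act VU.W (k, \<one>\<^bsub>G\<^esub>) c) = f w c"
      using c k by (simp add: f WV.bal_shift mem)
  next
    fix w c l g assume "A.matched w c" and l: "l \<in> carrier L" and g: "g \<in> carrier G"
    then obtain v u where c: "c = VU.bal v u" "VU.matched v u" "WV.matched w v" using AE by blast
    have "act VU.W (\<one>\<^bsub>K\<^esub>, g) c = VU.bal v (act U (\<one>\<^bsub>H\<^esub>, g) u)"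
      using c g by (simp add: VU.act_W mem)
    moreover have "VU.matched v (act U (\<one>\<^bsub>H\<^esub>, g) u)" using VU.matched_act[OF c(2) _ g, of "\<one>\<^bsub>K\<^esub>"] c by (simp add: mem)
    moreover have "WV.matched (act W (l, \<one>\<^bsub>K\<^esub>) w) v" using WV.matched_act[OF c(3) l, of "\<one>\<^bsub>H\<^esub>"] c by (simp add: mem)
    moreover have "act WV.W (l, \<one>\<^bsub>H\<^esub>) (WV.bal w v) = WV.bal (act W (l, \<one>\<^bsub>K\<^esub>) w) v"
      using c l by (simp add: WV.act_W mem)
    ultimately show "f (act W (l, \<one>\<^bsub>K\<^esub>) w) (act VU.W (\<one>\<^bsub>K\<^esub>, g) c) = act B.W (l, g) (f w c)"
      using c l g by (simp add: f mB B.act_W)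
  next
    fix w c w' c' assume "A.matched w c" "A.matched w' c'" and eq: "f w c = f w' c'"
    then obtain v u v' u' where c: "c = VU.bal v u" "VU.matched v u" "WV.matched w v"
      and c': "c' = VU.bal v' u'" "VU.matched v' u'" "WV.matched w' v'" using AE by metis
    \<comment> \<open>Equality on the right yields an \<open>h\<close> from the outer orbit and
      after that a \<open>k\<close> from the inner one. On the left only \<open>k\<close> remains
      visible, because \<open>h\<close> does not change the orbit \<open>c\<close>.\<close>
    obtain h where h: "h \<in> carrier H" "WV.bal w' v' = act WV.W (\<one>\<^bsub>L\<^esub>, h) (WV.bal w v)" "u' = act U (h, \<one>\<^bsub>G\<^esub>) u"
      using B.bal_eqD[of "WV.bal w v" u "WV.bal w' v'" u'] eq c c' WV.bal_in_W by (auto simp: f mem)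
    then have "WV.bal w (act V (\<one>\<^bsub>K\<^esub>, h) v) = WV.bal w' v'"
      using c by (simp add: WV.act_W mem)
    then obtain k where k: "k \<in> carrier K" "w' = act W (\<one>\<^bsub>L\<^esub>, k) w" "v' = act V (k, \<one>\<^bsub>H\<^esub>) (act V (\<one>\<^bsub>K\<^esub>, h) v)"
      using WV.bal_eqD[of w "act V (\<one>\<^bsub>K\<^esub>, h) v" w' v'] c' by (auto simp: mem)
    have "c' = act VU.W (k, \<one>\<^bsub>G\<^esub>) (VU.bal (act V (\<one>\<^bsub>K\<^esub>, h) v) (act U (h, \<one>\<^bsub>G\<^esub>) u))"
      using c c' h k by (simp add: VU.act_W VU.matched_shift mem)
    also have "\<dots> = act VU.W (k, \<one>\<^bsub>G\<^esub>) c" using c h by (simp add: VU.bal_shift mem)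
    finally show "\<exists>k \<in> carrier K. w' = act W (\<one>\<^bsub>L\<^esub>, k) w \<and> c' = act VU.W (k, \<one>\<^bsub>G\<^esub>) c" using k by blast
  next
    fix t assume "t \<in> pts B.W"
    then obtain d u where d: "B.matched d u" "t = B.bal d u" by (elim B.pts_WE)
    then have "d \<in> pts WV.W" by (simp add: B.matched_def)
    then obtain w v where wv: "WV.matched w v" "d = WV.bal w v" by (elim WV.pts_WE)
    then have "VU.matched v u" using d mB by simp
    then show "\<exists>w c. A.matched w c \<and> f w c = t" using wv d f mA by metis
  qed
qed

section \<open>Identity spans\<close>

lemma span_ident_simps:
  "pts (span_ident G X) = carrier G \<times> pts X"
  "g \<in> carrier G \<Longrightarrow> x \<in> pts X \<Longrightarrow>
    act (span_ident G X) (a, b) (g, x) = (a \<otimes>\<^bsub>G\<^esub> g \<otimes>\<^bsub>G\<^esub> inv\<^bsub>G\<^esub> b, act X a x)"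
  "anchor (span_ident G X) (g, x) = (x, act X (inv\<^bsub>G\<^esub> g) x)"
  by (auto simp: span_ident_def)

lemma span_ident_over:
  assumes X: "finite_gset G X" and fin: "finite (carrier G)"
  shows "gset_over (G \<times>\<times> G) (gset_prod X X) (span_ident G X)"
proof -
  interpret group G using finite_gsetD(1)[OF X] .
  note [simp] = finite_gsetD[OF X] span_ident_simps gset_prod_simps
  have "finite_gset (G \<times>\<times> G) (span_ident G X)"
  proof (rule finite_gsetI)
    fix g show "act (span_ident G X) g \<in> extensional (pts (span_ident G X))"
      by (auto simp: span_ident_def split: prod.splits)
  qed (auto simp: DirProd_group fin m_assoc inv_mult_group)
  then show ?thesis
    by (auto simp: gset_over_def gset_map_def inv_mult_group m_assoc)
qed

text \<open>The isomorphism is \<open>[(h, y), u] \<mapsto> h u\<close>: matching forces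
  \<open>y\<close> to be \<open>h\<close> applied to the left leg of \<open>u\<close>, so
  \<open>y\<close> carries no information.\<close>

lemma span_ident_left:
  assumes Y: "finite_gset H Y" and fin: "finite (carrier H)" and X: "finite_gset G X"
    and U: "gset_over (H \<times>\<times> G) (gset_prod Y X) U"
  shows "over_iso (H \<times>\<times> G) (span_comp H H G (span_ident H Y) U) U"
proof -
  interpret A: composable H H G Y Y X "span_ident H Y" U
    by (intro composable.intro X Y U span_ident_over fin)
  note [simp] = span_ident_simps
  have m: "A.matched (h, y) u \<longleftrightarrow> h \<in> carrier H \<and> u \<in> pts U \<and> y = act Y h (fst (anchor U u))" for h y u
    by (auto simp: A.matched_def act_inv_eq_iff[OF Y])
  show ?thesis
  proof (rule A.span_comp_isoI[where f = "\<lambda>(h, y) u. act U (h, \<one>\<^bsub>G\<^esub>) u"], goal_cases)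
    case (5 v u v' u')
    obtain h h' where vv: "v = (h, act Y h (fst (anchor U u)))" "v' = (h', act Y h' (fst (anchor U u')))"
      and mem: "h \<in> carrier H" "h' \<in> carrier H" "u \<in> pts U" "u' \<in> pts U"
      using 5(1,2) by (cases v; cases v') (auto simp: m)
    have eq: "act U (h, \<one>\<^bsub>G\<^esub>) u = act U (h', \<one>\<^bsub>G\<^esub>) u'" using 5(3) vv by simp
    \<comment> \<open>From \<open>h u = h' u'\<close> the shift must be by the product of the
      inverse of \<open>h'\<close> with \<open>h\<close>; the same element takes \<open>h\<close> to
      \<open>h'\<close> in the identity span.\<close>
    have "u' = act U (inv\<^bsub>H\<^esub> h', \<one>\<^bsub>G\<^esub>) (act U (h', \<one>\<^bsub>G\<^esub>) u')" using mem by simp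
    also have "\<dots> = act U (inv\<^bsub>H\<^esub> h' \<otimes>\<^bsub>H\<^esub> h, \<one>\<^bsub>G\<^esub>) u" unfolding eq[symmetric] using mem by simp
    finally have u': "u' = act U (inv\<^bsub>H\<^esub> h' \<otimes>\<^bsub>H\<^esub> h, \<one>\<^bsub>G\<^esub>) u" .
    show ?case
      by (rule bexI[of _ "inv\<^bsub>H\<^esub> h' \<otimes>\<^bsub>H\<^esub> h"])
        (use mem u' in \<open>simp_all add: vv A.K.inv_mult_group A.K.m_assoc[symmetric]\<close>)
  next
    case (6 t)
    then show ?case
      by (intro exI[of _ "(\<one>\<^bsub>H\<^esub>, fst (anchor U t))"] exI[of _ t]) (simp add: m)
  qed (auto simp: m A.K.m_assoc)
qed

text \<open>Here the isomorphism is \<open>[u, (g, x)] \<mapsto> u g\<close>, with \<open>x\<close>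
  forced to be the right leg of \<open>u\<close>. Right multiplication by \<open>g\<close> is the
  action of its inverse.\<close>

lemma span_ident_right:
  assumes Y: "finite_gset H Y" and fin: "finite (carrier G)" and X: "finite_gset G X"
    and U: "gset_over (H \<times>\<times> G) (gset_prod Y X) U"
  shows "over_iso (H \<times>\<times> G) (span_comp H G G U (span_ident G X)) U"
proof -
  interpret A: composable H G G Y X X U "span_ident G X"
    by (intro composable.intro X Y U span_ident_over fin)
  note [simp] = span_ident_simps
  have m: "A.matched u (g, x) \<longleftrightarrow> g \<in> carrier G \<and> u \<in> pts U \<and> x = snd (anchor U u)" for g x u
    by (auto simp: A.matched_def)
  show ?thesis
  proof (rule A.span_comp_isoI[where f = "\<lambda>u (g, x). act U (\<one>\<^bsub>H\<^esub>, inv\<^bsub>G\<^esub> g) u"], goal_cases)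
    case (5 u v u' v')
    obtain g g' where vv: "v = (g, snd (anchor U u))" "v' = (g', snd (anchor U u'))"
      and mem: "g \<in> carrier G" "g' \<in> carrier G" "u \<in> pts U" "u' \<in> pts U"
      using 5(1,2) by (cases v; cases v') (auto simp: m)
    have eq: "act U (\<one>\<^bsub>H\<^esub>, inv\<^bsub>G\<^esub> g) u = act U (\<one>\<^bsub>H\<^esub>, inv\<^bsub>G\<^esub> g') u'" using 5(3) vv by simp
    have "u' = act U (\<one>\<^bsub>H\<^esub>, g') (act U (\<one>\<^bsub>H\<^esub>, inv\<^bsub>G\<^esub> g') u')" using mem by simp
    also have "\<dots> = act U (\<one>\<^bsub>H\<^esub>, g' \<otimes>\<^bsub>G\<^esub> inv\<^bsub>G\<^esub> g) u" unfolding eq[symmetric] using mem by simp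
    finally have u': "u' = act U (\<one>\<^bsub>H\<^esub>, g' \<otimes>\<^bsub>G\<^esub> inv\<^bsub>G\<^esub> g) u" .
    show ?case
      by (rule bexI[of _ "g' \<otimes>\<^bsub>G\<^esub> inv\<^bsub>G\<^esub> g"])
        (use mem u' in \<open>simp_all add: vv A.H.m_assoc\<close>)
  next
    case (6 t)
    then show ?case
      by (intro exI[of _ t] exI[of _ "(\<one>\<^bsub>G\<^esub>, snd (anchor U t))"]) (simp add: m)
  qed (auto simp: m A.H.m_assoc A.H.inv_mult_group)
qed


section \<open>The category of spans is linear\<close>

lemma module_map_comp:
  "module_map R L M f \<Longrightarrow> module_map R M N g \<Longrightarrow> module_map R L N (\<lambda>x. g (f x))"
  by (auto simp: module_map_def Pi_iff)

lemma module_map_id: "module_map R M M (\<lambda>x. x)"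
  by (simp add: module_map_def)

abbreviation "over_sum_rel \<Gamma> \<equiv> (\<lambda>C A B. over_iso \<Gamma> C (over_sum A B))"

text \<open>Explicit spans, with points of any type, enter the modules in this form, through their
  copy on the natural numbers.\<close>

definition span_class ::
  "('r, 's) ring_scheme \<Rightarrow> 'k monoid \<Rightarrow> ('k, 'z) gset \<Rightarrow> ('k, 'u, 'z) over_gset \<Rightarrow>
    ('r \<times> ('k, nat, 'z) over_gset frag set) frag set"
  where "span_class R \<Gamma> Z S =
    groth.gen R (gsets_over \<Gamma> Z) (over_iso \<Gamma>) (over_sum_rel \<Gamma>) (over_copy \<Gamma> Z S)"

abbreviation "span_module R \<Gamma> Z \<equiv> tensor_module R (over_burnside \<Gamma> Z)"

context
  fixes R :: "('r, 's) ring_scheme"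
  assumes R: "cring R"
begin

lemma groth_R: "groth R"
  using R by (rule groth.intro)

lemma span_module: "Module.module R (span_module R \<Gamma> Z)"
  unfolding over_burnside_def over_burnside_rels_def
  by (rule groth.module[OF groth_R])

lemma over_copy_iso:
  assumes "gset_over \<Gamma> Z S" "gset_over \<Gamma> Z T" "over_iso \<Gamma> S T"
  shows "over_iso \<Gamma> (over_copy \<Gamma> Z S) (over_copy \<Gamma> Z T)"
  using over_copy[OF assms(1)] over_copy[OF assms(2)] assms
  by (meson gset_overD(1) over_iso_sym over_iso_trans)

lemma over_copy_sum:
  assumes "gset_over \<Gamma> Z S" "gset_over \<Gamma> Z A" "gset_over \<Gamma> Z B" "over_iso \<Gamma> S (over_sum A B)"
  shows "over_iso \<Gamma> (over_copy \<Gamma> Z S) (over_sum (over_copy \<Gamma> Z A) (over_copy \<Gamma> Z B))"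
proof -
  note S = over_copy[OF assms(1)] and A = over_copy[OF assms(2)] and B = over_copy[OF assms(3)]
  have "over_iso \<Gamma> (over_copy \<Gamma> Z S) S" by (rule over_iso_sym[OF gset_overD(1)[OF assms(1)] S(2)])
  then show ?thesis
    using assms(4) over_iso_sum[OF A(2) B(2)] by (meson over_iso_trans)
qed

lemma span_class_closed:
  "gset_over \<Gamma> Z S \<Longrightarrow> span_class R \<Gamma> Z S \<in> carrier (span_module R \<Gamma> Z)"
  unfolding span_class_def over_burnside_def over_burnside_rels_def
  by (rule groth.gen_closed[OF groth_R over_copy(1)])

lemma span_class_iso:
  assumes "gset_over \<Gamma> Z S" "gset_over \<Gamma> Z T" "over_iso \<Gamma> S T"
  shows "span_class R \<Gamma> Z S = span_class R \<Gamma> Z T"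
  unfolding span_class_def
  by (intro groth.gen_iso[OF groth_R] over_copy(1) over_copy_iso assms)

lemma span_class_sum:
  assumes "gset_over \<Gamma> Z S" "gset_over \<Gamma> Z A" "gset_over \<Gamma> Z B" "over_iso \<Gamma> S (over_sum A B)"
  shows "span_class R \<Gamma> Z S = span_class R \<Gamma> Z A \<oplus>\<^bsub>span_module R \<Gamma> Z\<^esub> span_class R \<Gamma> Z B"
  unfolding span_class_def over_burnside_def over_burnside_rels_def
  by (intro groth.gen_sum[OF groth_R] over_copy(1) over_copy_sum assms)

text \<open>The empty set is isomorphic to its disjoint union with itself, so its class is an
  additive idempotent.\<close>

lemma span_class_empty:
  assumes S: "gset_over \<Gamma> Z S" and "pts S = {}"
  shows "span_class R \<Gamma> Z S = \<zero>\<^bsub>span_module R \<Gamma> Z\<^esub>"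
proof -
  interpret Module.module R "span_module R \<Gamma> Z" by (rule span_module)
  have "over_iso \<Gamma> S (over_sum S S)"
    using assms(2) by (auto simp: over_iso_def gset_map_def over_sum_def bij_betw_def)
  from span_class_sum[OF S S S this] show ?thesis
    using span_class_closed[OF S] M.add.r_cancel_one by metis
qed

text \<open>A span on the natural numbers need not equal its chosen copy, but the two are
  isomorphic.\<close>

lemma gen_span_class:
  assumes "s \<in> gsets_over \<Gamma> Z"
  shows "groth.gen R (gsets_over \<Gamma> Z) (over_iso \<Gamma>) (over_sum_rel \<Gamma>) s = span_class R \<Gamma> Z s"
  unfolding span_class_def
  using assms over_copy[of \<Gamma> Z s] by (intro groth.gen_iso[OF groth_R]) (auto simp: gsets_over_def)

lemma span_map_eqI:
  assumes "Module.module R N" "module_map R (span_module R \<Gamma> Z) N f" "module_map R (span_module R \<Gamma> Z) N g"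
    and "\<And>S. S \<in> gsets_over \<Gamma> Z \<Longrightarrow> f (span_class R \<Gamma> Z S) = g (span_class R \<Gamma> Z S)"
    and A: "A \<in> carrier (span_module R \<Gamma> Z)"
  shows "f A = g A"
proof (rule groth.map_eqI[OF groth_R assms(1)])
  show "module_map R (tensor_module R (presented_group (gsets_over \<Gamma> Z)
      (groth_rels (gsets_over \<Gamma> Z) (over_iso \<Gamma>) (over_sum_rel \<Gamma>)))) N f"
    "module_map R (tensor_module R (presented_group (gsets_over \<Gamma> Z)
      (groth_rels (gsets_over \<Gamma> Z) (over_iso \<Gamma>) (over_sum_rel \<Gamma>)))) N g"
    "A \<in> carrier (tensor_module R (presented_group (gsets_over \<Gamma> Z)
      (groth_rels (gsets_over \<Gamma> Z) (over_iso \<Gamma>) (over_sum_rel \<Gamma>))))"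
    using assms unfolding over_burnside_def over_burnside_rels_def by simp_all
qed (simp add: gen_span_class assms(4))

text \<open>Congruence and distributivity of \<open>span_comp\<close> are what the general bilinear
  extension asks for. The value on classes of spans of arbitrary type is the rule for later
  computations; there the copies are exchanged for the originals by congruence.\<close>

lemma span_bilinear:
  fixes K :: "'k monoid" and H :: "'h monoid" and G :: "'g monoid"
  assumes Z: "finite_gset K Z" and Y: "finite_gset H Y" and X: "finite_gset G X"
  defines "c \<equiv> tensor_bilinear R (over_burnside (K \<times>\<times> G) (gset_prod Z X)) (span_bilinear K H G Z X)"
    and "M \<equiv> span_module R (K \<times>\<times> H) (gset_prod Z Y)" and "N \<equiv> span_module R (H \<times>\<times> G) (gset_prod Y X)"
    and "L \<equiv> span_module R (K \<times>\<times> G) (gset_prod Z X)"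
  shows "B \<in> carrier N \<Longrightarrow> module_map R M L (\<lambda>A. c A B)"
    and "A \<in> carrier M \<Longrightarrow> module_map R N L (c A)"
    and "gset_over (K \<times>\<times> H) (gset_prod Z Y) V \<Longrightarrow> gset_over (H \<times>\<times> G) (gset_prod Y X) U \<Longrightarrow>
      c (span_class R (K \<times>\<times> H) (gset_prod Z Y) V) (span_class R (H \<times>\<times> G) (gset_prod Y X) U) =
      span_class R (K \<times>\<times> G) (gset_prod Z X) (span_comp K H G V U)"
proof -
  note cI = composable.intro[OF Z Y X]
  note over = composable.span_comp_over[OF cI]
  let ?op = "\<lambda>V U. over_copy (K \<times>\<times> G) (gset_prod Z X) (span_comp K H G V U)"
  note sum = over_copy_sum
  note bil = groth_bilinear[where c = ?op and ?S1.0 = "gsets_over (K \<times>\<times> H) (gset_prod Z Y)"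
      and ?S2.0 = "gsets_over (H \<times>\<times> G) (gset_prod Y X)" and ?S3.0 = "gsets_over (K \<times>\<times> G) (gset_prod Z X)"
      and ?I1.0 = "over_iso (K \<times>\<times> H)" and ?I2.0 = "over_iso (H \<times>\<times> G)" and ?I3.0 = "over_iso (K \<times>\<times> G)"
      and ?D1.0 = "over_sum_rel (K \<times>\<times> H)" and ?D2.0 = "over_sum_rel (H \<times>\<times> G)" and ?D3.0 = "over_sum_rel (K \<times>\<times> G)",
      OF groth_R]
  have 1: "?op v u \<in> gsets_over (K \<times>\<times> G) (gset_prod Z X)"
    if "v \<in> gsets_over (K \<times>\<times> H) (gset_prod Z Y)" "u \<in> gsets_over (H \<times>\<times> G) (gset_prod Y X)" for v u
    using that unfolding gsets_over_def mem_Collect_eq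
    by (intro over over_copy(1)[unfolded gsets_over_def mem_Collect_eq])
  have 2: "over_iso (K \<times>\<times> G) (?op v u) (?op v' u)"
    if "v \<in> gsets_over (K \<times>\<times> H) (gset_prod Z Y)" "v' \<in> gsets_over (K \<times>\<times> H) (gset_prod Z Y)"
      "u \<in> gsets_over (H \<times>\<times> G) (gset_prod Y X)" "over_iso (K \<times>\<times> H) v v'" for v v' u
    using that by (intro over_copy_iso over span_comp_cong[OF cI cI] over_iso_refl) (auto simp: gsets_over_def)
  have 3: "over_iso (K \<times>\<times> G) (?op v u) (?op v u')"
    if "v \<in> gsets_over (K \<times>\<times> H) (gset_prod Z Y)" "u \<in> gsets_over (H \<times>\<times> G) (gset_prod Y X)"
      "u' \<in> gsets_over (H \<times>\<times> G) (gset_prod Y X)" "over_iso (H \<times>\<times> G) u u'" for v u u'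
    using that by (intro over_copy_iso over span_comp_cong[OF cI cI] over_iso_refl) (auto simp: gsets_over_def)
  have 4: "over_sum_rel (K \<times>\<times> G) (?op v u) (?op v1 u) (?op v2 u)"
    if "v \<in> gsets_over (K \<times>\<times> H) (gset_prod Z Y)" "v1 \<in> gsets_over (K \<times>\<times> H) (gset_prod Z Y)"
      "v2 \<in> gsets_over (K \<times>\<times> H) (gset_prod Z Y)" "u \<in> gsets_over (H \<times>\<times> G) (gset_prod Y X)"
      "over_sum_rel (K \<times>\<times> H) v v1 v2" for v v1 v2 u
    using that unfolding gsets_over_def mem_Collect_eq
    by (intro sum over over_iso_trans[OF span_comp_cong[OF cI cI] span_comp_sum_left[OF cI cI]]
        over_iso_refl gset_over_sum)
  have 5: "over_sum_rel (K \<times>\<times> G) (?op v u) (?op v u1) (?op v u2)"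
    if "v \<in> gsets_over (K \<times>\<times> H) (gset_prod Z Y)" "u \<in> gsets_over (H \<times>\<times> G) (gset_prod Y X)"
      "u1 \<in> gsets_over (H \<times>\<times> G) (gset_prod Y X)" "u2 \<in> gsets_over (H \<times>\<times> G) (gset_prod Y X)"
      "over_sum_rel (H \<times>\<times> G) u u1 u2" for v u u1 u2
    using that unfolding gsets_over_def mem_Collect_eq
    by (intro sum over over_iso_trans[OF span_comp_cong[OF cI cI] span_comp_sum_right[OF cI cI]]
        over_iso_refl gset_over_sum)
  note bil = bil[OF 1 2 3 4 5]
  \<comment> \<open>Definitional unfolding only: composition is brought to the form in which
    \<open>groth_bilinear\<close> states it.\<close>
  have c: "c = tensor_bilinear R (presented_group (gsets_over (K \<times>\<times> G) (gset_prod Z X))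
      (groth_rels (gsets_over (K \<times>\<times> G) (gset_prod Z X)) (over_iso (K \<times>\<times> G)) (over_sum_rel (K \<times>\<times> G))))
     (\<lambda>A B. presented_class (gsets_over (K \<times>\<times> G) (gset_prod Z X))
       (groth_rels (gsets_over (K \<times>\<times> G) (gset_prod Z X)) (over_iso (K \<times>\<times> G)) (over_sum_rel (K \<times>\<times> G)))
       (frag_bilinear (\<lambda>V U. frag_of (?op V U)) (coset_rep A) (coset_rep B)))"
    unfolding c_def over_burnside_def over_burnside_rels_def span_bilinear_def[abs_def] over_burnside_class_def
    by (rule refl)
  show "module_map R M L (\<lambda>A. c A B)" if "B \<in> carrier N"
    unfolding c M_def N_def L_def over_burnside_def over_burnside_rels_def
    by (rule bil(1); (assumption | rule that[unfolded N_def over_burnside_def over_burnside_rels_def]))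
  show "module_map R N L (c A)" if "A \<in> carrier M"
    unfolding c M_def N_def L_def over_burnside_def over_burnside_rels_def
    by (rule bil(2); (assumption | rule that[unfolded M_def over_burnside_def over_burnside_rels_def]))
  assume V: "gset_over (K \<times>\<times> H) (gset_prod Z Y) V" and U: "gset_over (H \<times>\<times> G) (gset_prod Y X) U"
  note VU' = over_copy(1)[OF V] over_copy(1)[OF U]
  have "c (span_class R (K \<times>\<times> H) (gset_prod Z Y) V) (span_class R (H \<times>\<times> G) (gset_prod Y X) U) =
    groth.gen R (gsets_over (K \<times>\<times> G) (gset_prod Z X)) (over_iso (K \<times>\<times> G)) (over_sum_rel (K \<times>\<times> G))
     (?op (over_copy (K \<times>\<times> H) (gset_prod Z Y) V) (over_copy (H \<times>\<times> G) (gset_prod Y X) U))"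
    unfolding span_class_def c by (rule bil(3); (assumption | rule VU'))
  also have "\<dots> = span_class R (K \<times>\<times> G) (gset_prod Z X)
      (span_comp K H G (over_copy (K \<times>\<times> H) (gset_prod Z Y) V) (over_copy (H \<times>\<times> G) (gset_prod Y X) U))"
    by (simp add: span_class_def)
  also have "\<dots> = span_class R (K \<times>\<times> G) (gset_prod Z X) (span_comp K H G V U)"
    using VU' unfolding gsets_over_def mem_Collect_eq
    by (intro span_class_iso[symmetric] over span_comp_cong[OF cI cI] over_copy(2) V U)
  finally show "c (span_class R (K \<times>\<times> H) (gset_prod Z Y) V) (span_class R (H \<times>\<times> G) (gset_prod Y X) U) =
      span_class R (K \<times>\<times> G) (gset_prod Z X) (span_comp K H G V U)" .
qed

lemma span_bilinear_closed:
  assumes "finite_gset K Z" "finite_gset H Y" "finite_gset G X"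
    "A \<in> carrier (span_module R (K \<times>\<times> H) (gset_prod Z Y))"
    "B \<in> carrier (span_module R (H \<times>\<times> G) (gset_prod Y X))"
  shows "tensor_bilinear R (over_burnside (K \<times>\<times> G) (gset_prod Z X)) (span_bilinear K H G Z X) A B \<in>
    carrier (span_module R (K \<times>\<times> G) (gset_prod Z X))"
  using span_bilinear(2)[OF assms(1-4)] assms(5) by (auto simp: module_map_def)

lemma span_category_simps:
  "(G, X) \<in> Obj (span_category R) \<longleftrightarrow> finite (carrier G) \<and> finite_gset G X"
  "Hom (span_category R) (G, X) (H, Y) = span_module R (H \<times>\<times> G) (gset_prod Y X)"
  "Comp (span_category R) (G, X) (H, Y) (K, Z) =
    tensor_bilinear R (over_burnside (K \<times>\<times> G) (gset_prod Z X)) (span_bilinear K H G Z X)"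
  "Ident (span_category R) (G, X) = span_class R (G \<times>\<times> G) (gset_prod X X) (span_ident G X)"
  using finite_gsetD(1)
  by (auto simp: span_category_def span_class_def groth.gen_def[OF groth_R] over_burnside_def
      over_burnside_class_def over_burnside_rels_def)

text \<open>Both sides of a unit law are linear in the arrow, and both sides of associativity are
  linear in each of three arrows. So the laws reduce to classes of spans, where the isomorphisms of
  the preceding sections apply.\<close>

lemma linear_span_category:
  "linear_category R (span_category R :: ('g monoid \<times> ('g, 'x) gset,
    ('r \<times> ('g \<times> 'g, nat, 'x \<times> 'x) over_gset frag set) frag set, 'r) lincat)"
  (is "linear_category R ?C")
  unfolding linear_category_def
proof (intro conjI ballI)
  fix X' Y' assume "X' \<in> Obj ?C" "Y' \<in> Obj ?C"
  then show "Module.module R (Hom ?C X' Y')"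
    by (cases X'; cases Y') (simp add: span_category_simps span_module)
next
  fix X' assume "X' \<in> Obj ?C"
  then show "Ident ?C X' \<in> carrier (Hom ?C X' X')"
    by (cases X') (simp add: span_category_simps span_class_closed span_ident_over)
next
  fix X' Y' Z' g assume "X' \<in> Obj ?C" "Y' \<in> Obj ?C" "Z' \<in> Obj ?C" "g \<in> carrier (Hom ?C Y' Z')"
  then show "module_map R (Hom ?C X' Y') (Hom ?C X' Z') (Comp ?C X' Y' Z' g)"
    by (cases X'; cases Y'; cases Z') (simp add: span_category_simps span_bilinear)
next
  fix X' Y' Z' f assume "X' \<in> Obj ?C" "Y' \<in> Obj ?C" "Z' \<in> Obj ?C" "f \<in> carrier (Hom ?C X' Y')"
  then show "module_map R (Hom ?C Y' Z') (Hom ?C X' Z') (\<lambda>g. Comp ?C X' Y' Z' g f)"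
    by (cases X'; cases Y'; cases Z') (simp add: span_category_simps span_bilinear)
next
  fix X' Y' f assume X': "X' \<in> Obj ?C" and Y': "Y' \<in> Obj ?C" and f: "f \<in> carrier (Hom ?C X' Y')"
  obtain G X H Y where XY: "X' = (G, X)" "Y' = (H, Y)" by (cases X'; cases Y')
  have X: "finite_gset G X" "finite (carrier G)" and Y: "finite_gset H Y" "finite (carrier H)"
    using X' Y' by (simp_all add: XY span_category_simps)
  note f = f[unfolded XY span_category_simps]
  have closed: "span_class R (H \<times>\<times> H) (gset_prod Y Y) (span_ident H Y) \<in> carrier (span_module R (H \<times>\<times> H) (gset_prod Y Y))"
    "span_class R (G \<times>\<times> G) (gset_prod X X) (span_ident G X) \<in> carrier (span_module R (G \<times>\<times> G) (gset_prod X X))"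
    by (intro span_class_closed span_ident_over X Y)+
  show "Comp ?C X' Y' Y' (Ident ?C Y') f = f"
    unfolding XY span_category_simps
  proof (rule span_map_eqI[OF span_module span_bilinear(2)[OF Y(1) Y(1) X(1) closed(1)] module_map_id _ f])
    fix U assume "U \<in> gsets_over (H \<times>\<times> G) (gset_prod Y X)"
    then have U: "gset_over (H \<times>\<times> G) (gset_prod Y X) U" by (simp add: gsets_over_def)
    have "composable H H G Y Y X (span_ident H Y) U"
      by (intro composable.intro X Y U span_ident_over)
    then show "tensor_bilinear R (over_burnside (H \<times>\<times> G) (gset_prod Y X)) (span_bilinear H H G Y X)
        (span_class R (H \<times>\<times> H) (gset_prod Y Y) (span_ident H Y)) (span_class R (H \<times>\<times> G) (gset_prod Y X) U) =
        span_class R (H \<times>\<times> G) (gset_prod Y X) U"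
      unfolding span_bilinear(3)[OF Y(1) Y(1) X(1) span_ident_over[OF Y] U]
      by (rule span_class_iso[OF composable.span_comp_over U span_ident_left[OF Y(1) Y(2) X(1) U]])
  qed
  show "Comp ?C X' X' Y' f (Ident ?C X') = f"
    unfolding XY span_category_simps
  proof (rule span_map_eqI[OF span_module span_bilinear(1)[OF Y(1) X(1) X(1) closed(2)] module_map_id _ f])
    fix U assume "U \<in> gsets_over (H \<times>\<times> G) (gset_prod Y X)"
    then have U: "gset_over (H \<times>\<times> G) (gset_prod Y X) U" by (simp add: gsets_over_def)
    have "composable H G G Y X X U (span_ident G X)"
      by (intro composable.intro X Y U span_ident_over)
    then show "tensor_bilinear R (over_burnside (H \<times>\<times> G) (gset_prod Y X)) (span_bilinear H G G Y X)
        (span_class R (H \<times>\<times> G) (gset_prod Y X) U) (span_class R (G \<times>\<times> G) (gset_prod X X) (span_ident G X)) =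
        span_class R (H \<times>\<times> G) (gset_prod Y X) U"
      unfolding span_bilinear(3)[OF Y(1) X(1) X(1) U span_ident_over[OF X]]
      by (rule span_class_iso[OF composable.span_comp_over U span_ident_right[OF Y(1) X(2) X(1) U]])
  qed
next
  fix W' X' Y' Z' f g h assume W': "W' \<in> Obj ?C" and X': "X' \<in> Obj ?C" and Y': "Y' \<in> Obj ?C" and Z': "Z' \<in> Obj ?C"
    and f: "f \<in> carrier (Hom ?C W' X')" and g: "g \<in> carrier (Hom ?C X' Y')" and h: "h \<in> carrier (Hom ?C Y' Z')"
  obtain F W G X H Y K Z where *: "W' = (F, W)" "X' = (G, X)" "Y' = (H, Y)" "Z' = (K, Z)"
    by (cases W'; cases X'; cases Y'; cases Z')
  have W: "finite_gset F W" and X: "finite_gset G X" and Y: "finite_gset H Y" and Z: "finite_gset K Z"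
    using W' X' Y' Z' by (simp_all add: * span_category_simps)
  let ?M = "\<lambda>H Y G X. span_module R (H \<times>\<times> G) (gset_prod Y X)"
  let ?c = "\<lambda>K H G Z X. tensor_bilinear R (over_burnside (K \<times>\<times> G) (gset_prod Z X)) (span_bilinear K H G Z X)"
  note f = f[unfolded * span_category_simps] and g = g[unfolded * span_category_simps]
    and h = h[unfolded * span_category_simps]
  note c1 = span_bilinear(1) and c2 = span_bilinear(2) and c3 = span_bilinear(3)
  note cI = composable.intro
  note cc = span_bilinear_closed
  let ?sc = "\<lambda>H Y G X. span_class R (H \<times>\<times> G) (gset_prod Y X)"
  \<comment> \<open>All three arguments are classes here. Linearity in one variable at a time frees
    \<open>h\<close> in \<open>2\<close>, \<open>g\<close> in \<open>3\<close>, and \<open>f\<close>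
    in the final step.\<close>
  have 1: "?c K H F Z W (?sc K Z H Y T) (?c H G F Y W (?sc H Y G X V) (?sc G X F W U)) =
      ?c K G F Z W (?c K H G Z X (?sc K Z H Y T) (?sc H Y G X V)) (?sc G X F W U)"
    if "T \<in> gsets_over (K \<times>\<times> H) (gset_prod Z Y)" "V \<in> gsets_over (H \<times>\<times> G) (gset_prod Y X)"
      "U \<in> gsets_over (G \<times>\<times> F) (gset_prod X W)" for T V U
  proof -
    have T: "gset_over (K \<times>\<times> H) (gset_prod Z Y) T" and V: "gset_over (H \<times>\<times> G) (gset_prod Y X) V"
      and U: "gset_over (G \<times>\<times> F) (gset_prod X W) U" using that by (simp_all add: gsets_over_def)
    have TV: "composable K H G Z Y X T V" and VU: "composable H G F Y X W V U"
      by (intro cI W X Y Z T V U)+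
    note tv = composable.span_comp_over[OF TV] and vu = composable.span_comp_over[OF VU]
    have "composable K H F Z Y W T (span_comp H G F V U)" "composable K G F Z X W (span_comp K H G T V) U"
      by (intro cI W X Y Z T U tv vu)+
    note over = this[THEN composable.span_comp_over]
    show ?thesis
      unfolding c3[OF Z Y X T V] c3[OF Y X W V U] c3[OF Z Y W T vu] c3[OF Z X W tv U]
      by (rule span_class_iso[OF over span_comp_assoc[OF TV VU]])
  qed
  have sc: "?sc H Y G X V \<in> carrier (?M H Y G X)" if "V \<in> gsets_over (H \<times>\<times> G) (gset_prod Y X)"
    for V :: "(_, nat, _) over_gset" and H :: "'g monoid" and G :: "'g monoid" and Y X :: "('g, 'x) gset"
    using that span_class_closed by (simp add: gsets_over_def)
  have 2: "?c K H F Z W h (?c H G F Y W (?sc H Y G X V) (?sc G X F W U)) =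
      ?c K G F Z W (?c K H G Z X h (?sc H Y G X V)) (?sc G X F W U)"
    if V: "V \<in> gsets_over (H \<times>\<times> G) (gset_prod Y X)" and U: "U \<in> gsets_over (G \<times>\<times> F) (gset_prod X W)" for V U
    by (rule span_map_eqI[where f = "\<lambda>h. ?c K H F Z W h (?c H G F Y W (?sc H Y G X V) (?sc G X F W U))"
          and g = "\<lambda>h. ?c K G F Z W (?c K H G Z X h (?sc H Y G X V)) (?sc G X F W U)",
          OF span_module c1[OF Z Y W cc[OF Y X W sc[OF V] sc[OF U]]]
            module_map_comp[OF c1[OF Z Y X sc[OF V]] c1[OF Z X W sc[OF U]]] _ h])
      (rule 1[OF _ V U])
  have 3: "?c K H F Z W h (?c H G F Y W g (?sc G X F W U)) = ?c K G F Z W (?c K H G Z X h g) (?sc G X F W U)"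
    if U: "U \<in> gsets_over (G \<times>\<times> F) (gset_prod X W)" for U
    by (rule span_map_eqI[where f = "\<lambda>g. ?c K H F Z W h (?c H G F Y W g (?sc G X F W U))"
          and g = "\<lambda>g. ?c K G F Z W (?c K H G Z X h g) (?sc G X F W U)",
          OF span_module module_map_comp[OF c1[OF Y X W sc[OF U]] c2[OF Z Y W h]]
            module_map_comp[OF c2[OF Z Y X h] c1[OF Z X W sc[OF U]]] _ g])
      (rule 2[OF _ U])
  show "Comp ?C W' Y' Z' h (Comp ?C W' X' Y' g f) = Comp ?C W' X' Z' (Comp ?C X' Y' Z' h g) f"
    unfolding * span_category_simps
    by (rule span_map_eqI[where f = "\<lambda>f. ?c K H F Z W h (?c H G F Y W g f)"
          and g = "?c K G F Z W (?c K H G Z X h g)",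
          OF span_module module_map_comp[OF c2[OF Y X W g] c2[OF Z Y W h]]
            c2[OF Z X W cc[OF Z Y X h g]] _ f])
      (rule 3)
qed

end

section \<open>The biset category as spans over a point\<close>

definition point_gset :: "'z \<Rightarrow> ('k, 'z) gset"
  where "point_gset p = \<lparr>pts = {p}, act = (\<lambda>g. restrict (\<lambda>z. z) {p})\<rparr>"

definition forget :: "('k, 'u, 'z) over_gset \<Rightarrow> ('k, 'u) gset"
  where "forget S = \<lparr>pts = pts S, act = act S\<rparr>"

definition anchored :: "'z \<Rightarrow> ('k, 'u) gset \<Rightarrow> ('k, 'u, 'z) over_gset"
  where "anchored p S = \<lparr>pts = pts S, act = act S, anchor = (\<lambda>_. p)\<rparr>"

lemma point_gset_simps: "pts (point_gset p) = {p}" "act (point_gset p) g p = p"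
  by (simp_all add: point_gset_def)

lemma forget_simps: "pts (forget S) = pts S" "act (forget S) = act S" "forget (anchored p T) = T"
  by (simp_all add: forget_def anchored_def)

lemma anchored_simps: "pts (anchored p S) = pts S" "act (anchored p S) = act S" "anchor (anchored p S) s = p"
  by (simp_all add: anchored_def)

lemma finite_gset_point: "group G \<Longrightarrow> finite_gset G (point_gset p)"
  by (rule finite_gsetI) (auto simp: point_gset_def)

text \<open>An equality and not only an isomorphism, so that arrows between objects over a point
  literally form the module over the one-point set at \<open>(p, q)\<close>.\<close>

lemma gset_prod_point: "gset_prod (point_gset p) (point_gset q) = point_gset (p, q)"
  by (auto simp: gset_prod_def point_gset_def restrict_def fun_eq_iff)

lemma gset_over_anchored: "finite_gset \<Gamma> S \<Longrightarrow> gset_over \<Gamma> (point_gset p) (anchored p S)"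
  using finite_gset_cong[of "anchored p S" S]
  by (auto simp: gset_over_def gset_map_def anchored_simps point_gset_simps)

lemma finite_gset_forget: "finite_gset \<Gamma> S \<Longrightarrow> finite_gset \<Gamma> (forget S)"
  by (simp add: finite_gset_def forget_simps)

text \<open>A constant anchor imposes no condition. With \<open>p = ()\<close> the facts about sets
  over a base specialise to sets with action.\<close>

lemma gset_iso_iff_over_iso: "gset_iso \<Gamma> S T \<longleftrightarrow> over_iso \<Gamma> (anchored p S) (anchored p T)"
  by (simp add: gset_iso_def over_iso_def gset_map_def anchored_simps)

lemma gset_iso_sum_iff:
  "gset_iso \<Gamma> C (gset_sum A B) \<longleftrightarrow> over_iso \<Gamma> (anchored p C) (over_sum (anchored p A) (anchored p B))"
  by (simp add: gset_iso_def over_iso_def gset_map_def anchored_simps gset_sum_def over_sum_def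
      Plus_def image_iff split: sum.splits)

lemma gset_iso_forget: "over_iso \<Gamma> S T \<Longrightarrow> gset_iso \<Gamma> (forget S) (forget T)"
  by (auto simp: gset_iso_def over_iso_def gset_map_def forget_simps)

lemma gset_iso_forget_sum:
  "over_iso \<Gamma> C (over_sum A B) \<Longrightarrow> gset_iso \<Gamma> (forget C) (gset_sum (forget A) (forget B))"
  by (simp add: gset_iso_def over_iso_def gset_map_def forget_simps gset_sum_def over_sum_def split del: if_split)
    blast

lemma over_iso_anchored_forget:
  "gset_over \<Gamma> (point_gset p) S \<Longrightarrow> over_iso \<Gamma> (anchored p (forget S)) S"
  unfolding over_iso_def gset_over_def gset_map_def
  by (intro exI[of _ id]) (auto simp: anchored_simps forget_simps point_gset_simps bij_betw_def)

lemma gset_iso_sym: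
  fixes S :: "('k, 'u) gset" and T :: "('k, 'v) gset"
  shows "finite_gset \<Gamma> S \<Longrightarrow> gset_iso \<Gamma> S T \<Longrightarrow> gset_iso \<Gamma> T S"
  unfolding gset_iso_iff_over_iso[where p = "()"]
  by (rule over_iso_sym[OF gset_overD(1)[OF gset_over_anchored]])

lemma gset_iso_trans:
  fixes S :: "('k, 'u) gset" and T :: "('k, 'v) gset" and U :: "('k, 'w) gset"
  shows "gset_iso \<Gamma> S T \<Longrightarrow> gset_iso \<Gamma> T U \<Longrightarrow> gset_iso \<Gamma> S U"
  unfolding gset_iso_iff_over_iso[where p = "()"] by (rule over_iso_trans)

text \<open>Anchoring at \<open>()\<close>, copying over that point and forgetting the anchor
  provides the witness for the Hilbert choice.\<close>

lemma gset_copy: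
  assumes S: "finite_gset \<Gamma> S"
  shows "gset_copy \<Gamma> S \<in> gsets \<Gamma>" "gset_iso \<Gamma> S (gset_copy \<Gamma> S)"
proof -
  note T = over_copy[OF gset_over_anchored[OF S, of "()"]]
  have "forget (over_copy \<Gamma> (point_gset ()) (anchored () S)) \<in> gsets \<Gamma> \<and>
    gset_iso \<Gamma> S (forget (over_copy \<Gamma> (point_gset ()) (anchored () S)))"
    using T(1) gset_iso_forget[OF T(2)]
    by (simp add: gsets_def gsets_over_def gset_over_def finite_gset_forget forget_simps)
  from someI[of "\<lambda>T. T \<in> gsets \<Gamma> \<and> gset_iso \<Gamma> S T", OF this]
  show "gset_copy \<Gamma> S \<in> gsets \<Gamma>" "gset_iso \<Gamma> S (gset_copy \<Gamma> S)"
    by (simp_all add: gset_copy_def)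
qed

lemma gset_copy_iso:
  assumes "finite_gset \<Gamma> S" "finite_gset \<Gamma> T" "gset_iso \<Gamma> S T"
  shows "gset_iso \<Gamma> (gset_copy \<Gamma> S) (gset_copy \<Gamma> T)"
  using gset_copy[OF assms(1)] gset_copy[OF assms(2)] assms by (meson gset_iso_sym gset_iso_trans)

lemma gset_copy_sum:
  assumes "finite_gset \<Gamma> S" "finite_gset \<Gamma> A" "finite_gset \<Gamma> B" "gset_iso \<Gamma> S (gset_sum A B)"
  shows "gset_iso \<Gamma> (gset_copy \<Gamma> S) (gset_sum (gset_copy \<Gamma> A) (gset_copy \<Gamma> B))"
proof -
  note copy = gset_copy(2)[unfolded gset_iso_iff_over_iso[where p = "()"]]
  have "over_iso \<Gamma> (anchored () (gset_copy \<Gamma> S)) (anchored () S)"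
    by (rule gset_iso_iff_over_iso[THEN iffD1, OF gset_iso_sym[OF assms(1) gset_copy(2)[OF assms(1)]]])
  then show ?thesis
    unfolding gset_iso_sum_iff[where p = "()"]
    using over_iso_sum[OF copy[OF assms(2)] copy[OF assms(3)]]
      gset_iso_sum_iff[where p = "()", THEN iffD1, OF assms(4)]
    by (meson over_iso_trans)
qed

text \<open>Over a point the middle legs always agree, so no pair is excluded and both constructions
  give the same set of orbits.\<close>

lemma biset_comp_eq:
  assumes V: "gset_over (K \<times>\<times> H) (gset_prod (point_gset p) (point_gset q)) V"
    and U: "gset_over (H \<times>\<times> G) (gset_prod (point_gset q) (point_gset r)) U"
  shows "forget (span_comp K H G V U) = biset_comp K H G (forget V) (forget U)"
proof -
  have "snd (anchor V v) = fst (anchor U u)" if "v \<in> pts V" "u \<in> pts U" for v u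
    using gset_overD(2)[OF V that(1)] gset_overD(2)[OF U that(2)] by (auto simp: gset_prod_simps point_gset_simps)
  then have "{bal_class K H G V U v u | v u. v \<in> pts V \<and> u \<in> pts U \<and> snd (anchor V v) = fst (anchor U u)} =
    {bal_class K H G V U v u | v u. v \<in> pts V \<and> u \<in> pts U}" by blast
  moreover have "bal_class K H G (forget V) (forget U) = bal_class K H G V U"
    "bal_act K H G (forget V) (forget U) = bal_act K H G V U"
    by (simp_all add: fun_eq_iff bal_class_def bal_act_def lmul_def rmul_def forget_simps)
  ultimately show ?thesis
    by (simp add: forget_def span_comp_def biset_comp_def Let_def)
qed

abbreviation "gset_sum_rel \<Gamma> \<equiv> (\<lambda>C A B. gset_iso \<Gamma> C (gset_sum A B))"

abbreviation "biset_module R \<Gamma> \<equiv> tensor_module R (burnside \<Gamma>)"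

definition biset_gen ::
  "('r, 's) ring_scheme \<Rightarrow> 'k monoid \<Rightarrow> ('k, nat) gset \<Rightarrow> ('r \<times> ('k, nat) gset frag set) frag set"
  where "biset_gen R \<Gamma> S = groth.gen R (gsets \<Gamma>) (gset_iso \<Gamma>) (gset_sum_rel \<Gamma>) S"

context
  fixes R :: "('r, 's) ring_scheme"
  assumes R: "cring R"
begin

lemma biset_module: "Module.module R (biset_module R \<Gamma>)"
  unfolding burnside_def burnside_rels_def by (rule groth.module[OF groth_R[OF R]])

lemma biset_gen_iso:
  "S \<in> gsets \<Gamma> \<Longrightarrow> T \<in> gsets \<Gamma> \<Longrightarrow> gset_iso \<Gamma> S T \<Longrightarrow> biset_gen R \<Gamma> S = biset_gen R \<Gamma> T"
  unfolding biset_gen_def by (rule groth.gen_iso[OF groth_R[OF R]])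

lemma biset_map_eqI:
  assumes "Module.module R N" "module_map R (biset_module R \<Gamma>) N f" "module_map R (biset_module R \<Gamma>) N g"
    and "\<And>S. S \<in> gsets \<Gamma> \<Longrightarrow> f (biset_gen R \<Gamma> S) = g (biset_gen R \<Gamma> S)"
    and A: "A \<in> carrier (biset_module R \<Gamma>)"
  shows "f A = g A"
proof (rule groth.map_eqI[OF groth_R[OF R] assms(1)])
  show "module_map R (tensor_module R (presented_group (gsets \<Gamma>)
      (groth_rels (gsets \<Gamma>) (gset_iso \<Gamma>) (gset_sum_rel \<Gamma>)))) N f"
    "module_map R (tensor_module R (presented_group (gsets \<Gamma>)
      (groth_rels (gsets \<Gamma>) (gset_iso \<Gamma>) (gset_sum_rel \<Gamma>)))) N g"
    "A \<in> carrier (tensor_module R (presented_group (gsets \<Gamma>)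
      (groth_rels (gsets \<Gamma>) (gset_iso \<Gamma>) (gset_sum_rel \<Gamma>))))"
    using assms unfolding burnside_def burnside_rels_def by simp_all
qed (use assms(4) in \<open>simp add: biset_gen_def\<close>)

text \<open>Bisets are read as spans between one-point sets of type \<open>unit\<close>. Finiteness,
  and below also congruence and distributivity, are thereby inherited from
  \<open>span_comp\<close>.\<close>

lemma biset_comp_finite:
  fixes V :: "('k \<times> 'h, 'v) gset" and U :: "('h \<times> 'g, 'u) gset"
  assumes "group K" "group H" "group G" "finite_gset (K \<times>\<times> H) V" "finite_gset (H \<times>\<times> G) U"
  shows "finite_gset (K \<times>\<times> G) (biset_comp K H G V U)"
    and "composable K H G (point_gset ()) (point_gset ()) (point_gset ()) (anchored ((), ()) V) (anchored ((), ()) U)"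
    and "biset_comp K H G V U = forget (span_comp K H G (anchored ((), ()) V) (anchored ((), ()) U))"
proof -
  have over: "gset_over (K \<times>\<times> H) (gset_prod (point_gset ()) (point_gset ())) (anchored ((), ()) V)"
    "gset_over (H \<times>\<times> G) (gset_prod (point_gset ()) (point_gset ())) (anchored ((), ()) U)"
    unfolding gset_prod_point by (intro gset_over_anchored assms)+
  show c: "composable K H G (point_gset ()) (point_gset ()) (point_gset ()) (anchored ((), ()) V) (anchored ((), ()) U)"
    by (intro composable.intro finite_gset_point assms over)
  show eq: "biset_comp K H G V U = forget (span_comp K H G (anchored ((), ()) V) (anchored ((), ()) U))"
    using biset_comp_eq[OF over] by (simp add: forget_simps)
  show "finite_gset (K \<times>\<times> G) (biset_comp K H G V U)"
    unfolding eq by (intro finite_gset_forget gset_overD(1)[OF composable.span_comp_over[OF c]])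
qed

lemma biset_bilinear:
  fixes K :: "'k monoid" and H :: "'h monoid" and G :: "'g monoid"
  assumes K: "group K" and H: "group H" and G: "group G"
  defines "c \<equiv> tensor_bilinear R (burnside (K \<times>\<times> G)) (biset_bilinear K H G)"
    and "M \<equiv> biset_module R (K \<times>\<times> H)" and "N \<equiv> biset_module R (H \<times>\<times> G)"
    and "L \<equiv> biset_module R (K \<times>\<times> G)"
  shows "B \<in> carrier N \<Longrightarrow> module_map R M L (\<lambda>A. c A B)"
    and "A \<in> carrier M \<Longrightarrow> module_map R N L (c A)"
    and "V \<in> gsets (K \<times>\<times> H) \<Longrightarrow> U \<in> gsets (H \<times>\<times> G) \<Longrightarrow>
      c (biset_gen R (K \<times>\<times> H) V) (biset_gen R (H \<times>\<times> G) U) =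
      biset_gen R (K \<times>\<times> G) (gset_copy (K \<times>\<times> G) (biset_comp K H G V U))"
proof -
  note fin = biset_comp_finite[OF K H G]
  let ?op = "\<lambda>V U. gset_copy (K \<times>\<times> G) (biset_comp K H G V U)"
  note bil = groth_bilinear[where c = ?op and ?S1.0 = "gsets (K \<times>\<times> H)"
      and ?S2.0 = "gsets (H \<times>\<times> G)" and ?S3.0 = "gsets (K \<times>\<times> G)"
      and ?I1.0 = "gset_iso (K \<times>\<times> H)" and ?I2.0 = "gset_iso (H \<times>\<times> G)" and ?I3.0 = "gset_iso (K \<times>\<times> G)"
      and ?D1.0 = "gset_sum_rel (K \<times>\<times> H)" and ?D2.0 = "gset_sum_rel (H \<times>\<times> G)" and ?D3.0 = "gset_sum_rel (K \<times>\<times> G)",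
      OF groth_R[OF R]]
  have 1: "?op v u \<in> gsets (K \<times>\<times> G)" if "v \<in> gsets (K \<times>\<times> H)" "u \<in> gsets (H \<times>\<times> G)" for v u
    using that unfolding gsets_def mem_Collect_eq
    by (intro fin(1) gset_copy(1)[unfolded gsets_def mem_Collect_eq])
  have 2: "gset_iso (K \<times>\<times> G) (?op v u) (?op v' u)"
    if "v \<in> gsets (K \<times>\<times> H)" "v' \<in> gsets (K \<times>\<times> H)" "u \<in> gsets (H \<times>\<times> G)" "gset_iso (K \<times>\<times> H) v v'" for v v' u
  proof -
    have v: "finite_gset (K \<times>\<times> H) v" "finite_gset (K \<times>\<times> H) v'" "finite_gset (H \<times>\<times> G) u"
      using that by (simp_all add: gsets_def)
    show ?thesis
      by (rule gset_copy_iso[OF fin(1)[OF v(1,3)] fin(1)[OF v(2,3)]], unfold fin(3)[OF v(1,3)] fin(3)[OF v(2,3)])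
        (intro gset_iso_forget span_comp_cong[OF fin(2)[OF v(1,3)] fin(2)[OF v(2,3)]] over_iso_refl
          gset_iso_iff_over_iso[THEN iffD1] that(4))
  qed
  have 3: "gset_iso (K \<times>\<times> G) (?op v u) (?op v u')"
    if "v \<in> gsets (K \<times>\<times> H)" "u \<in> gsets (H \<times>\<times> G)" "u' \<in> gsets (H \<times>\<times> G)" "gset_iso (H \<times>\<times> G) u u'" for v u u'
  proof -
    have v: "finite_gset (K \<times>\<times> H) v" "finite_gset (H \<times>\<times> G) u" "finite_gset (H \<times>\<times> G) u'"
      using that by (simp_all add: gsets_def)
    show ?thesis
      by (rule gset_copy_iso[OF fin(1)[OF v(1,2)] fin(1)[OF v(1,3)]], unfold fin(3)[OF v(1,2)] fin(3)[OF v(1,3)])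
        (intro gset_iso_forget span_comp_cong[OF fin(2)[OF v(1,2)] fin(2)[OF v(1,3)]] over_iso_refl
          gset_iso_iff_over_iso[THEN iffD1] that(4))
  qed
  have 4: "gset_sum_rel (K \<times>\<times> G) (?op v u) (?op v1 u) (?op v2 u)"
    if "v \<in> gsets (K \<times>\<times> H)" "v1 \<in> gsets (K \<times>\<times> H)" "v2 \<in> gsets (K \<times>\<times> H)" "u \<in> gsets (H \<times>\<times> G)"
      "gset_sum_rel (K \<times>\<times> H) v v1 v2" for v v1 v2 u
  proof -
    have v: "finite_gset (K \<times>\<times> H) v" "finite_gset (K \<times>\<times> H) v1" "finite_gset (K \<times>\<times> H) v2" "finite_gset (H \<times>\<times> G) u"
      using that by (simp_all add: gsets_def)
    note c = fin(2)[OF v(1,4)] fin(2)[OF v(2,4)] fin(2)[OF v(3,4)]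
    have s: "composable K H G (point_gset ()) (point_gset ()) (point_gset ())
        (over_sum (anchored ((), ()) v1) (anchored ((), ()) v2)) (anchored ((), ()) u)"
      using c by (auto simp: composable_def intro: gset_over_sum)
    have "over_iso (K \<times>\<times> H) (anchored ((), ()) v) (over_sum (anchored ((), ()) v1) (anchored ((), ()) v2))"
      by (rule gset_iso_sum_iff[THEN iffD1, OF that(5)])
    from over_iso_trans[OF span_comp_cong[OF c(1) s this over_iso_refl] span_comp_sum_left[OF c(2,3)]]
    show ?thesis
      by (intro gset_copy_sum fin(1) v) (simp add: fin(3)[OF v(1,4)] fin(3)[OF v(2,4)] fin(3)[OF v(3,4)] gset_iso_forget_sum)
  qed
  have 5: "gset_sum_rel (K \<times>\<times> G) (?op v u) (?op v u1) (?op v u2)"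
    if "v \<in> gsets (K \<times>\<times> H)" "u \<in> gsets (H \<times>\<times> G)" "u1 \<in> gsets (H \<times>\<times> G)" "u2 \<in> gsets (H \<times>\<times> G)"
      "gset_sum_rel (H \<times>\<times> G) u u1 u2" for v u u1 u2
  proof -
    have v: "finite_gset (K \<times>\<times> H) v" "finite_gset (H \<times>\<times> G) u" "finite_gset (H \<times>\<times> G) u1" "finite_gset (H \<times>\<times> G) u2"
      using that by (simp_all add: gsets_def)
    note c = fin(2)[OF v(1,2)] fin(2)[OF v(1,3)] fin(2)[OF v(1,4)]
    have s: "composable K H G (point_gset ()) (point_gset ()) (point_gset ()) (anchored ((), ()) v)
        (over_sum (anchored ((), ()) u1) (anchored ((), ()) u2))"
      using c by (auto simp: composable_def intro: gset_over_sum)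
    have "over_iso (H \<times>\<times> G) (anchored ((), ()) u) (over_sum (anchored ((), ()) u1) (anchored ((), ()) u2))"
      by (rule gset_iso_sum_iff[THEN iffD1, OF that(5)])
    from over_iso_trans[OF span_comp_cong[OF c(1) s over_iso_refl this] span_comp_sum_right[OF c(2,3)]]
    show ?thesis
      by (intro gset_copy_sum fin(1) v) (simp add: fin(3)[OF v(1,2)] fin(3)[OF v(1,3)] fin(3)[OF v(1,4)] gset_iso_forget_sum)
  qed
  note bil = bil[OF 1 2 3 4 5]
  have c: "c = tensor_bilinear R (presented_group (gsets (K \<times>\<times> G))
      (groth_rels (gsets (K \<times>\<times> G)) (gset_iso (K \<times>\<times> G)) (gset_sum_rel (K \<times>\<times> G))))
     (\<lambda>A B. presented_class (gsets (K \<times>\<times> G))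
       (groth_rels (gsets (K \<times>\<times> G)) (gset_iso (K \<times>\<times> G)) (gset_sum_rel (K \<times>\<times> G)))
       (frag_bilinear (\<lambda>V U. frag_of (?op V U)) (coset_rep A) (coset_rep B)))"
    unfolding c_def burnside_def burnside_rels_def biset_bilinear_def[abs_def] burnside_class_def
    by (rule refl)
  show "module_map R M L (\<lambda>A. c A B)" if "B \<in> carrier N"
    unfolding c M_def N_def L_def burnside_def burnside_rels_def
    by (rule bil(1); (assumption | rule that[unfolded N_def burnside_def burnside_rels_def]))
  show "module_map R N L (c A)" if "A \<in> carrier M"
    unfolding c M_def N_def L_def burnside_def burnside_rels_def
    by (rule bil(2); (assumption | rule that[unfolded M_def burnside_def burnside_rels_def]))
  assume VU: "V \<in> gsets (K \<times>\<times> H)" "U \<in> gsets (H \<times>\<times> G)"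
  show "c (biset_gen R (K \<times>\<times> H) V) (biset_gen R (H \<times>\<times> G) U) = biset_gen R (K \<times>\<times> G) (?op V U)"
    unfolding biset_gen_def c by (rule bil(3); (assumption | rule VU))
qed

lemma biset_category_simps:
  "G \<in> Obj (biset_category R) \<longleftrightarrow> group G \<and> finite (carrier G)"
  "Hom (biset_category R) G H = biset_module R (H \<times>\<times> G)"
  "Comp (biset_category R) G H K = tensor_bilinear R (burnside (K \<times>\<times> G)) (biset_bilinear K H G)"
  "Ident (biset_category R) G = biset_gen R (G \<times>\<times> G) (gset_copy (G \<times>\<times> G) (biset_ident G))"
  by (auto simp: biset_category_def biset_gen_def groth.gen_def[OF groth_R[OF R]] burnside_def
      burnside_class_def burnside_rels_def)

text \<open>The properties in the choice determine the map on the module, since classes generate it;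
  existence comes from \<open>groth_linear\<close>.\<close>

definition forget_map ::
  "'k monoid \<Rightarrow> 'z \<Rightarrow> ('r \<times> ('k, nat, 'z) over_gset frag set) frag set \<Rightarrow> ('r \<times> ('k, nat) gset frag set) frag set"
  where "forget_map \<Gamma> p = (SOME \<Psi>. module_map R (span_module R \<Gamma> (point_gset p)) (biset_module R \<Gamma>) \<Psi> \<and>
    (\<forall>S \<in> gsets_over \<Gamma> (point_gset p). \<Psi> (span_class R \<Gamma> (point_gset p) S) = biset_gen R \<Gamma> (forget S)))"

lemma forget_map:
  "module_map R (span_module R \<Gamma> (point_gset p)) (biset_module R \<Gamma>) (forget_map \<Gamma> p)"
  "S \<in> gsets_over \<Gamma> (point_gset p) \<Longrightarrow>
    forget_map \<Gamma> p (span_class R \<Gamma> (point_gset p) S) = biset_gen R \<Gamma> (forget S)"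
proof -
  have "\<exists>\<Psi>. module_map R (span_module R \<Gamma> (point_gset p)) (biset_module R \<Gamma>) \<Psi> \<and>
      (\<forall>S \<in> gsets_over \<Gamma> (point_gset p).
        \<Psi> (groth.gen R (gsets_over \<Gamma> (point_gset p)) (over_iso \<Gamma>) (over_sum_rel \<Gamma>) S) = biset_gen R \<Gamma> (forget S))"
    unfolding over_burnside_def over_burnside_rels_def burnside_def burnside_rels_def biset_gen_def
    by (rule groth_linear[OF groth_R[OF R]])
      (auto simp: gsets_over_def gsets_def gset_over_def intro: finite_gset_forget gset_iso_forget gset_iso_forget_sum)
  then have "\<exists>\<Psi>. module_map R (span_module R \<Gamma> (point_gset p)) (biset_module R \<Gamma>) \<Psi> \<and>
      (\<forall>S \<in> gsets_over \<Gamma> (point_gset p). \<Psi> (span_class R \<Gamma> (point_gset p) S) = biset_gen R \<Gamma> (forget S))"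
    by (simp add: gen_span_class[OF R] cong: ball_cong)
  from someI_ex[OF this]
  show "module_map R (span_module R \<Gamma> (point_gset p)) (biset_module R \<Gamma>) (forget_map \<Gamma> p)"
    "S \<in> gsets_over \<Gamma> (point_gset p) \<Longrightarrow>
      forget_map \<Gamma> p (span_class R \<Gamma> (point_gset p) S) = biset_gen R \<Gamma> (forget S)"
    unfolding forget_map_def[symmetric] by blast+
qed

text \<open>With points of arbitrary type the forgotten set is not a generator and has to be copied.
  Copying before forgetting and copying after it give isomorphic sets.\<close>

lemma forget_map_any:
  assumes S: "gset_over \<Gamma> (point_gset p) S"
  shows "forget_map \<Gamma> p (span_class R \<Gamma> (point_gset p) S) = biset_gen R \<Gamma> (gset_copy \<Gamma> (forget S))"
proof -
  note T = over_copy[OF S]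
  have T': "gset_over \<Gamma> (point_gset p) (over_copy \<Gamma> (point_gset p) S)" using T(1) by (simp add: gsets_over_def)
  have fin: "finite_gset \<Gamma> (forget S)" by (intro finite_gset_forget gset_overD(1)[OF S])
  have "span_class R \<Gamma> (point_gset p) S = span_class R \<Gamma> (point_gset p) (over_copy \<Gamma> (point_gset p) S)"
    by (rule span_class_iso[OF R S T' T(2)])
  then have "forget_map \<Gamma> p (span_class R \<Gamma> (point_gset p) S) = biset_gen R \<Gamma> (forget (over_copy \<Gamma> (point_gset p) S))"
    using forget_map(2)[OF T(1)] by simp
  also have "\<dots> = biset_gen R \<Gamma> (gset_copy \<Gamma> (forget S))"
  proof (rule biset_gen_iso[OF _ gset_copy(1)[OF fin]])
    show "forget (over_copy \<Gamma> (point_gset p) S) \<in> gsets \<Gamma>"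
      using gset_overD(1)[OF T'] by (simp add: gsets_def finite_gset_forget)
    show "gset_iso \<Gamma> (forget (over_copy \<Gamma> (point_gset p) S)) (gset_copy \<Gamma> (forget S))"
      using gset_iso_sym[OF fin gset_iso_forget[OF T(2)]] gset_copy(2)[OF fin] by (rule gset_iso_trans)
  qed
  finally show ?thesis .
qed

text \<open>The inverse is induced by anchoring all points at \<open>p\<close>. Forgetting undoes
  anchoring exactly; anchoring undoes forgetting up to isomorphism, as all anchors over the point
  are \<open>p\<close> already.\<close>

lemma forget_map_bij:
  "bij_betw (forget_map \<Gamma> p) (carrier (span_module R \<Gamma> (point_gset p))) (carrier (biset_module R \<Gamma>))"
proof -
  have "\<exists>\<Phi>. module_map R (biset_module R \<Gamma>) (span_module R \<Gamma> (point_gset p)) \<Phi> \<and>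
      (\<forall>S \<in> gsets \<Gamma>. \<Phi> (groth.gen R (gsets \<Gamma>) (gset_iso \<Gamma>) (gset_sum_rel \<Gamma>) S) =
        groth.gen R (gsets_over \<Gamma> (point_gset p)) (over_iso \<Gamma>) (over_sum_rel \<Gamma>) (anchored p S))"
    unfolding over_burnside_def over_burnside_rels_def burnside_def burnside_rels_def
    by (rule groth_linear[OF groth_R[OF R]])
      (auto simp: gsets_over_def gsets_def intro: gset_over_anchored
        gset_iso_iff_over_iso[THEN iffD1] gset_iso_sum_iff[THEN iffD1])
  then obtain \<Phi> where \<Phi>: "module_map R (biset_module R \<Gamma>) (span_module R \<Gamma> (point_gset p)) \<Phi>"
    "\<And>S. S \<in> gsets \<Gamma> \<Longrightarrow> \<Phi> (biset_gen R \<Gamma> S) = groth.gen R (gsets_over \<Gamma> (point_gset p)) (over_iso \<Gamma>) (over_sum_rel \<Gamma>) (anchored p S)"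
    unfolding biset_gen_def by blast
  have anch: "anchored p S \<in> gsets_over \<Gamma> (point_gset p)" if "S \<in> gsets \<Gamma>" for S
    using that gset_over_anchored by (auto simp: gsets_def gsets_over_def)
  have \<Phi>_gen: "\<Phi> (biset_gen R \<Gamma> S) = span_class R \<Gamma> (point_gset p) (anchored p S)" if "S \<in> gsets \<Gamma>" for S
    using \<Phi>(2)[OF that] gen_span_class[OF R anch[OF that]] by simp
  have 1: "\<Phi> (forget_map \<Gamma> p A) = A" if "A \<in> carrier (span_module R \<Gamma> (point_gset p))" for A
  proof (rule span_map_eqI[OF R span_module[OF R] module_map_comp[OF forget_map(1) \<Phi>(1)] module_map_id _ that])
    fix S assume S: "S \<in> gsets_over \<Gamma> (point_gset p)"
    then have S': "gset_over \<Gamma> (point_gset p) S" "forget S \<in> gsets \<Gamma>"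
      by (auto simp: gsets_over_def gsets_def gset_over_def finite_gset_forget)
    show "\<Phi> (forget_map \<Gamma> p (span_class R \<Gamma> (point_gset p) S)) = span_class R \<Gamma> (point_gset p) S"
      unfolding forget_map(2)[OF S] \<Phi>_gen[OF S'(2)]
      using anch[OF S'(2)] by (intro span_class_iso[OF R] S' over_iso_anchored_forget) (auto simp: gsets_over_def)
  qed
  have 2: "forget_map \<Gamma> p (\<Phi> A) = A" if "A \<in> carrier (biset_module R \<Gamma>)" for A
  proof (rule biset_map_eqI[OF biset_module module_map_comp[OF \<Phi>(1) forget_map(1)] module_map_id _ that])
    fix S assume "S \<in> gsets \<Gamma>"
    then show "forget_map \<Gamma> p (\<Phi> (biset_gen R \<Gamma> S)) = biset_gen R \<Gamma> S"
      using forget_map(2)[OF anch] by (simp add: \<Phi>_gen forget_simps)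
  qed
  show ?thesis
    using 1 2 \<Phi>(1) forget_map(1)[of \<Gamma> p]
    by (intro bij_betw_byWitness[where f' = \<Phi>]) (auto simp: module_map_def)
qed

text \<open>Both sides are bilinear in \<open>g\<close> and \<open>f\<close>, so it is enough to
  compare them on classes, where composition of spans over points is composition of bisets by
  \<open>biset_comp_eq\<close>.\<close>

lemma forget_map_comp:
  assumes K: "group K" and H: "group H" and G: "group G"
    and g: "g \<in> carrier (span_module R (K \<times>\<times> H) (point_gset (p, p)))"
    and f: "f \<in> carrier (span_module R (H \<times>\<times> G) (point_gset (p, p)))"
  shows "forget_map (K \<times>\<times> G) (p, p) (tensor_bilinear R (over_burnside (K \<times>\<times> G) (point_gset (p, p)))
      (span_bilinear K H G (point_gset p) (point_gset p)) g f) =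
    tensor_bilinear R (burnside (K \<times>\<times> G)) (biset_bilinear K H G)
      (forget_map (K \<times>\<times> H) (p, p) g) (forget_map (H \<times>\<times> G) (p, p) f)"
proof -
  note pt = finite_gset_point[OF K, of p] finite_gset_point[OF H, of p] finite_gset_point[OF G, of p]
  note sb = span_bilinear[OF R pt, unfolded gset_prod_point]
  note bb = biset_bilinear[OF K H G]
  note fm = forget_map(1)
  let ?s = "tensor_bilinear R (over_burnside (K \<times>\<times> G) (point_gset (p, p))) (span_bilinear K H G (point_gset p) (point_gset p))"
  let ?b = "tensor_bilinear R (burnside (K \<times>\<times> G)) (biset_bilinear K H G)"
  have 1: "forget_map (K \<times>\<times> G) (p, p) (?s (span_class R (K \<times>\<times> H) (point_gset (p, p)) V)
        (span_class R (H \<times>\<times> G) (point_gset (p, p)) U)) =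
      ?b (forget_map (K \<times>\<times> H) (p, p) (span_class R (K \<times>\<times> H) (point_gset (p, p)) V))
        (forget_map (H \<times>\<times> G) (p, p) (span_class R (H \<times>\<times> G) (point_gset (p, p)) U))"
    if V: "V \<in> gsets_over (K \<times>\<times> H) (point_gset (p, p))" and U: "U \<in> gsets_over (H \<times>\<times> G) (point_gset (p, p))" for V U
  proof -
    have V': "gset_over (K \<times>\<times> H) (point_gset (p, p)) V" and U': "gset_over (H \<times>\<times> G) (point_gset (p, p)) U"
      using V U by (simp_all add: gsets_over_def)
    have vu: "forget V \<in> gsets (K \<times>\<times> H)" "forget U \<in> gsets (H \<times>\<times> G)"
      using gset_overD(1)[OF V'] gset_overD(1)[OF U'] by (simp_all add: gsets_def finite_gset_forget)
    have "composable K H G (point_gset p) (point_gset p) (point_gset p) V U"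
      by (intro composable.intro pt; unfold gset_prod_point; intro V' U')
    note over = composable.span_comp_over[OF this, unfolded gset_prod_point]
    show ?thesis
      unfolding sb(3)[OF V' U'] forget_map(2)[OF V] forget_map(2)[OF U] bb(3)[OF vu] forget_map_any[OF over]
      using biset_comp_eq[of K H p p V G p U] V' U' by (simp add: gset_prod_point)
  qed
  note sc1 = span_class_closed[OF R gsets_over_def[THEN equalityD1, THEN subsetD, THEN CollectD]]
  note cl1 = fm[unfolded module_map_def, THEN conjunct1, THEN funcset_mem]
  have 2: "forget_map (K \<times>\<times> G) (p, p) (?s g (span_class R (H \<times>\<times> G) (point_gset (p, p)) U)) =
      ?b (forget_map (K \<times>\<times> H) (p, p) g) (forget_map (H \<times>\<times> G) (p, p) (span_class R (H \<times>\<times> G) (point_gset (p, p)) U))"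
    if U: "U \<in> gsets_over (H \<times>\<times> G) (point_gset (p, p))" for U
    by (rule span_map_eqI[where f = "\<lambda>g. forget_map (K \<times>\<times> G) (p, p) (?s g (span_class R (H \<times>\<times> G) (point_gset (p, p)) U))"
          and g = "\<lambda>g. ?b (forget_map (K \<times>\<times> H) (p, p) g) (forget_map (H \<times>\<times> G) (p, p) (span_class R (H \<times>\<times> G) (point_gset (p, p)) U))",
          OF R biset_module module_map_comp[OF sb(1)[OF sc1[OF U]] fm]
            module_map_comp[OF fm bb(1)[OF cl1[OF sc1[OF U]]]] _ g])
      (rule 1[OF _ U])
  show ?thesis
    by (rule span_map_eqI[where f = "\<lambda>f. forget_map (K \<times>\<times> G) (p, p) (?s g f)"
          and g = "\<lambda>f. ?b (forget_map (K \<times>\<times> H) (p, p) g) (forget_map (H \<times>\<times> G) (p, p) f)",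
          OF R biset_module module_map_comp[OF sb(2)[OF g] fm]
            module_map_comp[OF fm bb(2)[OF cl1[OF g]]] _ f])
      (rule 2)
qed

text \<open>Over a point the second coordinate of the identity span is constant, so
  \<open>fst\<close> is an isomorphism onto the identity biset.\<close>

lemma forget_map_ident:
  assumes G: "group G" and fin: "finite (carrier G)"
  shows "forget_map (G \<times>\<times> G) (p, p) (span_class R (G \<times>\<times> G) (point_gset (p, p)) (span_ident G (point_gset p))) =
    biset_gen R (G \<times>\<times> G) (gset_copy (G \<times>\<times> G) (biset_ident G))"
proof -
  interpret G: group G by fact
  note pt = finite_gset_point[OF G, of p]
  note over = span_ident_over[OF pt fin, unfolded gset_prod_point]
  have bi: "finite_gset (G \<times>\<times> G) (biset_ident G)"
    by (rule finite_gsetI)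
      (auto simp: biset_ident_def DirProd_group G fin G.m_assoc G.inv_mult_group split: prod.splits)
  have iso: "gset_iso (G \<times>\<times> G) (forget (span_ident G (point_gset p))) (biset_ident G)"
    unfolding gset_iso_def gset_map_def
    by (intro exI[of _ fst])
      (auto simp: forget_simps span_ident_simps point_gset_simps biset_ident_def bij_betw_def inj_on_def image_iff)
  have fs: "finite_gset (G \<times>\<times> G) (forget (span_ident G (point_gset p)))"
    by (intro finite_gset_forget gset_overD(1)[OF over])
  show ?thesis
    unfolding forget_map_any[OF over]
    by (rule biset_gen_iso[OF gset_copy(1)[OF fs] gset_copy(1)[OF bi] gset_copy_iso[OF fs bi iso]])
qed

end


section \<open>Decomposing objects into orbits\<close>

definition over_restrict :: "('k, 'u, 'z) over_gset \<Rightarrow> 'u set \<Rightarrow> ('k, 'u, 'z) over_gset"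
  where "over_restrict S B = \<lparr>pts = B, act = (\<lambda>g. restrict (act S g) B), anchor = anchor S\<rparr>"

lemma over_restrict_simps:
  "pts (over_restrict S B) = B" "s \<in> B \<Longrightarrow> act (over_restrict S B) g s = act S g s"
  "anchor (over_restrict S B) = anchor S"
  by (simp_all add: over_restrict_def)

lemma gset_over_restrict:
  assumes S: "gset_over \<Gamma> Z S" and B: "B \<subseteq> pts S"
    and inv: "\<And>g s. g \<in> carrier \<Gamma> \<Longrightarrow> s \<in> B \<Longrightarrow> act S g s \<in> B"
  shows "gset_over \<Gamma> Z (over_restrict S B)"
proof -
  note S' = gset_overD[OF S] and fin = finite_gsetD[OF gset_overD(1)[OF S]]
  have "finite_gset \<Gamma> (over_restrict S B)"
    using finite_subset[OF B fin(2)] B inv fin(1,4,5)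
    by (intro finite_gsetI) (auto simp: over_restrict_simps subset_iff over_restrict_def)
  then show ?thesis
    using B S'(2,3) inv by (auto simp: gset_over_def gset_map_def over_restrict_simps subset_iff)
qed

text \<open>Points are sorted by membership in \<open>A\<close>; since both pieces are invariant and
  disjoint, the action respects the sorting.\<close>

lemma over_restrict_Un:
  assumes "A \<inter> B = {}" and inv: "\<And>g s. g \<in> carrier \<Gamma> \<Longrightarrow> s \<in> A \<Longrightarrow> act S g s \<in> A"
    "\<And>g s. g \<in> carrier \<Gamma> \<Longrightarrow> s \<in> B \<Longrightarrow> act S g s \<in> B"
  shows "over_iso \<Gamma> (over_restrict S (A \<union> B)) (over_sum (over_restrict S A) (over_restrict S B))"
proof -
  let ?f = "\<lambda>s. if s \<in> A then Inl s else Inr s"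
  have 1: "?f s \<in> A <+> B" if "s \<in> A \<union> B" for s using that by auto
  have 2: "?f (act S g s) = act (over_sum (over_restrict S A) (over_restrict S B)) g (?f s)"
    if "g \<in> carrier \<Gamma>" "s \<in> A \<union> B" for g s
  proof (cases "s \<in> A")
    case True
    then show ?thesis using inv(1)[OF that(1)] by (simp add: over_sum_simps over_restrict_simps)
  next
    case False
    then have "s \<in> B" "act S g s \<notin> A" using that inv(2)[OF that(1)] assms(1) by auto
    then show ?thesis using False by (simp add: over_sum_simps over_restrict_simps)
  qed
  have "inj_on ?f (A \<union> B)" by (auto simp: inj_on_def split: if_splits)
  moreover have "?f ` (A \<union> B) = A <+> B" using assms(1) by (auto simp: image_iff)
  ultimately have "bij_betw ?f (A \<union> B) (A <+> B)" by (simp add: bij_betw_def)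
  then show ?thesis
    unfolding over_iso_def gset_map_def
  proof (intro exI[of _ ?f] conjI ballI funcsetI)
    fix g s assume "g \<in> carrier \<Gamma>" "s \<in> pts (over_restrict S (A \<union> B))"
    then have gs: "g \<in> carrier \<Gamma>" "s \<in> A \<union> B" by (simp_all add: over_restrict_simps)
    show "?f (act (over_restrict S (A \<union> B)) g s) = act (over_sum (over_restrict S A) (over_restrict S B)) g (?f s)"
      unfolding over_restrict_simps(2)[OF gs(2)] by (rule 2[OF gs])
  qed (use 1 in \<open>auto simp: over_sum_simps over_restrict_simps\<close>)
qed

text \<open>Induction on the index set: one piece is split off from the union of the others, which
  is again invariant. The empty union rests on the vanishing of the class of the empty span.\<close>

lemma span_class_partition:
  assumes R: "cring R" and S: "gset_over \<Gamma> Z S" and "finite I"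
    and sub: "\<And>i. i \<in> I \<Longrightarrow> B i \<subseteq> pts S"
    and inv: "\<And>i g s. i \<in> I \<Longrightarrow> g \<in> carrier \<Gamma> \<Longrightarrow> s \<in> B i \<Longrightarrow> act S g s \<in> B i"
    and disj: "\<And>i j. i \<in> I \<Longrightarrow> j \<in> I \<Longrightarrow> i \<noteq> j \<Longrightarrow> B i \<inter> B j = {}"
  shows "span_class R \<Gamma> Z (over_restrict S (\<Union>i\<in>I. B i)) =
    (\<Oplus>\<^bsub>span_module R \<Gamma> Z\<^esub> i\<in>I. span_class R \<Gamma> Z (over_restrict S (B i)))"
  using \<open>finite I\<close> sub inv disj
proof (induction I rule: finite_induct)
  case empty
  interpret Module.module R "span_module R \<Gamma> Z" by (rule span_module[OF R])
  have "gset_over \<Gamma> Z (over_restrict S {})" by (rule gset_over_restrict[OF S]) auto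
  then show ?case by (simp add: over_restrict_simps span_class_empty[OF R])
next
  case (insert a I)
  interpret Module.module R "span_module R \<Gamma> Z" by (rule span_module[OF R])
  let ?U = "\<Union>i\<in>I. B i"
  have over: "gset_over \<Gamma> Z (over_restrict S (B i))" if "i \<in> insert a I" for i
    by (rule gset_over_restrict[OF S]) (use insert.prems that in auto)
  have subU: "?U \<subseteq> pts S" by (intro UN_least insert.prems(1) insertI2)
  have invU: "act S g s \<in> ?U" if "g \<in> carrier \<Gamma>" "s \<in> ?U" for g s
  proof -
    obtain i where i: "i \<in> I" "s \<in> B i" using \<open>s \<in> ?U\<close> by (elim UN_E)
    show ?thesis by (intro UN_I[OF i(1)] insert.prems(2)[OF insertI2[OF i(1)] that(1) i(2)])
  qed
  have inva: "act S g s \<in> B a" if "g \<in> carrier \<Gamma>" "s \<in> B a" for g s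
    by (rule insert.prems(2)[OF insertI1 that])
  have overU: "gset_over \<Gamma> Z (over_restrict S ?U)"
    by (rule gset_over_restrict[OF S subU invU])
  have overaU: "gset_over \<Gamma> Z (over_restrict S (B a \<union> ?U))"
  proof (rule gset_over_restrict[OF S])
    show "B a \<union> ?U \<subseteq> pts S" using subU insert.prems(1)[of a] by blast
    show "act S g s \<in> B a \<union> ?U" if "g \<in> carrier \<Gamma>" "s \<in> B a \<union> ?U" for g s
      using that inva invU by blast
  qed
  have "over_iso \<Gamma> (over_restrict S (B a \<union> ?U)) (over_sum (over_restrict S (B a)) (over_restrict S ?U))"
  proof (rule over_restrict_Un)
    show "B a \<inter> ?U = {}" using insert.prems(3)[of a] insert.hyps by fastforce
  qed (rule inva invU; assumption)+
  from span_class_sum[OF R overaU over[OF insertI1] overU this]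
  have "span_class R \<Gamma> Z (over_restrict S (\<Union>i\<in>insert a I. B i)) =
    span_class R \<Gamma> Z (over_restrict S (B a)) \<oplus>\<^bsub>span_module R \<Gamma> Z\<^esub> span_class R \<Gamma> Z (over_restrict S ?U)"
    by simp
  also have "span_class R \<Gamma> Z (over_restrict S ?U) =
    (\<Oplus>\<^bsub>span_module R \<Gamma> Z\<^esub> i\<in>I. span_class R \<Gamma> Z (over_restrict S (B i)))"
    by (rule insert.IH) (use insert.prems in auto)
  finally show ?case
    using insert.hyps over by (subst M.finsum_insert) (auto intro!: span_class_closed[OF R])
qed

text \<open>
  The \<open>L i\<close> are related to the stabilizers by embeddings \<open>\<phi> i\<close> and need not be subgroups of \<open>G\<close>, since
  the groups in an object of the additive completion are not contained in a common group.
\<close>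

locale orbit_decomposition =
  fixes R :: "('r, 's) ring_scheme" and G :: "'g monoid" and X :: "('g, 'x) gset"
    and n :: nat and L :: "nat \<Rightarrow> 'l monoid" and \<phi> :: "nat \<Rightarrow> 'l \<Rightarrow> 'g" and x :: "nat \<Rightarrow> 'x" and p :: 'z
  assumes R: "cring R" and X: "finite_gset G X" and fin: "finite (carrier G)"
    and L: "i < n \<Longrightarrow> group (L i)" and hom: "i < n \<Longrightarrow> \<phi> i \<in> hom (L i) G"
    and inj: "i < n \<Longrightarrow> inj_on (\<phi> i) (carrier (L i))"
    and x: "i < n \<Longrightarrow> x i \<in> pts X"
    and stab: "i < n \<Longrightarrow> \<phi> i ` carrier (L i) = {g \<in> carrier G. act X g (x i) = x i}"
    and cover: "y \<in> pts X \<Longrightarrow> \<exists>i<n. \<exists>g \<in> carrier G. act X g (x i) = y"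
    and distinct: "i < n \<Longrightarrow> j < n \<Longrightarrow> g \<in> carrier G \<Longrightarrow> act X g (x i) = x j \<Longrightarrow> i = j"
begin

sublocale G: group G by (rule finite_gsetD(1)[OF X])

lemmas X_simps [simp] = finite_gsetD[OF X]

abbreviation "pt \<equiv> point_gset p"

text \<open>
  \<open>inc i\<close> and \<open>prj i\<close> are the spans from \<open>pt/L\<^sub>i\<close> to \<open>X/G\<close> and back.
\<close>

definition "inc i = \<lparr>pts = carrier G,
  act = (\<lambda>(g, l). \<lambda>u \<in> carrier G. g \<otimes>\<^bsub>G\<^esub> u \<otimes>\<^bsub>G\<^esub> inv\<^bsub>G\<^esub> \<phi> i l), anchor = (\<lambda>u. (act X u (x i), p))\<rparr>"

definition "prj i = \<lparr>pts = carrier G,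
  act = (\<lambda>(l, g). \<lambda>u \<in> carrier G. \<phi> i l \<otimes>\<^bsub>G\<^esub> u \<otimes>\<^bsub>G\<^esub> inv\<^bsub>G\<^esub> g), anchor = (\<lambda>u. (p, act X (inv\<^bsub>G\<^esub> u) (x i)))\<rparr>"

lemma inc_simps [simp]:
  "pts (inc i) = carrier G"
  "u \<in> carrier G \<Longrightarrow> act (inc i) (g, l) u = g \<otimes>\<^bsub>G\<^esub> u \<otimes>\<^bsub>G\<^esub> inv\<^bsub>G\<^esub> \<phi> i l"
  "anchor (inc i) u = (act X u (x i), p)"
  by (simp_all add: inc_def)

lemma prj_simps [simp]:
  "pts (prj i) = carrier G"
  "u \<in> carrier G \<Longrightarrow> act (prj i) (l, g) u = \<phi> i l \<otimes>\<^bsub>G\<^esub> u \<otimes>\<^bsub>G\<^esub> inv\<^bsub>G\<^esub> g"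
  "anchor (prj i) u = (p, act X (inv\<^bsub>G\<^esub> u) (x i))"
  by (simp_all add: prj_def)

lemma \<phi>_simps [simp]:
  assumes "i < n"
  shows "l \<in> carrier (L i) \<Longrightarrow> \<phi> i l \<in> carrier G"
    "l \<in> carrier (L i) \<Longrightarrow> m \<in> carrier (L i) \<Longrightarrow> \<phi> i (l \<otimes>\<^bsub>L i\<^esub> m) = \<phi> i l \<otimes>\<^bsub>G\<^esub> \<phi> i m"
    "\<phi> i \<one>\<^bsub>L i\<^esub> = \<one>\<^bsub>G\<^esub>"
    "l \<in> carrier (L i) \<Longrightarrow> \<phi> i (inv\<^bsub>L i\<^esub> l) = inv\<^bsub>G\<^esub> \<phi> i l"
    "l \<in> carrier (L i) \<Longrightarrow> act X (\<phi> i l) (x i) = x i"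
    "l \<in> carrier (L i) \<Longrightarrow> act X (inv\<^bsub>G\<^esub> \<phi> i l) (x i) = x i"
proof -
  interpret h: group_hom "L i" G "\<phi> i"
    using L hom assms by (simp add: group_hom_def group_hom_axioms_def G.is_group)
  show "l \<in> carrier (L i) \<Longrightarrow> \<phi> i l \<in> carrier G" by simp
  show "l \<in> carrier (L i) \<Longrightarrow> m \<in> carrier (L i) \<Longrightarrow> \<phi> i (l \<otimes>\<^bsub>L i\<^esub> m) = \<phi> i l \<otimes>\<^bsub>G\<^esub> \<phi> i m" by simp
  show "\<phi> i \<one>\<^bsub>L i\<^esub> = \<one>\<^bsub>G\<^esub>" by simp
  show 1: "l \<in> carrier (L i) \<Longrightarrow> \<phi> i (inv\<^bsub>L i\<^esub> l) = inv\<^bsub>G\<^esub> \<phi> i l" by simp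
  show "l \<in> carrier (L i) \<Longrightarrow> act X (\<phi> i l) (x i) = x i" using stab[OF assms] by blast
  then show "l \<in> carrier (L i) \<Longrightarrow> act X (inv\<^bsub>G\<^esub> \<phi> i l) (x i) = x i"
    using act_inv_eq_iff[OF X] x[OF assms] by simp
qed

lemma stabE:
  assumes "i < n" "g \<in> carrier G" "act X g (x i) = x i"
  obtains l where "l \<in> carrier (L i)" "\<phi> i l = g"
proof -
  have "g \<in> \<phi> i ` carrier (L i)" unfolding stab[OF assms(1)] using assms by simp
  then show ?thesis using that by (elim imageE) simp
qed

lemma inc_over: "i < n \<Longrightarrow> gset_over (G \<times>\<times> L i) (gset_prod X pt) (inc i)"
proof -
  assume i: "i < n"
  note [simp] = \<phi>_simps[OF i] x[OF i]
  interpret Li: group "L i" by (rule L[OF i])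
  have "finite_gset (G \<times>\<times> L i) (inc i)"
    by (rule finite_gsetI)
      (auto simp: DirProd_group G.is_group L i fin G.m_assoc G.inv_mult_group inc_def split: prod.splits)
  moreover have "act X (g \<otimes>\<^bsub>G\<^esub> u \<otimes>\<^bsub>G\<^esub> inv\<^bsub>G\<^esub> \<phi> i l) (x i) = act X (g \<otimes>\<^bsub>G\<^esub> u) (x i)"
    if "g \<in> carrier G" "u \<in> carrier G" "l \<in> carrier (L i)" for g u l
    using X_simps(5)[of "g \<otimes>\<^bsub>G\<^esub> u" "inv\<^bsub>G\<^esub> \<phi> i l" "x i"] that by simp
  ultimately show ?thesis
    by (auto simp: gset_over_def gset_map_def gset_prod_simps point_gset_simps)
qed

lemma prj_over: "i < n \<Longrightarrow> gset_over (L i \<times>\<times> G) (gset_prod pt X) (prj i)"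
proof -
  assume i: "i < n"
  note [simp] = \<phi>_simps[OF i] x[OF i]
  interpret Li: group "L i" by (rule L[OF i])
  have "finite_gset (L i \<times>\<times> G) (prj i)"
    by (rule finite_gsetI)
      (auto simp: DirProd_group G.is_group L i fin G.m_assoc G.inv_mult_group prj_def split: prod.splits)
  moreover have "act X (inv\<^bsub>G\<^esub> (\<phi> i l \<otimes>\<^bsub>G\<^esub> u \<otimes>\<^bsub>G\<^esub> inv\<^bsub>G\<^esub> g)) (x i) = act X (g \<otimes>\<^bsub>G\<^esub> inv\<^bsub>G\<^esub> u) (x i)"
    if "g \<in> carrier G" "u \<in> carrier G" "l \<in> carrier (L i)" for g u l
    using X_simps(5)[of "g \<otimes>\<^bsub>G\<^esub> inv\<^bsub>G\<^esub> u" "inv\<^bsub>G\<^esub> \<phi> i l" "x i"] that by (simp add: G.inv_mult_group G.m_assoc)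
  ultimately show ?thesis
    by (auto simp: gset_over_def gset_map_def gset_prod_simps point_gset_simps)
qed

lemma composable_prj_inc: "i < n \<Longrightarrow> j < n \<Longrightarrow> composable (L i) G (L j) pt X pt (prj i) (inc j)"
  by (intro composable.intro finite_gset_point L X prj_over inc_over)

lemma composable_inc_prj: "i < n \<Longrightarrow> composable G (L i) G X pt X (inc i) (prj i)"
  by (intro composable.intro finite_gset_point L X prj_over inc_over)

text \<open>Matching of \<open>(v, u)\<close> means that \<open>v u\<close> fixes
  \<open>x i\<close>, so \<open>v u = \<phi> i l\<close> for a unique \<open>l\<close>, which is the
  image of the pair. Balancing over \<open>G\<close> replaces \<open>(v, u)\<close> by
  \<open>(v h^-1, h u)\<close>, so exactly the product survives.\<close>

lemma prj_inc_same:
  assumes i: "i < n"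
  shows "over_iso (L i \<times>\<times> L i) (span_comp (L i) G (L i) (prj i) (inc i)) (span_ident (L i) pt)"
proof -
  interpret A: composable "L i" G "L i" pt X pt "prj i" "inc i" by (rule composable_prj_inc[OF i i])
  interpret Li: group "L i" by (rule L[OF i])
  note [simp] = \<phi>_simps[OF i] x[OF i] point_gset_simps span_ident_simps
  define \<psi> where "\<psi> = inv_into (carrier (L i)) (\<phi> i)"
  have \<psi>: "\<psi> (\<phi> i l) = l" if "l \<in> carrier (L i)" for l
    using that inj[OF i] by (simp add: \<psi>_def)
  have matched: "A.matched v u \<longleftrightarrow> v \<in> carrier G \<and> u \<in> carrier G \<and> (\<exists>l \<in> carrier (L i). \<phi> i l = v \<otimes>\<^bsub>G\<^esub> u)" for v u
  proof -
    have "act X (inv\<^bsub>G\<^esub> v) (x i) = act X u (x i) \<longleftrightarrow> act X (v \<otimes>\<^bsub>G\<^esub> u) (x i) = x i" if "v \<in> carrier G" "u \<in> carrier G"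
      using that act_inv_eq_iff[OF X that(1), of "x i" "act X u (x i)"] by auto
    then show ?thesis
      by (auto simp: A.matched_def elim: stabE[OF i]) (metis G.m_closed stabE[OF i], metis \<phi>_simps(5)[OF i])
  qed
  show ?thesis
  proof (rule A.span_comp_isoI[where f = "\<lambda>v u. (\<psi> (v \<otimes>\<^bsub>G\<^esub> u), p)"])
    fix v u assume m: "A.matched v u"
    then obtain l where l: "v \<in> carrier G" "u \<in> carrier G" "l \<in> carrier (L i)" "v \<otimes>\<^bsub>G\<^esub> u = \<phi> i l"
      using matched by metis
    show "(\<psi> (v \<otimes>\<^bsub>G\<^esub> u), p) \<in> pts (span_ident (L i) pt)" using l \<psi> by simp
    show "anchor (span_ident (L i) pt) (\<psi> (v \<otimes>\<^bsub>G\<^esub> u), p) = (fst (anchor (prj i) v), snd (anchor (inc i) u))" by simp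
    fix h assume h: "h \<in> carrier G"
    have "v \<otimes>\<^bsub>G\<^esub> inv\<^bsub>G\<^esub> h \<otimes>\<^bsub>G\<^esub> (h \<otimes>\<^bsub>G\<^esub> u) = v \<otimes>\<^bsub>G\<^esub> u"
      using h l by (metis G.inv_closed G.l_inv G.m_assoc G.m_closed G.l_one)
    then show "(\<psi> (act (prj i) (\<one>\<^bsub>L i\<^esub>, h) v \<otimes>\<^bsub>G\<^esub> act (inc i) (h, \<one>\<^bsub>L i\<^esub>) u), p) = (\<psi> (v \<otimes>\<^bsub>G\<^esub> u), p)"
      using h l by simp
  next
    fix v u k m assume m: "A.matched v u" and k: "k \<in> carrier (L i)" "m \<in> carrier (L i)"
    then obtain l where l: "v \<in> carrier G" "u \<in> carrier G" "l \<in> carrier (L i)" "v \<otimes>\<^bsub>G\<^esub> u = \<phi> i l"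
      using matched by metis
    have "\<phi> i k \<otimes>\<^bsub>G\<^esub> v \<otimes>\<^bsub>G\<^esub> (u \<otimes>\<^bsub>G\<^esub> inv\<^bsub>G\<^esub> \<phi> i m) = \<phi> i k \<otimes>\<^bsub>G\<^esub> (v \<otimes>\<^bsub>G\<^esub> u) \<otimes>\<^bsub>G\<^esub> inv\<^bsub>G\<^esub> \<phi> i m"
      using k l(1,2) by (simp add: G.m_assoc)
    also have "\<dots> = \<phi> i (k \<otimes>\<^bsub>L i\<^esub> l \<otimes>\<^bsub>L i\<^esub> inv\<^bsub>L i\<^esub> m)" using k l by simp
    finally have "act (prj i) (k, \<one>\<^bsub>G\<^esub>) v \<otimes>\<^bsub>G\<^esub> act (inc i) (\<one>\<^bsub>G\<^esub>, m) u =
        \<phi> i (k \<otimes>\<^bsub>L i\<^esub> l \<otimes>\<^bsub>L i\<^esub> inv\<^bsub>L i\<^esub> m)"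
      using k l by simp
    moreover have "\<psi> (\<phi> i (k \<otimes>\<^bsub>L i\<^esub> l \<otimes>\<^bsub>L i\<^esub> inv\<^bsub>L i\<^esub> m)) = k \<otimes>\<^bsub>L i\<^esub> l \<otimes>\<^bsub>L i\<^esub> inv\<^bsub>L i\<^esub> m"
      using k l by (intro \<psi>) simp
    ultimately show "(\<psi> (act (prj i) (k, \<one>\<^bsub>G\<^esub>) v \<otimes>\<^bsub>G\<^esub> act (inc i) (\<one>\<^bsub>G\<^esub>, m) u), p) =
        act (span_ident (L i) pt) (k, m) (\<psi> (v \<otimes>\<^bsub>G\<^esub> u), p)"
      using k l by (simp add: \<psi> del: \<phi>_simps inc_simps prj_simps)
  next
    fix v u v' u' assume "A.matched v u" "A.matched v' u'" and eq: "(\<psi> (v \<otimes>\<^bsub>G\<^esub> u), p) = (\<psi> (v' \<otimes>\<^bsub>G\<^esub> u'), p)"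
    then have mem: "v \<in> carrier G" "u \<in> carrier G" "v' \<in> carrier G" "u' \<in> carrier G"
      and vu: "v \<otimes>\<^bsub>G\<^esub> u = v' \<otimes>\<^bsub>G\<^esub> u'" using matched \<psi> by (simp_all, metis)
    \<comment> \<open>The shift by \<open>v'^-1 v\<close> takes \<open>v\<close> to
      \<open>v'\<close>; equality of the products then makes it take \<open>u\<close> to
      \<open>u'\<close>.\<close>
    have "u' = inv\<^bsub>G\<^esub> v' \<otimes>\<^bsub>G\<^esub> v \<otimes>\<^bsub>G\<^esub> u"
      using mem vu by (simp add: G.m_assoc G.inv_solve_left)
    moreover have "v' = v \<otimes>\<^bsub>G\<^esub> inv\<^bsub>G\<^esub> (inv\<^bsub>G\<^esub> v' \<otimes>\<^bsub>G\<^esub> v)"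
      using mem by (simp add: G.inv_mult_group flip: G.m_assoc)
    ultimately show "\<exists>h \<in> carrier G. v' = act (prj i) (\<one>\<^bsub>L i\<^esub>, h) v \<and> u' = act (inc i) (h, \<one>\<^bsub>L i\<^esub>) u"
      using mem by (intro bexI[of _ "inv\<^bsub>G\<^esub> v' \<otimes>\<^bsub>G\<^esub> v"]) simp_all
  next
    fix t assume "t \<in> pts (span_ident (L i) pt)"
    then obtain l where l: "l \<in> carrier (L i)" "t = (l, p)" by auto
    then show "\<exists>v u. A.matched v u \<and> (\<psi> (v \<otimes>\<^bsub>G\<^esub> u), p) = t"
      by (intro exI[of _ "\<one>\<^bsub>G\<^esub>"] exI[of _ "\<phi> i l"]) (auto simp: matched \<psi>)
  qed
qed

text \<open>A matched pair would satisfy \<open>(v u) (x j) = x i\<close> and so put two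
  representatives into one orbit. Orthogonality thus holds already on the level of sets.\<close>

lemma prj_inc_diff:
  assumes i: "i < n" and j: "j < n" and "i \<noteq> j"
  shows "pts (span_comp (L i) G (L j) (prj i) (inc j)) = {}"
proof -
  interpret A: composable "L i" G "L j" pt X pt "prj i" "inc j" by (rule composable_prj_inc[OF i j])
  have "\<not> A.matched v u" for v u
  proof
    assume "A.matched v u"
    then have mem: "v \<in> carrier G" "u \<in> carrier G" and eq: "act X (inv\<^bsub>G\<^esub> v) (x i) = act X u (x j)"
      by (auto simp: A.matched_def)
    then have "act X (v \<otimes>\<^bsub>G\<^esub> u) (x j) = x i"
      using act_inv_eq_iff[OF X mem(1), of "x i" "act X u (x j)"] x[OF i] x[OF j] by simp
    then show False using distinct[OF j i, of "v \<otimes>\<^bsub>G\<^esub> u"] mem assms(3) by simp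
  qed
  then show ?thesis using A.pts_W by blast
qed

definition "block i = {(g, y). g \<in> carrier G \<and> (\<exists>h \<in> carrier G. y = act X h (x i))}"

text \<open>The middle object is a point, so every pair is matched. Balancing over
  \<open>L i\<close> preserves both \<open>v u\<close> and \<open>v (x i)\<close>; conversely these
  determine the pair up to balancing, because \<open>v'^-1 v\<close> fixes \<open>x i\<close> and
  hence comes from \<open>L i\<close>.\<close>

lemma inc_prj:
  assumes i: "i < n"
  shows "over_iso (G \<times>\<times> G) (span_comp G (L i) G (inc i) (prj i)) (over_restrict (span_ident G X) (block i))"
proof -
  interpret A: composable G "L i" G X pt X "inc i" "prj i" by (rule composable_inc_prj[OF i])
  interpret Li: group "L i" by (rule L[OF i])
  note [simp] = \<phi>_simps[OF i] x[OF i] span_ident_simps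
  have matched: "A.matched v u \<longleftrightarrow> v \<in> carrier G \<and> u \<in> carrier G" for v u
    by (simp add: A.matched_def)
  have block: "(v \<otimes>\<^bsub>G\<^esub> u, act X v (x i)) \<in> block i" if "v \<in> carrier G" "u \<in> carrier G" for v u
    using that by (auto simp: block_def)
  show ?thesis
  proof (rule A.span_comp_isoI[where f = "\<lambda>v u. (v \<otimes>\<^bsub>G\<^esub> u, act X v (x i))"], unfold matched)
    fix v u assume vu: "v \<in> carrier G \<and> u \<in> carrier G"
    show "(v \<otimes>\<^bsub>G\<^esub> u, act X v (x i)) \<in> pts (over_restrict (span_ident G X) (block i))"
      using vu block by (simp add: over_restrict_simps)
    have "inv\<^bsub>G\<^esub> u \<otimes>\<^bsub>G\<^esub> inv\<^bsub>G\<^esub> v \<otimes>\<^bsub>G\<^esub> v = inv\<^bsub>G\<^esub> u" using vu by (simp add: G.m_assoc)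
    then show "anchor (over_restrict (span_ident G X) (block i)) (v \<otimes>\<^bsub>G\<^esub> u, act X v (x i)) =
        (fst (anchor (inc i) v), snd (anchor (prj i) u))"
      using vu by (simp add: over_restrict_simps G.inv_mult_group)
    fix l assume l: "l \<in> carrier (L i)"
    have "v \<otimes>\<^bsub>G\<^esub> inv\<^bsub>G\<^esub> \<phi> i l \<otimes>\<^bsub>G\<^esub> (\<phi> i l \<otimes>\<^bsub>G\<^esub> u) = v \<otimes>\<^bsub>G\<^esub> u"
      using l vu by (metis G.inv_closed G.l_inv G.m_assoc G.m_closed G.l_one \<phi>_simps(1)[OF i])
    moreover have "act X (v \<otimes>\<^bsub>G\<^esub> inv\<^bsub>G\<^esub> \<phi> i l) (x i) = act X v (x i)"
      using X_simps(5)[of v "inv\<^bsub>G\<^esub> \<phi> i l" "x i"] l vu by simp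
    ultimately show "(act (inc i) (\<one>\<^bsub>G\<^esub>, l) v \<otimes>\<^bsub>G\<^esub> act (prj i) (l, \<one>\<^bsub>G\<^esub>) u, act X (act (inc i) (\<one>\<^bsub>G\<^esub>, l) v) (x i)) =
        (v \<otimes>\<^bsub>G\<^esub> u, act X v (x i))"
      using l vu by simp
  next
    fix v u k g assume vu: "v \<in> carrier G \<and> u \<in> carrier G" and kg: "k \<in> carrier G" "g \<in> carrier G"
    then show "(act (inc i) (k, \<one>\<^bsub>L i\<^esub>) v \<otimes>\<^bsub>G\<^esub> act (prj i) (\<one>\<^bsub>L i\<^esub>, g) u, act X (act (inc i) (k, \<one>\<^bsub>L i\<^esub>) v) (x i)) =
        act (over_restrict (span_ident G X) (block i)) (k, g) (v \<otimes>\<^bsub>G\<^esub> u, act X v (x i))"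
      using block by (simp add: over_restrict_simps G.m_assoc)
  next
    fix v u v' u' assume vu: "v \<in> carrier G \<and> u \<in> carrier G" and vu': "v' \<in> carrier G \<and> u' \<in> carrier G"
      and eq: "(v \<otimes>\<^bsub>G\<^esub> u, act X v (x i)) = (v' \<otimes>\<^bsub>G\<^esub> u', act X v' (x i))"
    have "act X (inv\<^bsub>G\<^esub> v' \<otimes>\<^bsub>G\<^esub> v) (x i) = x i"
      using act_inv_eq_iff[OF X, of v' "act X v (x i)" "x i"] eq vu vu' by simp
    then obtain l where l: "l \<in> carrier (L i)" "\<phi> i l = inv\<^bsub>G\<^esub> v' \<otimes>\<^bsub>G\<^esub> v"
      using vu vu' by (metis G.inv_closed G.m_closed stabE[OF i])
    have "u' = inv\<^bsub>G\<^esub> v' \<otimes>\<^bsub>G\<^esub> v \<otimes>\<^bsub>G\<^esub> u"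
      using vu vu' eq by (simp add: G.m_assoc G.inv_solve_left)
    moreover have "v' = v \<otimes>\<^bsub>G\<^esub> inv\<^bsub>G\<^esub> (inv\<^bsub>G\<^esub> v' \<otimes>\<^bsub>G\<^esub> v)"
      using vu vu' by (simp add: G.inv_mult_group flip: G.m_assoc)
    ultimately show "\<exists>l \<in> carrier (L i). v' = act (inc i) (\<one>\<^bsub>G\<^esub>, l) v \<and> u' = act (prj i) (l, \<one>\<^bsub>G\<^esub>) u"
      using vu vu' l by (intro bexI[of _ l]) simp_all
  next
    fix t assume "t \<in> pts (over_restrict (span_ident G X) (block i))"
    then obtain g h where t: "t = (g, act X h (x i))" "g \<in> carrier G" "h \<in> carrier G"
      by (auto simp: over_restrict_simps block_def)
    \<comment> \<open>Taking \<open>v = h\<close> reaches the given point of the orbit, and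
      \<open>u = h^-1 g\<close> then gives the product \<open>g\<close>.\<close>
    then show "\<exists>v u. (v \<in> carrier G \<and> u \<in> carrier G) \<and> (v \<otimes>\<^bsub>G\<^esub> u, act X v (x i)) = t"
      by (intro exI[of _ h] exI[of _ "inv\<^bsub>G\<^esub> h \<otimes>\<^bsub>G\<^esub> g"]) (simp flip: G.m_assoc)
  qed
qed

lemma block_cover: "(\<Union>i<n. block i) = pts (span_ident G X)"
  using cover x by (fastforce simp: block_def span_ident_simps)

lemma block_disjoint:
  assumes "i < n" "j < n" "i \<noteq> j"
  shows "block i \<inter> block j = {}"
proof -
  have False if "h \<in> carrier G" "k \<in> carrier G" "act X h (x i) = act X k (x j)" for h k
  proof -
    have "act X (inv\<^bsub>G\<^esub> k \<otimes>\<^bsub>G\<^esub> h) (x i) = act X (inv\<^bsub>G\<^esub> k) (act X h (x i))"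
      using that x assms by (intro X_simps(5)[symmetric]) auto
    also have "\<dots> = x j"
      unfolding that(3) using that x assms by simp
    finally have "act X (inv\<^bsub>G\<^esub> k \<otimes>\<^bsub>G\<^esub> h) (x i) = x j" .
    from distinct[OF assms(1,2) _ this] show False using that assms(3) by simp
  qed
  then show ?thesis by (auto simp: block_def)
qed

lemma block_invariant: "i < n \<Longrightarrow> a \<in> carrier (G \<times>\<times> G) \<Longrightarrow> s \<in> block i \<Longrightarrow> act (span_ident G X) a s \<in> block i"
  using x by (auto simp: block_def span_ident_simps intro!: bexI[of _ "_ \<otimes>\<^bsub>G\<^esub> _"])

text \<open>The blocks partition the identity span into invariant pieces, and \<open>inc_prj\<close>
  identifies each piece with a composite through \<open>L i\<close>.\<close>

lemma sum_inc_prj: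
  "(\<Oplus>\<^bsub>span_module R (G \<times>\<times> G) (gset_prod X X)\<^esub> i\<in>{..<n}.
      span_class R (G \<times>\<times> G) (gset_prod X X) (span_comp G (L i) G (inc i) (prj i))) =
    span_class R (G \<times>\<times> G) (gset_prod X X) (span_ident G X)"
proof -
  let ?S = "span_ident G X" and ?Z = "gset_prod X X"
  note S = span_ident_over[OF X fin]
  interpret Module.module R "span_module R (G \<times>\<times> G) ?Z" by (rule span_module[OF R])
  have sub: "block i \<subseteq> pts ?S" if "i < n" for i using block_cover that by blast
  have over: "gset_over (G \<times>\<times> G) ?Z (over_restrict ?S (block i))" if "i < n" for i
    by (rule gset_over_restrict[OF S sub[OF that] block_invariant[OF that]])
  have "span_class R (G \<times>\<times> G) ?Z ?S = span_class R (G \<times>\<times> G) ?Z (over_restrict ?S (\<Union>i<n. block i))"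
  proof (rule span_class_iso[OF R S])
    show "gset_over (G \<times>\<times> G) ?Z (over_restrict ?S (\<Union>i<n. block i))"
      unfolding block_cover by (rule gset_over_restrict[OF S]) (use finite_gsetD(3)[OF gset_overD(1)[OF S]] in auto)
    show "over_iso (G \<times>\<times> G) ?S (over_restrict ?S (\<Union>i<n. block i))"
      unfolding block_cover over_iso_def gset_map_def
      by (intro exI[of _ id]) (auto simp: over_restrict_simps)
  qed
  also have "\<dots> = (\<Oplus>\<^bsub>span_module R (G \<times>\<times> G) ?Z\<^esub> i\<in>{..<n}. span_class R (G \<times>\<times> G) ?Z (over_restrict ?S (block i)))"
    by (rule span_class_partition[OF R S]) (use sub block_disjoint block_invariant in auto)
  also have "\<dots> = (\<Oplus>\<^bsub>span_module R (G \<times>\<times> G) ?Z\<^esub> i\<in>{..<n}.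
      span_class R (G \<times>\<times> G) ?Z (span_comp G (L i) G (inc i) (prj i)))"
  proof (intro M.finsum_cong')
    fix i assume "i \<in> {..<n}"
    then have i: "i < n" by simp
    note comp = composable.span_comp_over[OF composable_inc_prj[OF i]]
    show "span_class R (G \<times>\<times> G) ?Z (over_restrict ?S (block i)) =
        span_class R (G \<times>\<times> G) ?Z (span_comp G (L i) G (inc i) (prj i))"
      by (rule span_class_iso[OF R over[OF i] comp over_iso_sym[OF gset_overD(1)[OF comp] inc_prj[OF i]]])
  qed (simp_all add: Pi_iff span_class_closed[OF R] composable.span_comp_over[OF composable_inc_prj])
  finally show ?thesis by simp
qed

end


section \<open>The equivalence\<close>

text \<open>One base point \<open>p\<close> is fixed for all groups, so each group has exactly one
  object over a point, and all morphism modules between these are modules over the same point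
  \<open>(p, p)\<close>.\<close>

lemma biproduct_cover_span_biset:
  assumes R: "cring R"
  shows "biproduct_cover R
    (span_category R :: ('g monoid \<times> ('g, 'x) gset,
      ('r \<times> ('g \<times> 'g, nat, 'x \<times> 'x) over_gset frag set) frag set, 'r) lincat)
    (biset_category R :: ('g monoid, ('r \<times> ('g \<times> 'g, nat) gset frag set) frag set, 'r) lincat)
    (\<lambda>G. (G, point_gset p)) (\<lambda>G H. forget_map R (H \<times>\<times> G) (p, p))"
proof (rule biproduct_cover.intro, goal_cases)
  case 1
  show ?case by (rule linear_span_category[OF R])
next
  case (2 G H)
  then show ?case by (simp add: biset_category_simps[OF R] biset_module[OF R])
next
  case (3 G)
  then show ?case by (simp add: span_category_simps[OF R] biset_category_simps[OF R] finite_gset_point)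
next
  case (4 G H)
  then show ?case
    by (simp add: span_category_simps[OF R] biset_category_simps[OF R] gset_prod_point forget_map_bij[OF R])
next
  case (5 G H)
  then show ?case
    by (simp add: span_category_simps[OF R] biset_category_simps[OF R] gset_prod_point forget_map(1)[OF R])
next
  case (6 G)
  then show ?case
    by (simp add: span_category_simps[OF R] biset_category_simps[OF R] gset_prod_point forget_map_ident[OF R])
next
  case (7 G H K f g)
  then show ?case
    by (simp add: span_category_simps[OF R] biset_category_simps[OF R] gset_prod_point forget_map_comp[OF R])
qed

text \<open>The classes of \<open>inc\<close> and \<open>prj\<close> serve as injections and
  projections: \<open>prj_inc_same\<close> and \<open>prj_inc_diff\<close> give the orthogonality
  relations, \<open>sum_inc_prj\<close> the expansion of the identity.\<close>

lemma orbit_decomposition_imp_decomposition: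
  fixes R :: "('r, 's) ring_scheme" and X :: "('g, 'x) gset" and p :: 'x
  assumes "orbit_decomposition R G X (length Ls) (\<lambda>i. Ls ! i) \<phi> x" and fin: "\<And>L. L \<in> set Ls \<Longrightarrow> finite (carrier L)"
  shows "\<exists>\<iota> \<pi>. biproduct_cover.decomposition
    (span_category R :: ('g monoid \<times> ('g, 'x) gset,
      ('r \<times> ('g \<times> 'g, nat, 'x \<times> 'x) over_gset frag set) frag set, 'r) lincat)
    (biset_category R :: ('g monoid, ('r \<times> ('g \<times> 'g, nat) gset frag set) frag set, 'r) lincat)
    (\<lambda>G. (G, point_gset p)) (G, X) Ls \<iota> \<pi>"
proof -
  interpret O: orbit_decomposition R G X "length Ls" "\<lambda>i. Ls ! i" \<phi> x p by fact
  note R = O.R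
  interpret bc: biproduct_cover R
    "span_category R :: ('g monoid \<times> ('g, 'x) gset,
      ('r \<times> ('g \<times> 'g, nat, 'x \<times> 'x) over_gset frag set) frag set, 'r) lincat"
    "biset_category R :: ('g monoid, ('r \<times> ('g \<times> 'g, nat) gset frag set) frag set, 'r) lincat"
    "\<lambda>G. (G, point_gset p)" "\<lambda>G H. forget_map R (H \<times>\<times> G) (p, p)"
    by (rule biproduct_cover_span_biset[OF R])
  let ?\<iota> = "\<lambda>i. span_class R (G \<times>\<times> (Ls ! i)) (gset_prod X O.pt) (O.inc i)"
  let ?\<pi> = "\<lambda>i. span_class R ((Ls ! i) \<times>\<times> G) (gset_prod O.pt X) (O.prj i)"
  note simps = span_category_simps[OF R]
  have pt: "finite_gset (Ls ! i) O.pt" if "i < length Ls" for i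
    by (rule finite_gset_point[OF O.L[OF that]])
  have fin': "finite (carrier (Ls ! i))" if "i < length Ls" for i
    using fin that by simp
  have "bc.decomposition (G, X) Ls ?\<iota> ?\<pi>"
    unfolding bc.decomposition_def
  proof (intro conjI allI impI)
    show "(G, X) \<in> Obj (span_category R)" using O.X O.fin by (simp add: simps)
    show "Ls \<in> lists (Obj (biset_category R))"
      using O.L fin by (auto simp: biset_category_simps[OF R] in_set_conv_nth)
    fix i assume i: "i < length Ls"
    show "?\<iota> i \<in> carrier (Hom (span_category R) (Ls ! i, O.pt) (G, X))"
      "?\<pi> i \<in> carrier (Hom (span_category R) (G, X) (Ls ! i, O.pt))"
      by (simp_all add: simps span_class_closed[OF R] O.inc_over[OF i] O.prj_over[OF i])
    fix j assume j: "j < length Ls"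
    have comp: "Comp (span_category R) (Ls ! j, O.pt) (G, X) (Ls ! i, O.pt) (?\<pi> i) (?\<iota> j) =
      span_class R ((Ls ! i) \<times>\<times> (Ls ! j)) (gset_prod O.pt O.pt) (span_comp (Ls ! i) G (Ls ! j) (O.prj i) (O.inc j))"
      unfolding simps by (rule span_bilinear(3)[OF R pt[OF i] O.X pt[OF j] O.prj_over[OF i] O.inc_over[OF j]])
    note over = composable.span_comp_over[OF O.composable_prj_inc[OF i j]]
    show "Comp (span_category R) (Ls ! j, O.pt) (G, X) (Ls ! i, O.pt) (?\<pi> i) (?\<iota> j) =
      (if i = j then Ident (span_category R) (Ls ! i, O.pt)
       else \<zero>\<^bsub>Hom (span_category R) (Ls ! j, O.pt) (Ls ! i, O.pt)\<^esub>)"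
    proof (cases "i = j")
      case True
      then show ?thesis
        unfolding comp using over
        by (simp add: simps span_class_iso[OF R _ span_ident_over[OF pt[OF j] fin'[OF j]] O.prj_inc_same[OF j]])
    next
      case False
      then show ?thesis
        unfolding comp by (simp add: simps span_class_empty[OF R over O.prj_inc_diff[OF i j False]])
    qed
  next
    interpret H: Module.module R "span_module R (G \<times>\<times> G) (gset_prod X X)" by (rule span_module[OF R])
    have comp: "Comp (span_category R) (G, X) (Ls ! i, O.pt) (G, X) (?\<iota> i) (?\<pi> i) =
      span_class R (G \<times>\<times> G) (gset_prod X X) (span_comp G (Ls ! i) G (O.inc i) (O.prj i))" if i: "i < length Ls" for i
      unfolding simps by (rule span_bilinear(3)[OF R O.X pt[OF i] O.X O.inc_over[OF i] O.prj_over[OF i]])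
    have "(\<Oplus>\<^bsub>span_module R (G \<times>\<times> G) (gset_prod X X)\<^esub> i\<in>{..<length Ls}.
        Comp (span_category R) (G, X) (Ls ! i, O.pt) (G, X) (?\<iota> i) (?\<pi> i)) =
      (\<Oplus>\<^bsub>span_module R (G \<times>\<times> G) (gset_prod X X)\<^esub> i\<in>{..<length Ls}.
        span_class R (G \<times>\<times> G) (gset_prod X X) (span_comp G (Ls ! i) G (O.inc i) (O.prj i)))"
      using composable.span_comp_over[OF O.composable_inc_prj]
      by (intro H.M.finsum_cong') (auto simp: comp intro!: span_class_closed[OF R])
    then show "(\<Oplus>\<^bsub>Hom (span_category R) (G, X) (G, X)\<^esub> i\<in>{..<length Ls}.
        Comp (span_category R) (G, X) (Ls ! i, O.pt) (G, X) (?\<iota> i) (?\<pi> i)) = Ident (span_category R) (G, X)"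
      by (simp add: simps(2,4) O.sum_inc_prj)
  qed
  then show ?thesis by blast
qed

text \<open>One point is chosen in each orbit; orbits partition the set and are listed without
  repetition, so two chosen points in one orbit have the same index. A list is produced because
  objects of the completion are lists.\<close>

lemma orbit_representatives:
  assumes X: "finite_gset G X"
  shows "\<exists>xs. set xs \<subseteq> pts X \<and> (\<forall>y \<in> pts X. \<exists>i<length xs. \<exists>g \<in> carrier G. act X g (xs ! i) = y) \<and>
    (\<forall>i<length xs. \<forall>j<length xs. \<forall>g \<in> carrier G. act X g (xs ! i) = xs ! j \<longrightarrow> i = j)"
proof -
  interpret A: group_action G "pts X" "act X" using X by (simp add: finite_gset_def)
  have orb: "y \<in> orbit G (act X) x \<longleftrightarrow> (\<exists>g \<in> carrier G. act X g x = y)" for x y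
    by (auto simp: orbit_def)
  define rep where "rep B = (SOME y. y \<in> B)" for B :: "'b set"
  have ne: "x \<in> orbit G (act X) x" if "x \<in> pts X" for x using A.orbit_refl[OF that] .
  have rep: "rep B \<in> B" if "B \<in> orbits G (pts X) (act X)" for B
  proof -
    have "\<exists>y. y \<in> B" using that ne unfolding orbits_def by blast
    then show ?thesis unfolding rep_def by (rule someI_ex)
  qed
  have sub: "B \<subseteq> pts X" if "B \<in> orbits G (pts X) (act X)" for B
    using that finite_gsetD(3)[OF X] unfolding orbits_def orbit_def by auto
  have eq: "B = orbit G (act X) y" if "B \<in> orbits G (pts X) (act X)" "y \<in> B" for B y
  proof -
    have y: "y \<in> pts X" using sub that by blast
    then have "orbit G (act X) y \<in> orbits G (pts X) (act X)" by (auto simp: orbits_def)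
    then show ?thesis
      using A.orbit_partition that ne[OF y] y unfolding partition_def by blast
  qed
  have "finite (orbits G (pts X) (act X))"
    using finite_gsetD(2)[OF X] by (simp add: orbits_def setcompr_eq_image)
  then obtain os where os: "set os = orbits G (pts X) (act X)" "distinct os"
    using finite_distinct_list by blast
  define xs where "xs = map rep os"
  have nth: "os ! i \<in> orbits G (pts X) (act X)" "xs ! i = rep (os ! i)" if "i < length xs" for i
    using that os(1) nth_mem by (auto simp: xs_def)
  show ?thesis
  proof (intro exI[of _ xs] conjI ballI allI impI)
    show "set xs \<subseteq> pts X" using rep sub os(1) by (auto simp: xs_def)
    fix y assume y: "y \<in> pts X"
    then have "orbit G (act X) y \<in> set os" unfolding os by (auto simp: orbits_def)
    then obtain i where i: "i < length os" "os ! i = orbit G (act X) y" by (auto simp: in_set_conv_nth)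
    then have i': "i < length xs" by (simp add: xs_def)
    have "os ! i = orbit G (act X) (rep (os ! i))" using eq[OF nth(1)[OF i'] rep[OF nth(1)[OF i']]] .
    then have "y \<in> orbit G (act X) (xs ! i)" using i(2) ne[OF y] nth(2)[OF i'] by metis
    then show "\<exists>i<length xs. \<exists>g \<in> carrier G. act X g (xs ! i) = y" using i' orb by blast
  next
    fix i j g assume i: "i < length xs" and j: "j < length xs" and g: "g \<in> carrier G" "act X g (xs ! i) = xs ! j"
    have "os ! i = orbit G (act X) (xs ! i)"
      using eq[OF nth(1)[OF i] rep[OF nth(1)[OF i]]] nth(2)[OF i] by simp
    then have "xs ! j \<in> os ! i" using orb g by blast
    then have "os ! i = orbit G (act X) (xs ! j)" by (rule eq[OF nth(1)[OF i]])
    also have "\<dots> = os ! j"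
      using eq[OF nth(1)[OF j] rep[OF nth(1)[OF j]]] nth(2)[OF j] by simp
    finally show "i = j" using os(2) i j by (simp add: xs_def nth_eq_iff_index_eq)
  qed
qed

text \<open>The stabilizers of the representatives are subgroups of \<open>G\<close>, so here the
  embeddings \<open>\<phi> i\<close> are inclusions.\<close>

lemma decomposition_exists:
  fixes X :: "('g, 'x) gset"
  assumes R: "cring R" and X: "finite_gset G X" and fin: "finite (carrier G)"
  shows "\<exists>Ls \<phi> x. orbit_decomposition R G X (length Ls) (\<lambda>i. Ls ! i) \<phi> x \<and>
    (\<forall>L \<in> set Ls. finite (carrier (L :: 'g monoid)))"
proof -
  interpret A: group_action G "pts X" "act X" using X by (simp add: finite_gset_def)
  interpret G: group G by (rule finite_gsetD(1)[OF X])
  obtain xs where xs: "set xs \<subseteq> pts X" "\<And>y. y \<in> pts X \<Longrightarrow> \<exists>i<length xs. \<exists>g \<in> carrier G. act X g (xs ! i) = y"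
    "\<And>i j g. i < length xs \<Longrightarrow> j < length xs \<Longrightarrow> g \<in> carrier G \<Longrightarrow> act X g (xs ! i) = xs ! j \<Longrightarrow> i = j"
    using orbit_representatives[OF X] by blast
  define St where "St y = G\<lparr>carrier := stabilizer G (act X) y\<rparr>" for y
  have sub: "subgroup (stabilizer G (act X) y) G" if "y \<in> pts X" for y
    using A.stabilizer_subgroup[OF that] .
  have mem: "xs ! i \<in> pts X" if "i < length xs" for i using xs(1) that by auto
  have "orbit_decomposition R G X (length (map St xs)) (\<lambda>i. map St xs ! i) (\<lambda>_ l. l) (\<lambda>i. xs ! i)"
  proof (rule orbit_decomposition.intro, goal_cases)
    case (4 i)
    then show ?case using G.subgroup_imp_group[OF sub[OF mem]] by (simp add: St_def)
  next
    case (5 i)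
    then show ?case using subgroup.subset[OF sub[OF mem]] by (auto simp: St_def hom_def)
  next
    case (8 i)
    then show ?case by (simp add: St_def stabilizer_def)
  next
    case (9 y)
    then show ?case using xs(2)[of y] by simp
  next
    case (10 i j g)
    then show ?case using xs(3)[of i j g] by simp
  qed (use R X fin mem in \<open>auto simp: inj_on_def\<close>)
  moreover have "finite (carrier L)" if "L \<in> set (map St xs)" for L
    using that finite_subset[OF _ fin] by (auto simp: St_def stabilizer_def)
  ultimately show ?thesis by blast
qed

section \<open>Realizing a list of groups as point stabilizers\<close>

lemma finite_inj_into_infinite:
  assumes "finite (A :: 'a set)"
  shows "\<exists>e :: 'a \<Rightarrow> 'b :: infinite. inj_on e A"
proof -
  obtain B :: "'b set" where "finite B" "card B = card A"
    using infinite_arbitrarily_large[OF infinite_UNIV] by blast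
  then show ?thesis using finite_same_card_bij[OF assms, of B] bij_betw_imp_inj_on by metis
qed

text \<open>The direct product contains each factor as the tuples that are trivial elsewhere, but
  its elements are functions and not elements of \<open>'g\<close>. Its carrier is finite and
  therefore injects into the infinite type \<open>'g\<close>, along which the group is copied. The
  empty list yields the trivial group.\<close>

lemma embed_groups:
  fixes Ls :: "('g :: infinite) monoid list"
  assumes "\<And>L. L \<in> set Ls \<Longrightarrow> group L \<and> finite (carrier L)"
  shows "\<exists>(G :: 'g monoid) \<phi>. group G \<and> finite (carrier G) \<and>
    (\<forall>i<length Ls. \<phi> i \<in> hom (Ls ! i) G \<and> inj_on (\<phi> i) (carrier (Ls ! i)))"
proof -
  let ?I = "{..<length Ls}"
  define Q where "Q = product_group ?I (\<lambda>i. Ls ! i)"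
  have L: "group (Ls ! i)" "finite (carrier (Ls ! i))" if "i < length Ls" for i
    using assms[OF nth_mem[OF that]] by auto
  interpret Q: group Q unfolding Q_def by (rule product_group) (use L in auto)
  have fin: "finite (carrier Q)" unfolding Q_def carrier_product_group by (intro finite_PiE) (use L in auto)
  obtain e :: "(nat \<Rightarrow> 'g) \<Rightarrow> 'g" where e: "inj_on e (carrier Q)"
    using finite_inj_into_infinite[OF fin] by blast
  define \<psi> where "\<psi> i l = (\<lambda>j\<in>?I. if j = i then l else \<one>\<^bsub>Ls ! j\<^esub>)" for i l
  have one: "\<one>\<^bsub>Ls ! j\<^esub> \<in> carrier (Ls ! j)" "\<one>\<^bsub>Ls ! j\<^esub> \<otimes>\<^bsub>Ls ! j\<^esub> \<one>\<^bsub>Ls ! j\<^esub> = \<one>\<^bsub>Ls ! j\<^esub>"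
    if "j < length Ls" for j
    using group.is_monoid[OF L(1)[OF that]] by (simp_all add: monoid.one_closed monoid.l_one)
  have \<psi>_closed: "\<psi> i l \<in> carrier Q" if "i < length Ls" "l \<in> carrier (Ls ! i)" for i l
    using that one by (simp add: \<psi>_def Q_def)
  have \<psi>_mult: "\<psi> i (l \<otimes>\<^bsub>Ls ! i\<^esub> m) = \<psi> i l \<otimes>\<^bsub>Q\<^esub> \<psi> i m" if "i < length Ls" for i l m
    unfolding \<psi>_def Q_def mult_product_group by (rule restrict_ext) (use one in simp)
  have ehom: "e \<in> hom Q (image_group e Q)" using inj_imp_image_group_iso[OF e] by (simp add: iso_def)
  show ?thesis
  proof (intro exI[of _ "image_group e Q"] exI[of _ "\<lambda>i l. e (\<psi> i l)"] conjI allI impI)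
    show "group (image_group e Q)" by (rule Q.inj_imp_image_group_is_group[OF e])
    show "finite (carrier (image_group e Q))" using fin by (simp add: image_group_carrier)
    fix i assume i: "i < length Ls"
    show "(\<lambda>l. e (\<psi> i l)) \<in> hom (Ls ! i) (image_group e Q)"
      using ehom \<psi>_closed[OF i] \<psi>_mult[OF i] by (auto simp: hom_def)
    show "inj_on (\<lambda>l. e (\<psi> i l)) (carrier (Ls ! i))"
    proof (rule inj_onI)
      fix l m assume l: "l \<in> carrier (Ls ! i)" and m: "m \<in> carrier (Ls ! i)" and "e (\<psi> i l) = e (\<psi> i m)"
      then have "\<psi> i l = \<psi> i m" using inj_onD[OF e] \<psi>_closed[OF i] by blast
      then have "\<psi> i l i = \<psi> i m i" by simp
      then show "l = m" using i by (simp add: \<psi>_def)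
    qed
  qed
qed

text \<open>In \<open>G / H i\<close> the trivial coset has stabilizer \<open>H i\<close>, an
  isomorphic image of \<open>Ls ! i\<close>, and the action is transitive. The index is kept as a
  first component because a coset may occur for several \<open>i\<close>; the resulting finite set
  is copied into the infinite type \<open>'x\<close>.\<close>

lemma realization_exists:
  fixes Ls :: "('g :: infinite) monoid list"
  assumes R: "cring R" and Ls: "\<And>L. L \<in> set Ls \<Longrightarrow> group L \<and> finite (carrier L)"
  shows "\<exists>G (X :: ('g, 'x :: infinite) gset) \<phi> x. orbit_decomposition R G X (length Ls) (\<lambda>i. Ls ! i) \<phi> x"
proof -
  obtain G :: "'g monoid" and \<phi> where G: "group G" "finite (carrier G)"
    and \<phi>: "\<And>i. i < length Ls \<Longrightarrow> \<phi> i \<in> hom (Ls ! i) G" "\<And>i. i < length Ls \<Longrightarrow> inj_on (\<phi> i) (carrier (Ls ! i))"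
    using embed_groups[OF Ls] by blast
  interpret G: group G by fact
  have L: "group (Ls ! i)" if "i < length Ls" for i using Ls that by simp
  define H where "H i = \<phi> i ` carrier (Ls ! i)" for i
  have H: "subgroup (H i) G" if "i < length Ls" for i
    unfolding H_def using L[OF that] \<phi>(1)[OF that] G.is_group
    by (intro group_hom.img_is_subgroup) (simp add: group_hom_def group_hom_axioms_def)
  note Hsub = subgroup.subset[OF H]
  define Y :: "('g, nat \<times> 'g set) gset" where "Y = \<lparr>pts = (SIGMA i:{..<length Ls}. (\<lambda>g. g <#\<^bsub>G\<^esub> H i) ` carrier G),
    act = (\<lambda>g. restrict (\<lambda>(i, c). (i, g <#\<^bsub>G\<^esub> c)) (SIGMA i:{..<length Ls}. (\<lambda>g. g <#\<^bsub>G\<^esub> H i) ` carrier G))\<rparr>"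
  have Ypts: "(i, g <#\<^bsub>G\<^esub> H i) \<in> pts Y" if "i < length Ls" "g \<in> carrier G" for i g
    using that by (simp add: Y_def)
  have Yact: "act Y a (i, g <#\<^bsub>G\<^esub> H i) = (i, (a \<otimes>\<^bsub>G\<^esub> g) <#\<^bsub>G\<^esub> H i)"
    if "i < length Ls" "g \<in> carrier G" "a \<in> carrier G" for i g a
    using that Hsub by (simp add: Y_def G.lcos_m_assoc)
  have YE: "\<exists>i g. i < length Ls \<and> g \<in> carrier G \<and> s = (i, g <#\<^bsub>G\<^esub> H i)" if "s \<in> pts Y" for s
    using that by (auto simp: Y_def)
  have Y: "finite_gset G Y"
  proof (rule finite_gsetI[OF G(1)])
    show "finite (pts Y)" using G(2) by (simp add: Y_def)
    fix g show "act Y g \<in> extensional (pts Y)" by (simp add: Y_def)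
  next
    fix s assume "s \<in> pts Y"
    then obtain i a where s: "i < length Ls" "a \<in> carrier G" "s = (i, a <#\<^bsub>G\<^esub> H i)" using YE by blast
    show "act Y \<one>\<^bsub>G\<^esub> s = s" using s by (simp add: Yact)
    fix g assume g: "g \<in> carrier G"
    show "act Y g s \<in> pts Y" using s g by (simp add: Yact Ypts)
    fix h assume "h \<in> carrier G"
    then show "act Y (g \<otimes>\<^bsub>G\<^esub> h) s = act Y g (act Y h s)" using s g by (simp add: Yact G.m_assoc)
  qed
  obtain e :: "nat \<times> 'g set \<Rightarrow> 'x" where e: "inj_on e (pts Y)"
    using finite_inj_into_infinite[OF finite_gsetD(2)[OF Y]] by blast
  define X where "X = \<lparr>pts = e ` pts Y, act = (\<lambda>g. restrict (\<lambda>t. e (act Y g (inv_into (pts Y) e t))) (e ` pts Y))\<rparr>"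
  have X: "finite_gset G X" and Xact: "\<And>s g. s \<in> pts Y \<Longrightarrow> act X g (e s) = e (act Y g s)"
    using finite_gset_transport[OF Y e, of X] by (simp_all add: X_def)
  define x where "x i = e (i, \<one>\<^bsub>G\<^esub> <#\<^bsub>G\<^esub> H i)" for i
  have xact: "act X g (x i) = e (i, g <#\<^bsub>G\<^esub> H i)" if "i < length Ls" "g \<in> carrier G" for i g
    unfolding x_def using Xact[OF Ypts[OF that(1) G.one_closed]] Yact[OF that(1) G.one_closed that(2)] that by simp
  have stab: "g <#\<^bsub>G\<^esub> H i = \<one>\<^bsub>G\<^esub> <#\<^bsub>G\<^esub> H i \<longleftrightarrow> g \<in> H i" if "i < length Ls" "g \<in> carrier G" for i g
  proof -
    have "g \<in> g <#\<^bsub>G\<^esub> H i"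
      using subgroup.one_closed[OF H[OF that(1)]] that(2) by (force simp: l_coset_def)
    then show ?thesis
      using G.coset_join3[OF that(2) H[OF that(1)]] G.lcos_mult_one[OF Hsub[OF that(1)]] by auto
  qed
  have "orbit_decomposition R G X (length Ls) (\<lambda>i. Ls ! i) \<phi> x"
  proof (rule orbit_decomposition.intro, goal_cases)
    case (7 i)
    then show ?case using Ypts by (simp add: X_def x_def)
  next
    case (8 i)
    have "act X g (x i) = x i \<longleftrightarrow> g \<in> H i" if "g \<in> carrier G" for g
      using 8 that xact[OF 8 that] inj_on_eq_iff[OF e Ypts[OF 8 that] Ypts[OF 8 G.one_closed]] stab[OF 8 that]
      by (simp add: x_def)
    then show ?case using Hsub[OF 8] by (auto simp: H_def[symmetric])
  next
    case (9 y)
    then obtain s where "s \<in> pts Y" "y = e s" by (auto simp: X_def)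
    then obtain i g where "i < length Ls" "g \<in> carrier G" "y = e (i, g <#\<^bsub>G\<^esub> H i)" using YE by blast
    then show ?case using xact by metis
  next
    case (10 i j g)
    then have "e (i, g <#\<^bsub>G\<^esub> H i) = e (j, \<one>\<^bsub>G\<^esub> <#\<^bsub>G\<^esub> H j)" using xact by (simp add: x_def)
    then show ?case using inj_onD[OF e] Ypts 10 by blast
  qed (use R X G L \<phi> in auto)
  then show ?thesis by blast
qed

theorem theorem3p12:
  fixes R :: "('r, 's) ring_scheme"
  assumes "cring R"
  shows "linear_equivalent R
    (span_category R ::
      ('g::infinite monoid \<times> ('g, 'x::infinite) gset,
       ('r \<times> ('g \<times> 'g, nat, 'x \<times> 'x) over_gset frag set) frag set, 'r) lincat)
    (additive_completion
      (biset_category R ::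
        ('g monoid, ('r \<times> ('g \<times> 'g, nat) gset frag set) frag set, 'r) lincat))"
proof -
  \<comment> \<open>Any element of \<open>'x\<close> can serve as the base point; all that matters
    is that it is the same for every group.\<close>
  let ?p = "undefined :: 'x"
  interpret biproduct_cover R
    "span_category R :: ('g monoid \<times> ('g, 'x) gset,
      ('r \<times> ('g \<times> 'g, nat, 'x \<times> 'x) over_gset frag set) frag set, 'r) lincat"
    "biset_category R :: ('g monoid, ('r \<times> ('g \<times> 'g, nat) gset frag set) frag set, 'r) lincat"
    "\<lambda>G. (G, point_gset ?p)" "\<lambda>G H. forget_map R (H \<times>\<times> G) (?p, ?p)"
    by (rule biproduct_cover_span_biset[OF assms])
  show ?thesis
  proof (rule additive_completion_equivalence)
    fix X' :: "'g monoid \<times> ('g, 'x) gset"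
    assume "X' \<in> Obj (span_category R)"
    then obtain G X where X: "X' = (G, X)" "finite_gset G X" "finite (carrier G)"
      using span_category_simps(1)[OF assms] by (cases X') blast
    then obtain Ls :: "'g monoid list" and \<phi> x where "orbit_decomposition R G X (length Ls) (\<lambda>i. Ls ! i) \<phi> x"
      "\<forall>L \<in> set Ls. finite (carrier L)"
      using decomposition_exists[OF assms X(2,3)] by blast
    then show "\<exists>Ls \<iota> \<pi>. decomposition X' Ls \<iota> \<pi>"
      unfolding X(1) by (intro exI[of _ Ls] orbit_decomposition_imp_decomposition) auto
  next
    fix Ls :: "'g monoid list"
    assume "Ls \<in> lists (Obj (biset_category R))"
    then have Ls: "group L \<and> finite (carrier L)" if "L \<in> set Ls" for L
      using that biset_category_simps(1)[OF assms] by (auto simp: in_lists_conv_set)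
    then obtain G and X :: "('g, 'x) gset" and \<phi> x where
      "orbit_decomposition R G X (length Ls) (\<lambda>i. Ls ! i) \<phi> x"
      using realization_exists[OF assms] by blast
    then show "\<exists>X' \<iota> \<pi>. decomposition X' Ls \<iota> \<pi>"
      using Ls by (intro exI[of _ "(G, X)"] orbit_decomposition_imp_decomposition) auto
  qed
qed

end
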